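(* Let $(\Omega,\mathcal{A},\mu)$ be a probability space, let $T$ be a non-empty set, let $X \subseteq \mathbb{R}^T$ be a separable reproducing kernel Banach space, and let $\xi : T \times \Omega \to \mathbb{R}$ be a centered Gaussian process with covariance function $K$. Then the following are equivalent: (1) There exists a centered Gaussian random element $\eta : \Omega \to X$ such that for every $t\in T$ one has $\xi_t = \eta_t$ $\mu$-almost surely. (2) $H(K) \subseteq X$ and the embedding $\iota : H(K) \to X$ is $\gamma$-radonifying.
   Context: All vector spaces are real. A Banach space $X$ that is a linear subspace of $\mathbb{R}^T$ (real functions on $T$) is a reproducing kernel Banach space if for every $t\in T$ the evaluation functional $\delta_t : X \to \mathbb{R}$, $x \mapsto x(t)$, is continuous. Random processes: a random process is a function $\xi : T\times\Omega\to\mathbb{R}$ such that $\xi_t := \xi(t,\cdot)$ is $\mathcal{A}$-measurable for each $t\in T$. It is a centered Gaussian process if $(\xi_t)_{t\in T_0}$ is a centered (possibly degenerate) Gaussian vector for each finite $T_0\subseteq T$; its covariance function is $K(s,t)=\int_\Omega \xi_s\xi_t\,d\mu$, which is a positive definite function, i.e. $\sum_{s,t\in T_0}c_sc_tK(s,t)\ge 0$ for all finite $T_0\subseteq T$ and real $(c_t)_{t\in T_0}$. $H(K)$: for positive definite $K:T\times T\to\mathbb{R}$, $H(K)\subseteq\mathbb{R}^T$ is the unique Hilbert space of functions on $T$ with $K(\cdot,t)\in H(K)$ for all $t \in T$ and $(x,K(\cdot,t))_{H(K)}=x(t)$ for all $x\in H(K)$, $t\in T$. When $H(K)\subseteq X$,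 $\iota:H(K)\to X$ is the inclusion (automatically continuous by the closed graph theorem). Gaussian random elements: a random element in $X$ is a map $\eta:\Omega\to X$ measurable with respect to $\mathcal{A}$ and the $\sigma$-algebra generated by $X^*$ (which equals the Borel $\sigma$-algebra since $X$ is separable). It is centered Gaussian if $f\circ\eta$ is a centered (possibly degenerate) Gaussian random variable for every $f\in X^*$. We write $\eta_t(\omega)=\eta(\omega)(t)$. $\gamma$-radonifying operators: let $H$ be a Hilbert space and $(\xi_k)$ a sequence of independent standard Gaussian random variables on some probability space, with expectation denoted $\mathbb{E}$. For a bounded linear $A:H\to X$ put $\|A\|_{\gamma_\infty(H,X)}=\sup\big(\mathbb{E}\|\sum_{k=1}^n\xi_kAh_k\|_X^2\big)^{1/2}$, the supremum being over all finite orthonormal systems $(h_k)_{k=1}^n$ in $H$; $\gamma_\infty(H,X)$ is the normed space of all $A$ for which this is finite. $A$ is $\gamma$-radonifying if it belongs to the closure in $\gamma_\infty(H,X)$ of the bounded finite-rank operators. *)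

theory Defs
  imports "HOL-Probability.Probability" "HOL-Library.Function_Algebras"
begin

text \<open>The vector space of all real functions on an index type, with pointwise operations
  (addition comes from \<^theory>\<open>HOL-Library.Function_Algebras\<close>).\<close>

instantiation "fun" :: (type, scaleR) scaleR
begin

definition scaleR_fun :: "real \<Rightarrow> ('a \<Rightarrow> 'b) \<Rightarrow> 'a \<Rightarrow> 'b"
  where "scaleR_fun c f = (\<lambda>x. c *\<^sub>R f x)"

instance ..

end

instance "fun" :: (type, real_vector) real_vector
  by standard (auto simp: scaleR_fun_def fun_eq_iff scaleR_add_right scaleR_add_left)


section \<open>Reproducing kernel Banach spaces\<close>

text \<open>A Banach space of functions on the type \<^typ>\<open>'t\<close> is given by a Banach space type \<^typ>\<open>'x\<close>
  and the injective linear map \<open>emb\<close> that sends an element to the function it is; as a subset of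
  the space of all functions it is \<open>range emb\<close>.\<close>

definition rkbs :: "('x::banach \<Rightarrow> 't \<Rightarrow> real) \<Rightarrow> bool"
  where "rkbs emb \<longleftrightarrow>
    linear emb \<and> inj emb \<and> (\<forall>t. continuous_on UNIV (\<lambda>x. emb x t))"


section \<open>Gaussian variables, processes and random elements\<close>

definition centered_gaussian :: "'w measure \<Rightarrow> ('w \<Rightarrow> real) \<Rightarrow> bool"
  where "centered_gaussian M Y \<longleftrightarrow>
    Y \<in> borel_measurable M \<and>
    ((AE \<omega> in M. Y \<omega> = 0) \<or> (\<exists>\<sigma>>0. distributed M lborel Y (normal_density 0 \<sigma>)))"

text \<open>A finite family is a (possibly degenerate) centered Gaussian vector iff all its linear
  combinations are (possibly degenerate) centered Gaussian variables.\<close>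

definition centered_gaussian_vector :: "'w measure \<Rightarrow> 'i set \<Rightarrow> ('i \<Rightarrow> 'w \<Rightarrow> real) \<Rightarrow> bool"
  where "centered_gaussian_vector M I Y \<longleftrightarrow>
    (\<forall>c :: 'i \<Rightarrow> real. centered_gaussian M (\<lambda>\<omega>. \<Sum>i\<in>I. c i * Y i \<omega>))"

definition centered_gaussian_process :: "'w measure \<Rightarrow> ('t \<Rightarrow> 'w \<Rightarrow> real) \<Rightarrow> bool"
  where "centered_gaussian_process M \<xi> \<longleftrightarrow>
    (\<forall>t. \<xi> t \<in> borel_measurable M) \<and>
    (\<forall>T\<^sub>0. finite T\<^sub>0 \<longrightarrow> centered_gaussian_vector M T\<^sub>0 \<xi>)"

definition covariance_function :: "'w measure \<Rightarrow> ('t \<Rightarrow> 'w \<Rightarrow> real) \<Rightarrow> 't \<Rightarrow> 't \<Rightarrow> real"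
  where "covariance_function M \<xi> s t = (\<integral>\<omega>. \<xi> s \<omega> * \<xi> t \<omega> \<partial>M)"

definition dual_algebra :: "'x::real_normed_vector measure"
  where "dual_algebra =
    sigma UNIV {f -` B | (f :: 'x \<Rightarrow> real) B. bounded_linear f \<and> B \<in> sets borel}"

definition centered_gaussian_element :: "'w measure \<Rightarrow> ('w \<Rightarrow> 'x::real_normed_vector) \<Rightarrow> bool"
  where "centered_gaussian_element M \<eta> \<longleftrightarrow>
    \<eta> \<in> measurable M dual_algebra \<and>
    (\<forall>f. bounded_linear f \<longrightarrow> centered_gaussian M (f \<circ> \<eta>))"


section \<open>Hilbert spaces on a carrier and the reproducing kernel Hilbert space\<close>

text \<open>The inner product \<open>ip\<close> matters only on the carrier \<open>V\<close>.\<close>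

definition hilbert_on :: "'h::real_vector set \<Rightarrow> ('h \<Rightarrow> 'h \<Rightarrow> real) \<Rightarrow> bool"
  where "hilbert_on V ip \<longleftrightarrow>
    subspace V \<and>
    (\<forall>x\<in>V. \<forall>y\<in>V. ip x y = ip y x) \<and>
    (\<forall>x\<in>V. \<forall>y\<in>V. \<forall>z\<in>V. ip (x + y) z = ip x z + ip y z) \<and>
    (\<forall>c. \<forall>x\<in>V. \<forall>y\<in>V. ip (c *\<^sub>R x) y = c * ip x y) \<and>
    (\<forall>x\<in>V. 0 \<le> ip x x) \<and>
    (\<forall>x\<in>V. ip x x = 0 \<longrightarrow> x = 0) \<and>
    (\<forall>u :: nat \<Rightarrow> 'h. (\<forall>n. u n \<in> V) \<longrightarrow>
      (\<forall>e>0. \<exists>N. \<forall>m\<ge>N. \<forall>n\<ge>N. sqrt (ip (u m - u n) (u m - u n)) < e) \<longrightarrow>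
      (\<exists>l\<in>V. (\<lambda>n. sqrt (ip (u n - l) (u n - l))) \<longlonglongrightarrow> 0))"

definition is_rkhs :: "('t \<Rightarrow> 't \<Rightarrow> real) \<Rightarrow> ('t \<Rightarrow> real) set \<Rightarrow>
    (('t \<Rightarrow> real) \<Rightarrow> ('t \<Rightarrow> real) \<Rightarrow> real) \<Rightarrow> bool"
  where "is_rkhs K V ip \<longleftrightarrow>
    hilbert_on V ip \<and>
    (\<forall>t. (\<lambda>s. K s t) \<in> V) \<and>
    (\<forall>x\<in>V. \<forall>t. ip x (\<lambda>s. K s t) = x t)"

text \<open>For positive definite \<open>K\<close> there is exactly one carrier with exactly one inner product on it
  satisfying \<open>is_rkhs\<close> (Moore-Aronszajn). The choice below therefore only concerns the
  values of the inner product outside the carrier, which are never used.\<close>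

definition rkhs_structure :: "('t \<Rightarrow> 't \<Rightarrow> real) \<Rightarrow>
    ('t \<Rightarrow> real) set \<times> (('t \<Rightarrow> real) \<Rightarrow> ('t \<Rightarrow> real) \<Rightarrow> real)"
  where "rkhs_structure K = (SOME p. is_rkhs K (fst p) (snd p))"

definition rkhs :: "('t \<Rightarrow> 't \<Rightarrow> real) \<Rightarrow> ('t \<Rightarrow> real) set"
  where "rkhs K = fst (rkhs_structure K)"

definition rkhs_inner :: "('t \<Rightarrow> 't \<Rightarrow> real) \<Rightarrow> ('t \<Rightarrow> real) \<Rightarrow> ('t \<Rightarrow> real) \<Rightarrow> real"
  where "rkhs_inner K = snd (rkhs_structure K)"


section \<open>Radonifying operators\<close>

text \<open>Operators on the Hilbert space \<open>(V, ip)\<close> are functions on the ambient type of which only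
  the restriction to \<open>V\<close> matters.\<close>

definition bounded_operator_on ::
    "'h::real_vector set \<Rightarrow> ('h \<Rightarrow> 'h \<Rightarrow> real) \<Rightarrow> ('h \<Rightarrow> 'x::real_normed_vector) \<Rightarrow> bool"
  where "bounded_operator_on V ip A \<longleftrightarrow>
    (\<forall>x\<in>V. \<forall>y\<in>V. A (x + y) = A x + A y) \<and>
    (\<forall>c. \<forall>x\<in>V. A (c *\<^sub>R x) = c *\<^sub>R A x) \<and>
    (\<exists>C. \<forall>x\<in>V. norm (A x) \<le> C * sqrt (ip x x))"

definition finite_rank_on :: "'h set \<Rightarrow> ('h \<Rightarrow> 'x::real_vector) \<Rightarrow> bool"
  where "finite_rank_on V A \<longleftrightarrow> (\<exists>F. finite F \<and> A ` V \<subseteq> span F)"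

definition orthonormal_on ::
    "'h set \<Rightarrow> ('h \<Rightarrow> 'h \<Rightarrow> real) \<Rightarrow> nat \<Rightarrow> (nat \<Rightarrow> 'h) \<Rightarrow> bool"
  where "orthonormal_on V ip n h \<longleftrightarrow>
    (\<forall>i<n. h i \<in> V) \<and> (\<forall>i<n. \<forall>j<n. ip (h i) (h j) = (if i = j then 1 else 0))"

text \<open>The coordinates on this space are a sequence of independent standard Gaussian variables;
  the expectations below depend only on the joint law of such a sequence.\<close>

definition gaussian_seq :: "(nat \<Rightarrow> real) measure"
  where "gaussian_seq = (\<Pi>\<^sub>M k\<in>UNIV. density lborel std_normal_density)"

definition gamma_norm ::
    "'h set \<Rightarrow> ('h \<Rightarrow> 'h \<Rightarrow> real) \<Rightarrow> ('h \<Rightarrow> 'x::{banach,second_countable_topology}) \<Rightarrow> ennreal"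
  where "gamma_norm V ip A =
    (SUP (n, h) \<in> {(n, h). orthonormal_on V ip n h}.
      ennreal (sqrt (\<integral>g. (norm (\<Sum>k<n. g k *\<^sub>R A (h k)))\<^sup>2 \<partial>gaussian_seq)))"

definition gamma_infinity ::
    "'h::real_vector set \<Rightarrow> ('h \<Rightarrow> 'h \<Rightarrow> real) \<Rightarrow> ('h \<Rightarrow> 'x::{banach,second_countable_topology}) set"
  where "gamma_infinity V ip = {A. bounded_operator_on V ip A \<and> gamma_norm V ip A < \<infinity>}"

definition gamma_radonifying ::
    "'h::real_vector set \<Rightarrow> ('h \<Rightarrow> 'h \<Rightarrow> real) \<Rightarrow> ('h \<Rightarrow> 'x::{banach,second_countable_topology}) \<Rightarrow> bool"
  where "gamma_radonifying V ip A \<longleftrightarrow>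
    A \<in> gamma_infinity V ip \<and>
    (\<forall>e>0. \<exists>B\<in>gamma_infinity V ip.
      finite_rank_on V B \<and> gamma_norm V ip (\<lambda>h. A h - B h) < ennreal e)"

end

theory Submission
  imports Defs
begin

text \<open>
  The space \<open>H(K)\<close> is isometric, via \<open>x \<mapsto> J x\<close> with \<open>E (J x * \<xi> t) = x t\<close>, to the closed linear span of
  the process in \<open>L\<^sup>2\<close>, which consists of jointly Gaussian variables.

  Given \<open>\<eta>\<close>, Fernique's theorem makes \<open>\<eta>\<close> square integrable, and \<open>\<iota> x = E (J x * \<eta>)\<close>. For orthonormal
  \<open>Z k\<close> in the Gaussian space let \<open>S = (\<Sum>k. Z k * E (Z k * \<eta>))\<close>. The reflection \<open>\<eta> - 2 * S\<close> has the same
  law as \<open>\<eta>\<close>, so by convexity \<open>E (norm S)\<^sup>2 \<le> E (norm \<eta>)\<^sup>2\<close>, which bounds the \<open>\<gamma>\<close>-norm of \<open>\<iota>\<close>. The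
  same reflection, applied to the distance from a compact convex set which almost carries \<open>\<eta>\<close>,
  shows that \<open>\<eta> - S\<close> is small in \<open>L\<^sup>2\<close> for suitable \<open>Z\<close>. The operator \<open>x \<mapsto> E (J x * S)\<close> has finite
  rank and is \<open>\<gamma>\<close>-close to \<open>\<iota>\<close>.

  Conversely, a finite rank operator \<open>B\<close> satisfies \<open>B x = (\<Sum>k. (x, h k) * B (h k))\<close> for a finite
  orthonormal system \<open>h\<close> and yields the random element \<open>\<Sum>k. J (h k) * B (h k)\<close>. The \<open>L\<^sup>2\<close>-distance
  of two such elements is at most the \<open>\<gamma>\<close>-norm of the difference of the operators, so
  approximations of \<open>\<iota>\<close> give a Cauchy sequence; its limit is \<open>\<eta>\<close>.
\<close>

section \<open>Norming functionals\<close>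

text \<open>Laws on \<open>'x\<close> are determined by their characteristic functionals, so two
  centered Gaussian elements have the same law as soon as every functional has the same variance
  under both. This drives the reflection: for each \<open>f\<close>, the variable \<open>f S\<close>
  is the orthogonal projection of \<open>f \<eta>\<close> onto the span of the \<open>Z k\<close>,
  and subtracting a projection twice preserves the variance. Now \<open>S\<close> is half the
  difference, and \<open>\<eta> - S\<close> half the sum, of \<open>\<eta>\<close> and its
  reflection, so convex quantities are controlled by \<open>\<eta>\<close> alone. The two directions
  use different Gaussian spaces. Given \<open>\<eta>\<close>, it is the closure of all
  \<open>f \<eta>\<close>: reflections are then Gaussian for every functional without approximating
  functionals by evaluations, and the process lies in it because evaluations are functionals. Given
  the embedding, it is the closed span of the process. In the converse the approximating operators
  come with unrelated orthonormal systems. Their random sums can be compared because, almost surely,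
  such a sum does not change when it is rewritten in any larger system.\<close>

definition sublinear :: "('x::real_vector \<Rightarrow> real) \<Rightarrow> bool"
  where "sublinear p \<longleftrightarrow>
    (\<forall>x y. p (x + y) \<le> p x + p y) \<and> (\<forall>c x. 0 \<le> c \<longrightarrow> p (c *\<^sub>R x) \<le> c * p x)"

lemma sublinear_add: "sublinear p \<Longrightarrow> p (x + y) \<le> p x + p y"
  by (simp add: sublinear_def)

text \<open>\<open>sublinear\<close> asks for homogeneity only as an inequality, the form that
  infima inherit at once. Applying the inequality to \<open>inverse c\<close> gives the other
  direction.\<close>

lemma sublinear_scaleR:
  assumes "sublinear p" and "0 \<le> c"
  shows "p (c *\<^sub>R x) = c * p x"
proof (cases "c = 0")
  case True
  have "p 0 \<le> 0"
    using assms(1) unfolding sublinear_def by (metis mult_zero_left order_refl scaleR_zero_left)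
  moreover have "p 0 \<le> p 0 + p 0"
    using sublinear_add[OF assms(1), of 0 0] by simp
  ultimately show ?thesis using True by simp
next
  case False
  have "0 \<le> inverse c" using assms(2) by simp
  then have "p (inverse c *\<^sub>R (c *\<^sub>R x)) \<le> inverse c * p (c *\<^sub>R x)"
    using assms(1) unfolding sublinear_def by blast
  with False have "p x \<le> inverse c * p (c *\<^sub>R x)" by simp
  with False assms(2) have "c * p x \<le> p (c *\<^sub>R x)"
    by (simp add: field_simps)
  moreover have "p (c *\<^sub>R x) \<le> c * p x"
    using assms unfolding sublinear_def by blast
  ultimately show ?thesis by simp
qed

lemma sublinear_0: "sublinear p \<Longrightarrow> p 0 = 0"
  using sublinear_scaleR[of p 0 0] by simp

lemma sublinear_minus_le: "sublinear p \<Longrightarrow> - p (- x) \<le> p x"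
  using sublinear_add[of p x "- x"] sublinear_0[of p] by simp

text \<open>The infimum of \<open>p (z + t *\<^sub>R y) - t * p y\<close> over \<open>t\<close> at
  least 0 pushes \<open>p\<close> towards additivity in the direction \<open>y\<close>. The choice
  \<open>t = 0\<close> gives \<open>q \<le> p\<close>, and \<open>t = 1\<close> gives the last
  inequality. The infimum is finite because every term is at least \<open>- p (- z)\<close>.\<close>

lemma sublinear_lower:
  fixes p :: "'x::real_vector \<Rightarrow> real"
  assumes p: "sublinear p"
  shows "\<exists>q. sublinear q \<and> q \<le> p \<and> (\<forall>z. q z \<le> p (z + y) - p y)"
proof -
  define q where "q z = (INF t\<in>{0..}. p (z + t *\<^sub>R y) - t * p y)" for z
  have bdd: "bdd_below ((\<lambda>t. p (z + t *\<^sub>R y) - t * p y) ` {0..})" for z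
  proof (rule bdd_belowI2)
    fix t :: real assume "t \<in> {0..}"
    then have "t * p y = p (t *\<^sub>R y)" using sublinear_scaleR[OF p] by simp
    also have "\<dots> = p ((z + t *\<^sub>R y) + (- z))" by simp
    also have "\<dots> \<le> p (z + t *\<^sub>R y) + p (- z)" by (rule sublinear_add[OF p])
    finally show "- p (- z) \<le> p (z + t *\<^sub>R y) - t * p y" by simp
  qed
  have q_le: "q z \<le> p (z + t *\<^sub>R y) - t * p y" if "0 \<le> t" for z t
    unfolding q_def by (rule cINF_lower[OF bdd]) (use that in auto)
  have q_ge: "c \<le> q z" if "\<And>t. 0 \<le> t \<Longrightarrow> c \<le> p (z + t *\<^sub>R y) - t * p y" for c z
    unfolding q_def by (rule cINF_greatest) (use that in auto)
  have q_add: "q (z + w) \<le> q z + q w" for z w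
  proof -
    have "q (z + w) - q w \<le> p (z + s *\<^sub>R y) - s * p y" if s: "0 \<le> s" for s
    proof -
      have "q (z + w) - (p (z + s *\<^sub>R y) - s * p y) \<le> q w"
      proof (rule q_ge)
        fix t :: real assume t: "0 \<le> t"
        have "q (z + w) \<le> p (z + w + (s + t) *\<^sub>R y) - (s + t) * p y"
          using q_le s t by simp
        also have "p (z + w + (s + t) *\<^sub>R y) = p ((z + s *\<^sub>R y) + (w + t *\<^sub>R y))"
          by (simp add: algebra_simps)
        also have "\<dots> \<le> p (z + s *\<^sub>R y) + p (w + t *\<^sub>R y)" by (rule sublinear_add[OF p])
        finally show "q (z + w) - (p (z + s *\<^sub>R y) - s * p y) \<le> p (w + t *\<^sub>R y) - t * p y"
          by (simp add: algebra_simps)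
      qed
      then show ?thesis by simp
    qed
    then have "q (z + w) - q w \<le> q z" by (rule q_ge)
    then show ?thesis by simp
  qed
  have q_scale: "q (c *\<^sub>R z) \<le> c * q z" if c: "0 \<le> c" for c z
  proof (cases "c = 0")
    case True
    then show ?thesis using q_le[of 0 0] sublinear_0[OF p] by simp
  next
    case False
    with c have c: "0 < c" by simp
    have "q (c *\<^sub>R z) / c \<le> q z"
    proof (rule q_ge)
      fix t :: real assume t: "0 \<le> t"
      have "q (c *\<^sub>R z) \<le> p (c *\<^sub>R z + (c * t) *\<^sub>R y) - (c * t) * p y"
        using q_le t c by simp
      also have "c *\<^sub>R z + (c * t) *\<^sub>R y = c *\<^sub>R (z + t *\<^sub>R y)" by (simp add: scaleR_add_right)
      also have "p \<dots> = c * p (z + t *\<^sub>R y)" using sublinear_scaleR[OF p] c by simp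
      finally show "q (c *\<^sub>R z) / c \<le> p (z + t *\<^sub>R y) - t * p y"
        using c by (simp add: field_simps)
    qed
    then show ?thesis using c by (simp add: field_simps)
  qed
  have "sublinear q" using q_add q_scale by (simp add: sublinear_def)
  moreover have "q \<le> p" using q_le[of 0] by (simp add: le_fun_def)
  moreover have "\<forall>z. q z \<le> p (z + y) - p y" using q_le[of 1] by simp
  ultimately show ?thesis by blast
qed

text \<open>The pointwise infimum works: of two members of a chain the smaller one can be used in
  both arguments, which keeps subadditivity, and \<open>- p0 (- x)\<close> is a common lower bound
  at \<open>x\<close>.\<close>

lemma sublinear_INF_chain:
  assumes C: "C \<noteq> {}" "\<And>p. p \<in> C \<Longrightarrow> sublinear p \<and> p \<le> p0"
    and chain: "\<And>p q. p \<in> C \<Longrightarrow> q \<in> C \<Longrightarrow> p \<le> q \<or> q \<le> p"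
  shows "\<exists>q. sublinear q \<and> q \<le> p0 \<and> (\<forall>p\<in>C. q \<le> p)"
proof -
  define q where "q x = (INF p\<in>C. p x)" for x
  have bdd: "bdd_below ((\<lambda>p. p x) ` C)" for x
  proof (rule bdd_belowI2)
    fix p assume "p \<in> C"
    then have "p (- x) \<le> p0 (- x)" "- p (- x) \<le> p x"
      using C(2) sublinear_minus_le by (auto simp: le_fun_def)
    then show "- p0 (- x) \<le> p x" by simp
  qed
  have q_le: "q x \<le> p x" if "p \<in> C" for p x
    unfolding q_def by (rule cINF_lower[OF bdd that])
  have q_ge: "c \<le> q x" if "\<And>p. p \<in> C \<Longrightarrow> c \<le> p x" for c x
    unfolding q_def by (rule cINF_greatest[OF C(1) that])
  have "q (x + y) \<le> q x + q y" for x y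
  proof -
    have *: "q (x + y) \<le> p x + p' y" if "p \<in> C" "p' \<in> C" for p p'
    proof -
      from chain[OF that] show ?thesis
      proof
        assume "p \<le> p'"
        moreover have "q (x + y) \<le> p x + p y"
          using q_le[OF that(1)] sublinear_add C(2)[OF that(1)] by (meson order_trans)
        ultimately show ?thesis by (smt (verit) le_funD)
      next
        assume "p' \<le> p"
        moreover have "q (x + y) \<le> p' x + p' y"
          using q_le[OF that(2)] sublinear_add C(2)[OF that(2)] by (meson order_trans)
        ultimately show ?thesis by (smt (verit) le_funD)
      qed
    qed
    have "q (x + y) - q y \<le> p x" if "p \<in> C" for p
    proof -
      have "q (x + y) - p x \<le> q y" by (rule q_ge) (use *[OF that] in \<open>smt (verit)\<close>)
      then show ?thesis by simp
    qed
    then have "q (x + y) - q y \<le> q x" by (rule q_ge)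
    then show ?thesis by simp
  qed
  moreover have "q (c *\<^sub>R x) \<le> c * q x" if c: "0 \<le> c" for c x
  proof (cases "c = 0")
    case True
    obtain p where "p \<in> C" using C(1) by auto
    then show ?thesis using True q_le[of p 0] C(2) sublinear_0[of p] by auto
  next
    case False
    with c have c: "0 < c" by simp
    have "q (c *\<^sub>R x) / c \<le> q x"
    proof (rule q_ge)
      fix p assume "p \<in> C"
      then have "q (c *\<^sub>R x) \<le> c * p x"
        using q_le[of p "c *\<^sub>R x"] sublinear_scaleR[of p c x] C(2) c by simp
      then show "q (c *\<^sub>R x) / c \<le> p x" using c by (simp add: field_simps)
    qed
    then show ?thesis using c by (simp add: field_simps)
  qed
  ultimately have "sublinear q" by (simp add: sublinear_def)
  moreover have "q \<le> p" if "p \<in> C" for p using q_le[OF that] by (simp add: le_fun_def)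
  moreover have "q \<le> p0" using C calculation(2) by (meson all_not_in_conv order_trans)
  ultimately show ?thesis by blast
qed

text \<open>A minimal sublinear functional is linear, by \<open>sublinear_lower\<close>.\<close>

lemma linear_below_sublinear:
  fixes p0 :: "'x::real_vector \<Rightarrow> real"
  assumes p0: "sublinear p0"
  shows "\<exists>f. linear f \<and> f \<le> p0"
proof -
  define A where "A = {p. sublinear p \<and> p \<le> p0}"
  have "\<exists>m\<in>A. \<forall>a\<in>A. a \<le> m \<longrightarrow> a = m"
  \<comment> \<open>Zorn's lemma for the reversed order, so that a maximal element is a minimal
    functional.\<close>
  proof (rule predicate_Zorn)
    show "partial_order_on A (relation_of (\<lambda>p q. q \<le> p) A)"
      by (rule partial_order_on_relation_ofI) auto
    fix C assume C: "C \<in> Chains (relation_of (\<lambda>p q. q \<le> p) A)"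
    show "\<exists>u\<in>A. \<forall>a\<in>C. u \<le> a"
    proof (cases "C = {}")
      case True
      then show ?thesis using p0 by (auto simp: A_def)
    next
      case False
      then have "\<exists>q. sublinear q \<and> q \<le> p0 \<and> (\<forall>p\<in>C. q \<le> p)"
        using C by (intro sublinear_INF_chain) (auto simp: Chains_def relation_of_def A_def)
      then show ?thesis by (auto simp: A_def)
    qed
  qed
  then obtain f where f: "sublinear f" "f \<le> p0"
    and min: "\<And>q. sublinear q \<Longrightarrow> q \<le> p0 \<Longrightarrow> q \<le> f \<Longrightarrow> q = f"
    by (auto simp: A_def)
  have add: "f (z + y) = f z + f y" for z y
  proof -
    obtain q where "sublinear q" "q \<le> f" "\<forall>z. q z \<le> f (z + y) - f y"
      using sublinear_lower[OF f(1)] by blast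
    then have "f z \<le> f (z + y) - f y" using min f(2) by (metis order_trans)
    then show ?thesis using sublinear_add[OF f(1), of z y] by simp
  qed
  have minus: "f (- z) = - f z" for z
    using add[of z "- z"] sublinear_0[OF f(1)] by simp
  have "f (c *\<^sub>R z) = c * f z" for c z
  proof (cases "0 \<le> c")
    case False
    then have "f (- ((- c) *\<^sub>R z)) = - ((- c) * f z)"
      unfolding minus using sublinear_scaleR[OF f(1), of "- c" z] by simp
    then show ?thesis by simp
  qed (rule sublinear_scaleR[OF f(1)])
  then have "linear f" using add by (intro linearI) auto
  with f(2) show ?thesis by blast
qed

text \<open>Hahn-Banach without extension from a subspace: the norm is first lowered in the
  direction \<open>x\<close>. A linear \<open>f\<close> below the result satisfies
  \<open>f (- x) \<le> norm (- x + x) - norm x\<close>, that is,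
  \<open>norm x \<le> f x\<close>.\<close>

lemma norming_functional:
  fixes x :: "'x::real_normed_vector"
  obtains f where "bounded_linear f" "f x = norm x" "\<And>y. \<bar>f y\<bar> \<le> norm y"
proof -
  have "sublinear (norm :: 'x \<Rightarrow> real)"
    by (auto simp: sublinear_def norm_triangle_ineq)
  then obtain q where q: "sublinear q" "q \<le> norm" "\<And>z. q z \<le> norm (z + x) - norm x"
    using sublinear_lower by blast
  obtain f where f: "linear f" "f \<le> q" using linear_below_sublinear[OF q(1)] by blast
  have le: "f y \<le> norm y" for y using f(2) q(2) by (meson le_funD order_trans)
  have abs: "\<bar>f y\<bar> \<le> norm y" for y
    using le[of y] le[of "- y"] linear_neg[OF f(1), of y] by auto
  have "f (- x) \<le> - norm x" using f(2) q(3)[of "- x"] by (simp add: le_fun_def) (smt (verit))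
  then have "f x = norm x" using le[of x] linear_neg[OF f(1), of x] by simp
  moreover have "bounded_linear f"
    using f(1) abs by (intro bounded_linear_intro[where K = 1]) (auto simp: linear_add linear_cmul)
  ultimately show ?thesis using that abs by blast
qed

text \<open>By separability a closed ball is a countable intersection of half-spaces, given by the
  functionals that norm the points of a countable dense set \<open>D\<close>. Open sets are
  countable unions of closed balls with centres in \<open>D\<close> and rational radii.\<close>

lemma sets_dual_algebra:
  "sets (dual_algebra :: 'x::{real_normed_vector, second_countable_topology} measure) = sets borel"
proof
  have sets_eq: "sets (dual_algebra :: 'x measure) =
      sigma_sets UNIV {f -` B | (f :: 'x \<Rightarrow> real) B. bounded_linear f \<and> B \<in> sets borel}"
    unfolding dual_algebra_def by (rule sets_measure_of) auto
  show "sets (dual_algebra :: 'x measure) \<subseteq> sets borel"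
    unfolding sets_eq
  proof (rule sets.sigma_sets_subset[of _ borel, unfolded space_borel], safe)
    fix f :: "'x \<Rightarrow> real" and B :: "real set"
    assume "bounded_linear f" "B \<in> sets borel"
    then have "f \<in> borel_measurable borel"
      by (intro borel_measurable_continuous_onI linear_continuous_on) 
    then show "f -` B \<in> sets borel" using \<open>B \<in> sets borel\<close>
      by (auto dest: measurable_sets)
  qed
  have half: "{x :: 'x. f x \<le> r} \<in> sets dual_algebra" if "bounded_linear f" for f and r :: real
    unfolding sets_eq using that
    by (intro sigma_sets.Basic) (auto intro!: exI[of _ f] exI[of _ "{..r}"])
  obtain D :: "'x set" where D: "countable D" "\<And>X. open X \<Longrightarrow> X \<noteq> {} \<Longrightarrow> \<exists>d\<in>D. d \<in> X"
    by (erule countable_dense_setE)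
  have dense: "\<exists>d\<in>D. norm (x - d) < e" if "0 < e" for x :: 'x and e
    using D(2)[of "ball x e"] that by (auto simp: dist_norm)
  obtain F where F: "\<And>d :: 'x. bounded_linear (F d)" "\<And>d. F d d = norm d" "\<And>d y. \<bar>F d y\<bar> \<le> norm y"
    using norming_functional by metis
  have cball: "cball a r \<in> sets dual_algebra" for a :: 'x and r
  proof -
    have "cball a r = (\<Inter>d\<in>D. {x. F d x \<le> r + F d a})"
    proof (intro set_eqI iffI)
      fix x assume "x \<in> cball a r"
      then have "norm (x - a) \<le> r" by (simp add: dist_norm norm_minus_commute)
      then have "F d (x - a) \<le> r" for d using F(3)[of d "x - a"] by simp
      then show "x \<in> (\<Inter>d\<in>D. {x. F d x \<le> r + F d a})"
        using linear_diff[OF bounded_linear.linear[OF F(1)]] by (simp add: algebra_simps)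
    next
      fix x assume x: "x \<in> (\<Inter>d\<in>D. {x. F d x \<le> r + F d a})"
      \<comment> \<open>The point \<open>d\<close> is taken close to \<open>x - a\<close>, not to
        \<open>x\<close>, so that \<open>F d\<close> nearly norms \<open>x - a\<close>. Replacing
        \<open>x - a\<close> by \<open>d\<close> costs \<open>e\<close> once in the norm and once
        under \<open>F d\<close>.\<close>
      have "norm (x - a) \<le> r + 2 * e" if e: "0 < e" for e
      proof -
        obtain d where d: "d \<in> D" "norm (x - a - d) < e" using dense[OF e] by blast
        have "norm (x - a) \<le> norm d + e" using d(2) norm_triangle_ineq2[of "x - a" d] by simp
        also have "norm d = F d d" by (rule F(2)[symmetric])
        also have "F d d = F d (x - a) - F d (x - a - d)"
          using linear_diff[OF bounded_linear.linear[OF F(1)[of d]], of "x - a" d] by simp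
        also have "- F d (x - a - d) \<le> e" using F(3)[of d "x - a - d"] d(2) by simp
        then have "F d (x - a) - F d (x - a - d) + e \<le> F d (x - a) + e + e" by simp
        also have "F d (x - a) \<le> r"
          using x d(1) linear_diff[OF bounded_linear.linear[OF F(1)[of d]], of x a] by auto
        finally show ?thesis by simp
      qed
      then have "norm (x - a) \<le> r + e" if "0 < e" for e
        using that by (metis field_sum_of_halves half_gt_zero mult_2)
      then have "norm (x - a) \<le> r" by (rule field_le_epsilon)
      then show "x \<in> cball a r" by (simp add: dist_norm norm_minus_commute)
    qed
    moreover have "(\<Inter>d\<in>D. {x. F d x \<le> r + F d a}) \<in> sets dual_algebra"
    proof -
      have "D \<noteq> {}" using D(2)[of UNIV] by auto
      then show ?thesis using D(1) half[OF F(1)] by (intro sets.countable_INT') auto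
    qed
    ultimately show ?thesis by simp
  qed
  show "sets borel \<subseteq> sets (dual_algebra :: 'x measure)"
  proof -
    have "U \<in> sets dual_algebra" if U: "open U" for U :: "'x set"
    proof -
      define I where "I = {(d, q). d \<in> D \<and> q \<in> \<rat> \<and> cball d q \<subseteq> U}"
      have "countable I"
        by (rule countable_subset[of _ "D \<times> \<rat>"]) (auto simp: I_def D(1) countable_rat)
      moreover have "U = (\<Union>(d, q)\<in>I. cball d q)"
      proof (intro set_eqI iffI)
        fix x assume "x \<in> U"
        then obtain e where e: "0 < e" "ball x e \<subseteq> U" using U openE by blast
        \<comment> \<open>The upper bound keeps \<open>cball d q\<close> inside
          \<open>ball x e\<close> although \<open>x\<close> is not its centre; the lower bound keeps
          the radius positive, so that density supplies \<open>d\<close>.\<close>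
        obtain q where q: "q \<in> \<rat>" "e / 4 < q" "q < e / 2" using Rats_dense_in_real[of "e/4" "e/2"] e(1) by auto
        with e(1) obtain d where d: "d \<in> D" "norm (x - d) < q" using dense[of q x] by auto
        have "cball d q \<subseteq> ball x e"
        proof
          fix y assume "y \<in> cball d q"
          then show "y \<in> ball x e" using d(2) q(3) dist_triangle[of x y d]
            by (simp add: dist_norm) 
        qed
        then have "(d, q) \<in> I" using d q e(2) by (auto simp: I_def)
        moreover have "x \<in> cball d q" using d(2) by (simp add: dist_norm norm_minus_commute)
        ultimately show "x \<in> (\<Union>(d, q)\<in>I. cball d q)" by blast
      qed (auto simp: I_def)
      moreover have "(\<Union>(d, q)\<in>I. cball d q) \<in> sets dual_algebra"
        using cball by (intro sets.countable_UN'[OF \<open>countable I\<close>]) auto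
      ultimately show ?thesis by simp
    qed
    then have "sigma_sets (space (dual_algebra :: 'x measure)) {S. open S} \<subseteq> sets (dual_algebra :: 'x measure)"
      by (intro sets.sigma_sets_subset) auto
    moreover have "space (dual_algebra :: 'x measure) = UNIV"
      unfolding dual_algebra_def by (rule space_measure_of) auto
    ultimately show ?thesis by (simp add: sets_borel)
  qed
qed

section \<open>Laws on a separable Banach space\<close>

lemma cexp_integrable:
  fixes w :: "'w \<Rightarrow> real"
  assumes "integrable M w" and [measurable]: "a \<in> borel_measurable M"
  shows "complex_integrable M (\<lambda>x. complex_of_real (w x) * iexp (a x))"
proof (rule Bochner_Integration.integrable_bound[OF assms(1)])
  have [measurable]: "w \<in> borel_measurable M" using assms(1) by simp
  show "(\<lambda>x. complex_of_real (w x) * iexp (a x)) \<in> borel_measurable M" by measurable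
  show "AE x in M. norm (complex_of_real (w x) * iexp (a x)) \<le> norm (w x)"
    by (simp add: norm_mult)
qed

text \<open>The case \<open>u = 0\<close> of the hypothesis shows that both weights have the same
  total mass \<open>c\<close>. Dividing by \<open>c\<close> yields probability measures on the line
  with equal characteristic functions. If \<open>c = 0\<close>, both weights vanish almost
  everywhere.\<close>

lemma weighted_char_unique:
  fixes w :: "'w \<Rightarrow> real" and v :: "'v \<Rightarrow> real"
  assumes w: "integrable M w" "\<And>x. 0 \<le> w x" and v: "integrable N v" "\<And>x. 0 \<le> v x"
    and a[measurable]: "a \<in> borel_measurable M" and b[measurable]: "b \<in> borel_measurable N"
    and eq: "\<And>u. (\<integral>x. complex_of_real (w x) * iexp (u * a x) \<partial>M)
                 = (\<integral>x. complex_of_real (v x) * iexp (u * b x) \<partial>N)"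
    and A[measurable]: "A \<in> sets borel"
  shows "(\<integral>x. w x * indicator A (a x) \<partial>M) = (\<integral>x. v x * indicator A (b x) \<partial>N)"
proof -
  have [measurable]: "w \<in> borel_measurable M" "v \<in> borel_measurable N" using w v by simp_all
  define c where "c = (\<integral>x. w x \<partial>M)"
  have "complex_of_real (\<integral>x. w x \<partial>M) = complex_of_real (\<integral>x. v x \<partial>N)"
    using eq[of 0] by simp
  then have cv: "c = (\<integral>x. v x \<partial>N)" unfolding c_def of_real_eq_iff .
  have "0 \<le> c" unfolding c_def using w(2) by simp
  show ?thesis
  proof (cases "c = 0")
    case True
    have "AE x in M. w x = 0"
      using True integral_nonneg_eq_0_iff_AE[OF w(1)] w(2) by (simp add: c_def)
    then have "(\<integral>x. w x * indicator A (a x) \<partial>M) = (\<integral>x. 0 \<partial>M)"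
      by (intro integral_cong_AE) auto
    moreover have "AE x in N. v x = 0"
      using True integral_nonneg_eq_0_iff_AE[OF v(1)] v(2) by (simp add: cv)
    then have "(\<integral>x. v x * indicator A (b x) \<partial>N) = (\<integral>x. 0 \<partial>N)"
      by (intro integral_cong_AE) auto
    ultimately show ?thesis by simp
  next
    case False
    with \<open>0 \<le> c\<close> have c: "0 < c" by simp
    have real_dist: "real_distribution (distr (density L (\<lambda>x. ennreal (z x / c))) borel e)"
      if z: "integrable L z" "\<And>x. 0 \<le> z x" "(\<integral>x. z x \<partial>L) = c"
        and [measurable]: "e \<in> borel_measurable L" for L :: "'z measure" and z :: "'z \<Rightarrow> real" and e :: "'z \<Rightarrow> real"
    proof -
      have [measurable]: "z \<in> borel_measurable L" using z by simp
      have "(\<integral>\<^sup>+x. ennreal (z x / c) \<partial>L) = ennreal (\<integral>x. z x / c \<partial>L)"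
        using z c by (intro nn_integral_eq_integral) auto
      also have "(\<integral>x. z x / c \<partial>L) = 1" using z c by simp
      finally have "prob_space (density L (\<lambda>x. ennreal (z x / c)))"
        by (intro prob_spaceI) (simp add: emeasure_density)
      then have "prob_space (distr (density L (\<lambda>x. ennreal (z x / c))) borel e)"
        by (rule prob_space.prob_space_distr) simp
      then show ?thesis by (simp add: real_distribution_def real_distribution_axioms_def)
    qed
    define P where "P = distr (density M (\<lambda>x. ennreal (w x / c))) borel a"
    define Q where "Q = distr (density N (\<lambda>x. ennreal (v x / c))) borel b"
    have P: "real_distribution P" unfolding P_def
      by (rule real_dist) (use w in \<open>auto simp: c_def\<close>)
    have Q: "real_distribution Q" unfolding Q_def
      by (rule real_dist) (use v in \<open>auto simp: cv\<close>)
    have charP: "char P u = (\<integral>x. complex_of_real (w x) * iexp (u * a x) \<partial>M) / c" for u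
    proof -
      have "char P u = (\<integral>x. iexp (u * a x) \<partial>density M (\<lambda>x. ennreal (w x / c)))"
        unfolding char_def P_def by (subst integral_distr) auto
      also have "\<dots> = (\<integral>x. (w x / c) *\<^sub>R iexp (u * a x) \<partial>M)"
        using w c by (subst integral_density) auto
      also have "\<dots> = (\<integral>x. (complex_of_real (w x) * iexp (u * a x)) / c \<partial>M)"
        by (simp add: scaleR_conv_of_real)
      finally show ?thesis by simp
    qed
    have charQ: "char Q u = (\<integral>x. complex_of_real (v x) * iexp (u * b x) \<partial>N) / c" for u
    proof -
      have "char Q u = (\<integral>x. iexp (u * b x) \<partial>density N (\<lambda>x. ennreal (v x / c)))"
        unfolding char_def Q_def by (subst integral_distr) auto
      also have "\<dots> = (\<integral>x. (v x / c) *\<^sub>R iexp (u * b x) \<partial>N)"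
        using v c by (subst integral_density) auto
      also have "\<dots> = (\<integral>x. (complex_of_real (v x) * iexp (u * b x)) / c \<partial>N)"
        by (simp add: scaleR_conv_of_real)
      finally show ?thesis by simp
    qed
    have "char P = char Q" by (rule ext) (simp only: charP charQ eq)
    then have "P = Q" by (rule Levy_uniqueness[OF P Q])
    have "(\<integral>x. indicator A x \<partial>P) = (\<integral>x. w x * indicator A (a x) \<partial>M) / c"
      unfolding P_def using w c by (subst integral_distr) (auto simp: integral_density)
    moreover have "(\<integral>x. indicator A x \<partial>Q) = (\<integral>x. v x * indicator A (b x) \<partial>N) / c"
      unfolding Q_def using v c by (subst integral_distr) (auto simp: integral_density)
    ultimately show ?thesis using \<open>P = Q\<close> c by simp
  qed
qed

text \<open>The weights \<open>2 + cos (\<theta> - \<phi>)\<close> are positive and combinations of characters, so the uniqueness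
  theorem on the line applies to them; in this way half-spaces can be intersected one at a time
  without a multivariate inversion theorem.\<close>

lemma char_cylinder_step:
  fixes P Q :: "'x::real_normed_vector measure" and f \<theta> :: "'x \<Rightarrow> real"
  assumes "prob_space P" "prob_space Q" and sets: "sets P = sets borel" "sets Q = sets borel"
    and D: "D \<in> sets borel"
    and eq: "\<And>\<theta>. bounded_linear \<theta> \<Longrightarrow>
      (\<integral>x. complex_of_real (indicator D x) * iexp (\<theta> x) \<partial>P)
      = (\<integral>x. complex_of_real (indicator D x) * iexp (\<theta> x) \<partial>Q)"
    and f: "bounded_linear f" and A: "A \<in> sets borel" and \<theta>: "bounded_linear \<theta>"
  shows "(\<integral>x. complex_of_real (indicator (D \<inter> f -` A) x) * iexp (\<theta> x) \<partial>P)
      = (\<integral>x. complex_of_real (indicator (D \<inter> f -` A) x) * iexp (\<theta> x) \<partial>Q)"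
proof -
  interpret P: prob_space P by fact
  interpret Q: prob_space Q by fact
  note [measurable] = D A
  note [simp] = sets
  have meas[measurable]: "g \<in> borel_measurable borel" if "bounded_linear g" for g :: "'x \<Rightarrow> real"
    using that by (intro borel_measurable_continuous_onI linear_continuous_on) auto
  have measP: "g \<in> borel_measurable P" "g \<in> borel_measurable Q" if "bounded_linear g" for g :: "'x \<Rightarrow> real"
    using meas[OF that] measurable_cong_sets[OF sets(1) refl] measurable_cong_sets[OF sets(2) refl] by auto
  note [measurable] = measP[OF f] measP[OF \<theta>]
  have [measurable]: "D \<in> sets P" "D \<in> sets Q" by (simp_all add: D)
  \<comment> \<open>Only \<open>\<alpha> = 1\<close> and \<open>\<alpha> = 0\<close> matter: both
    weights are nonnegative, and the difference of the two resulting identities isolates the cosine,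
    which changes sign and could not serve as a weight itself.\<close>
  define W where "W \<phi> \<alpha> x = indicator D x * (2 + \<alpha> * cos (\<theta> x - \<phi>))" for \<phi> \<alpha> x
  have W_nonneg: "0 \<le> W \<phi> \<alpha> x" if "\<bar>\<alpha>\<bar> \<le> 1" for \<phi> \<alpha> x
  proof -
    have "\<bar>\<alpha> * cos (\<theta> x - \<phi>)\<bar> \<le> 1 * 1"
      unfolding abs_mult by (rule mult_mono) (use that in auto)
    then show ?thesis by (simp add: W_def)
  qed
  have iP: "integrable P (\<lambda>x. indicator D x * g x)" "integrable Q (\<lambda>x. indicator D x * g x)"
    if "g \<in> borel_measurable P" "g \<in> borel_measurable Q" "\<And>x. \<bar>g x\<bar> \<le> 4" for g :: "'x \<Rightarrow> real"
    using that by (auto intro!: P.integrable_const_bound[of _ 4] Q.integrable_const_bound[of _ 4]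
        split: split_indicator simp: indicator_def)
  have bd: "\<bar>2 + \<alpha> * cos (\<theta> x - \<phi>)\<bar> \<le> 4" if "\<bar>\<alpha>\<bar> \<le> 1" for \<alpha> \<phi> x
  proof -
    have "\<bar>\<alpha> * cos (\<theta> x - \<phi>)\<bar> \<le> 1 * 1"
      unfolding abs_mult by (rule mult_mono) (use that in auto)
    then show ?thesis by simp
  qed
  have W_int: "integrable P (W \<phi> \<alpha>)" "integrable Q (W \<phi> \<alpha>)" if "\<bar>\<alpha>\<bar> \<le> 1" for \<phi> \<alpha>
    unfolding W_def using bd[OF that] by (intro iP; simp)+
  have iD: "integrable P (indicator D :: _ \<Rightarrow> real)" "integrable Q (indicator D :: _ \<Rightarrow> real)"
    using iP[of "\<lambda>_. 1", OF borel_measurable_const borel_measurable_const] by (simp_all only: mult_1_right)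
  have W_eq: "(\<integral>x. W \<phi> \<alpha> x * indicator A (f x) \<partial>P) = (\<integral>x. W \<phi> \<alpha> x * indicator A (f x) \<partial>Q)"
    if \<alpha>: "\<bar>\<alpha>\<bar> \<le> 1" for \<phi> \<alpha>
  proof (rule weighted_char_unique)
    fix u :: real
    \<comment> \<open>Weight times character of \<open>f\<close> is a combination of characters of
      \<open>u * f x + s * \<theta> x\<close> with \<open>s\<close> equal to 0, 1 and -1. These are
      again functionals, so the hypothesis on \<open>D\<close> applies to each term.\<close>
    let ?b = "\<lambda>s x. complex_of_real (indicator D x) * iexp (u * f x + s * \<theta> x)"
    have bl: "bounded_linear (\<lambda>x. u * f x + s * \<theta> x)" for s
      using f \<theta> by (intro bounded_linear_add bounded_linear_const_mult)
    have "complex_of_real (W \<phi> \<alpha> x) * iexp (u * f x)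
        = 2 * ?b 0 x + \<alpha> / 2 * iexp (- \<phi>) * ?b 1 x + \<alpha> / 2 * iexp \<phi> * ?b (- 1) x" for x
    proof -
      have "complex_of_real (cos (\<theta> x - \<phi>)) = (iexp (\<theta> x - \<phi>) + iexp (- (\<theta> x - \<phi>))) / 2"
        unfolding cos_of_real[symmetric] cos_exp_eq by (simp add: algebra_simps)
      also have "iexp (\<theta> x - \<phi>) = iexp (\<theta> x) * iexp (- \<phi>)"
        by (simp add: exp_add[symmetric] algebra_simps)
      also have "iexp (- (\<theta> x - \<phi>)) = iexp (- \<theta> x) * iexp \<phi>"
        by (simp add: exp_add[symmetric] algebra_simps)
      finally have c: "complex_of_real (cos (\<theta> x - \<phi>))
          = (iexp (\<theta> x) * iexp (- \<phi>) + iexp (- \<theta> x) * iexp \<phi>) / 2" .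
      define E p m where "E = iexp (u * f x)" and "p = iexp (\<theta> x)" and "m = iexp (- \<theta> x)"
      have e: "iexp (u * f x + 0 * \<theta> x) = E" "iexp (u * f x + 1 * \<theta> x) = E * p"
          "iexp (u * f x + (- 1) * \<theta> x) = E * m"
        unfolding E_def p_def m_def by (simp_all add: exp_add[symmetric] algebra_simps)
      have "complex_of_real (W \<phi> \<alpha> x)
          = complex_of_real (indicator D x) * (2 + complex_of_real \<alpha> * ((p * iexp (- \<phi>) + m * iexp \<phi>) / 2))"
        unfolding W_def p_def m_def c[symmetric] by simp
      then show ?thesis unfolding e E_def[symmetric]
        by (simp add: algebra_simps add_divide_distrib)
    qed
    then have expand: "(\<lambda>x. complex_of_real (W \<phi> \<alpha> x) * iexp (u * f x))
        = (\<lambda>x. 2 * ?b 0 x + \<alpha> / 2 * iexp (- \<phi>) * ?b 1 x + \<alpha> / 2 * iexp \<phi> * ?b (- 1) x)"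
      by (rule ext)
    have int: "complex_integrable P (?b s)" "complex_integrable Q (?b s)" for s
      using cexp_integrable[OF iD(1) measP(1)[OF bl]] cexp_integrable[OF iD(2) measP(2)[OF bl]]
      by auto
    have expP: "(\<integral>x. complex_of_real (W \<phi> \<alpha> x) * iexp (u * f x) \<partial>P)
      = 2 * integral\<^sup>L P (?b 0) + \<alpha> / 2 * iexp (- \<phi>) * integral\<^sup>L P (?b 1) + \<alpha> / 2 * iexp \<phi> * integral\<^sup>L P (?b (- 1))"
      unfolding expand
      by (simp only: Bochner_Integration.integral_add Bochner_Integration.integrable_add
          integrable_mult_right int integral_mult_right_zero)
    have expQ: "(\<integral>x. complex_of_real (W \<phi> \<alpha> x) * iexp (u * f x) \<partial>Q)
      = 2 * integral\<^sup>L Q (?b 0) + \<alpha> / 2 * iexp (- \<phi>) * integral\<^sup>L Q (?b 1) + \<alpha> / 2 * iexp \<phi> * integral\<^sup>L Q (?b (- 1))"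
      unfolding expand
      by (simp only: Bochner_Integration.integral_add Bochner_Integration.integrable_add
          integrable_mult_right int integral_mult_right_zero)
    have "integral\<^sup>L P (?b s) = integral\<^sup>L Q (?b s)" for s by (rule eq[OF bl])
    then show "(\<integral>x. complex_of_real (W \<phi> \<alpha> x) * iexp (u * f x) \<partial>P)
        = (\<integral>x. complex_of_real (W \<phi> \<alpha> x) * iexp (u * f x) \<partial>Q)"
      by (simp only: expP expQ)
  qed (use W_int[OF \<alpha>] W_nonneg[OF \<alpha>] in auto)
  define E where "E = D \<inter> f -` A"
  have E: "E \<in> sets P" "E \<in> sets Q" unfolding E_def
    using measurable_sets[OF meas[OF f] A] D by auto
  note [measurable] = E
  have cos_eq: "(\<integral>x. indicator E x * cos (\<theta> x - \<phi>) \<partial>P) = (\<integral>x. indicator E x * cos (\<theta> x - \<phi>) \<partial>Q)" for \<phi>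
  proof -
    have split: "(\<lambda>x. indicator E x * cos (\<theta> x - \<phi>)) =
      (\<lambda>x. W \<phi> 1 x * indicator A (f x) - W \<phi> 0 x * indicator A (f x))"
      by (auto simp: W_def E_def fun_eq_iff split: split_indicator)
    have sm: "W \<phi> \<alpha> x * indicator A (f x) = indicator D x * ((2 + \<alpha> * cos (\<theta> x - \<phi>)) * indicator A (f x))" for x \<alpha>
      by (simp add: W_def)
    have "integrable P (\<lambda>x. W \<phi> \<alpha> x * indicator A (f x))" "integrable Q (\<lambda>x. W \<phi> \<alpha> x * indicator A (f x))"
      if "\<bar>\<alpha>\<bar> \<le> 1" for \<alpha>
      unfolding sm using bd[OF that] by (intro iP; auto simp: indicator_def)+
    then show ?thesis unfolding split using W_eq[of 1 \<phi>] W_eq[of 0 \<phi>]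
      by (simp add: Bochner_Integration.integral_diff)
  qed
  \<comment> \<open>The phases 0 and \<open>pi / 2\<close> recover the real and the imaginary part
    of the character.\<close>
  have decomp: "complex_of_real (indicator E x) * iexp (\<theta> x)
      = complex_of_real (indicator E x * cos (\<theta> x - 0)) + \<i> * complex_of_real (indicator E x * cos (\<theta> x - pi / 2))" for x
  proof -
    have "cos (\<theta> x - pi / 2) = sin (\<theta> x)" by (simp add: cos_diff)
    then show ?thesis by (simp add: exp_Euler cos_of_real sin_of_real algebra_simps)
  qed
  have ic: "integrable P (\<lambda>x. indicator E x * cos (\<theta> x - \<phi>))" "integrable Q (\<lambda>x. indicator E x * cos (\<theta> x - \<phi>))" for \<phi>
    by (auto intro!: P.integrable_const_bound[of _ 1] Q.integrable_const_bound[of _ 1] simp: indicator_def)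
  have iC: "complex_integrable P (\<lambda>x. complex_of_real (indicator E x * cos (\<theta> x - \<phi>)))"
      "complex_integrable Q (\<lambda>x. complex_of_real (indicator E x * cos (\<theta> x - \<phi>)))" for \<phi>
    by (rule integrable_of_real, rule ic)+
  show ?thesis unfolding E_def[symmetric] decomp
    by (simp only: Bochner_Integration.integral_add iC integrable_mult_right
        integral_mult_right_zero integral_complex_of_real cos_eq)
qed

lemma char_functional_unique:
  fixes P Q :: "'x::{real_normed_vector, second_countable_topology} measure"
  assumes P: "prob_space P" and Q: "prob_space Q" and sets: "sets P = sets borel" "sets Q = sets borel"
    and eq: "\<And>f. bounded_linear f \<Longrightarrow> (\<integral>x. iexp (f x) \<partial>P) = (\<integral>x. iexp (f x) \<partial>Q)"
  shows "P = Q"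
proof -
  interpret P: prob_space P by fact
  interpret Q: prob_space Q by fact
  define \<D> where "\<D> = {D \<in> sets borel. \<forall>\<theta>. bounded_linear \<theta> \<longrightarrow>
      (\<integral>x. complex_of_real (indicator D x) * iexp (\<theta> x) \<partial>P)
      = (\<integral>x. complex_of_real (indicator D x) * iexp (\<theta> x) \<partial>Q)}"
  define cyl where "cyl L = (\<Inter>(f, A)\<in>set L. f -` A)" for L :: "(('x \<Rightarrow> real) \<times> real set) list"
  define ok where "ok L \<longleftrightarrow> (\<forall>(f, A)\<in>set L. bounded_linear f \<and> A \<in> sets borel)" for L :: "(('x \<Rightarrow> real) \<times> real set) list"
  define E where "E = {cyl L | L. ok L}"
  have cyl_D: "cyl L \<in> \<D>" if "ok L" for L using that
  proof (induction L)
    case Nil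
    then show ?case using eq by (simp add: \<D>_def cyl_def)
  next
    case (Cons p L)
    obtain f A where p: "p = (f, A)" by (cases p)
    with Cons have *: "cyl L \<in> \<D>" "bounded_linear f" "A \<in> sets borel" by (auto simp: ok_def)
    have "f -` A \<in> sets borel"
      using measurable_sets[OF borel_measurable_continuous_onI[OF linear_continuous_on[OF *(2)]] *(3)] by simp
    moreover have "cyl (p # L) = cyl L \<inter> f -` A" by (auto simp: cyl_def p)
    ultimately show ?case
      using * char_cylinder_step[OF P Q sets, of "cyl L" f A] by (auto simp: \<D>_def)
  qed
  show ?thesis
  proof (rule measure_eqI_generator_eq[where E = E and \<Omega> = UNIV and A = "\<lambda>_. UNIV"])
    show "Int_stable E"
    proof (rule Int_stableI)
      fix a b assume "a \<in> E" "b \<in> E"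
      then obtain L L' where "a = cyl L" "ok L" "b = cyl L'" "ok L'" by (auto simp: E_def)
      then have "a \<inter> b = cyl (L @ L')" "ok (L @ L')" by (auto simp: cyl_def ok_def)
      then show "a \<inter> b \<in> E" by (auto simp: E_def)
    qed
    show "emeasure P X = emeasure Q X" if "X \<in> E" for X
    proof -
      have X: "X \<in> \<D>" using that cyl_D by (auto simp: E_def)
      have "(\<integral>x. complex_of_real (indicator X x) * iexp 0 \<partial>P)
          = (\<integral>x. complex_of_real (indicator X x) * iexp 0 \<partial>Q)"
        using X unfolding \<D>_def by (elim CollectE conjE allE[of _ "\<lambda>_. 0"]) (simp add: bounded_linear_zero)
      then have "measure P X = measure Q X"
        using X by (simp add: \<D>_def sets sets_eq_imp_space_eq[OF sets(1)] sets_eq_imp_space_eq[OF sets(2)])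
      then show ?thesis using X by (simp add: \<D>_def P.emeasure_eq_measure Q.emeasure_eq_measure)
    qed
    have "sigma_sets UNIV E = sets borel"
    proof
      show "sigma_sets UNIV E \<subseteq> sets borel"
        using cyl_D by (intro sets.sigma_sets_subset[of _ borel, unfolded space_borel]) (auto simp: E_def \<D>_def)
      have "sets borel = sets (dual_algebra :: 'x measure)" by (rule sets_dual_algebra[symmetric])
      also have "\<dots> = sigma_sets UNIV {f -` B | (f :: 'x \<Rightarrow> real) B. bounded_linear f \<and> B \<in> sets borel}"
        unfolding dual_algebra_def by (rule sets_measure_of) auto
      also have "\<dots> \<subseteq> sigma_sets UNIV E"
      proof (rule sigma_sets_mono', safe)
        fix f :: "'x \<Rightarrow> real" and B :: "real set" assume "bounded_linear f" "B \<in> sets borel"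
        then show "f -` B \<in> E" by (auto simp: E_def cyl_def ok_def intro!: exI[of _ "[(f, B)]"])
      qed
      finally show "sets borel \<subseteq> sigma_sets UNIV E" .
    qed
    then show "sets P = sigma_sets UNIV E" "sets Q = sigma_sets UNIV E" using sets by auto
    show "range (\<lambda>_. UNIV) \<subseteq> E" by (auto simp: E_def cyl_def ok_def intro!: exI[of _ "[]"])
  qed auto
qed

lemma distr_eqI_char:
  fixes \<zeta> :: "'w \<Rightarrow> 'x::{real_normed_vector, second_countable_topology}" and \<zeta>' :: "'v \<Rightarrow> 'x"
  assumes "prob_space M" "prob_space N"
    and [measurable]: "\<zeta> \<in> borel_measurable M" "\<zeta>' \<in> borel_measurable N"
    and eq: "\<And>f. bounded_linear f \<Longrightarrow> (\<integral>x. iexp (f (\<zeta> x)) \<partial>M) = (\<integral>x. iexp (f (\<zeta>' x)) \<partial>N)"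
  shows "distr M borel \<zeta> = distr N borel \<zeta>'"
proof (rule char_functional_unique)
  fix f :: "'x \<Rightarrow> real" assume f: "bounded_linear f"
  then have [measurable]: "f \<in> borel_measurable borel"
    by (intro borel_measurable_continuous_onI linear_continuous_on)
  show "(\<integral>x. iexp (f x) \<partial>distr M borel \<zeta>) = (\<integral>x. iexp (f x) \<partial>distr N borel \<zeta>')"
    by (simp add: integral_distr eq[OF f])
qed (use assms in \<open>auto intro: prob_space.prob_space_distr\<close>)

section \<open>Semi-inner products\<close>

text \<open>Definiteness is left out because random variables are kept as functions and not
  identified almost surely. One set of lemmas then serves square integrable functions, Gaussian
  spaces and the carrier of a Hilbert space.\<close>

locale semi_inner_on =
  fixes V :: "'h::real_vector set" and ip :: "'h \<Rightarrow> 'h \<Rightarrow> real"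
  assumes subspace: "subspace V"
    and ip_sym: "x \<in> V \<Longrightarrow> y \<in> V \<Longrightarrow> ip x y = ip y x"
    and ip_add: "x \<in> V \<Longrightarrow> y \<in> V \<Longrightarrow> z \<in> V \<Longrightarrow> ip (x + y) z = ip x z + ip y z"
    and ip_scaleR: "x \<in> V \<Longrightarrow> y \<in> V \<Longrightarrow> ip (c *\<^sub>R x) y = c * ip x y"
    and ip_nonneg: "x \<in> V \<Longrightarrow> 0 \<le> ip x x"
begin

lemmas V_0 = subspace_0[OF subspace]
lemmas V_add = subspace_add[OF subspace]
lemmas V_scaleR = subspace_scale[OF subspace]
lemmas V_diff = subspace_diff[OF subspace]
lemmas V_sum = subspace_sum[OF subspace]

lemma ip_0: "y \<in> V \<Longrightarrow> ip 0 y = 0"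
  using ip_scaleR[of y y 0] by simp

lemma ip_diff: "x \<in> V \<Longrightarrow> y \<in> V \<Longrightarrow> z \<in> V \<Longrightarrow> ip (x - y) z = ip x z - ip y z"
  using ip_add[of x "- 1 *\<^sub>R y" z] ip_scaleR[of y z "- 1"] V_scaleR[of y "- 1"] by simp

lemma ip_add_right: "x \<in> V \<Longrightarrow> y \<in> V \<Longrightarrow> z \<in> V \<Longrightarrow> ip z (x + y) = ip z x + ip z y"
  using ip_add[of x y z] ip_sym V_add by metis

lemma ip_diff_right: "x \<in> V \<Longrightarrow> y \<in> V \<Longrightarrow> z \<in> V \<Longrightarrow> ip z (x - y) = ip z x - ip z y"
  using ip_diff[of x y z] ip_sym V_diff by metis

lemma ip_scaleR_right: "x \<in> V \<Longrightarrow> y \<in> V \<Longrightarrow> ip y (c *\<^sub>R x) = c * ip y x"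
  using ip_scaleR[of x y c] ip_sym V_scaleR by metis

lemma ip_sum: "(\<And>i. i \<in> I \<Longrightarrow> f i \<in> V) \<Longrightarrow> y \<in> V \<Longrightarrow> ip (\<Sum>i\<in>I. f i) y = (\<Sum>i\<in>I. ip (f i) y)"
proof (induction I rule: infinite_finite_induct)
  case (insert i I)
  then have "sum f I \<in> V" by (intro V_sum) auto
  with insert show ?case by (simp add: ip_add)
qed (auto simp: ip_0)

lemma ip_add_self: "x \<in> V \<Longrightarrow> y \<in> V \<Longrightarrow> ip (x + y) (x + y) = ip x x + 2 * ip x y + ip y y"
  by (simp add: ip_add ip_add_right V_add ip_sym[of y x])

lemma ip_diff_self: "x \<in> V \<Longrightarrow> y \<in> V \<Longrightarrow> ip (x - y) (x - y) = ip x x - 2 * ip x y + ip y y"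
  by (simp add: ip_diff ip_diff_right V_diff ip_sym[of y x])

lemma ip_add_self_le: "x \<in> V \<Longrightarrow> y \<in> V \<Longrightarrow> ip (x + y) (x + y) \<le> 2 * ip x x + 2 * ip y y"
  using ip_add_self[of x y] ip_diff_self[of x y] ip_nonneg[OF V_diff[of x y]] by simp

lemma ip_minus_commute: "x \<in> V \<Longrightarrow> y \<in> V \<Longrightarrow> ip (x - y) (x - y) = ip (y - x) (y - x)"
  by (simp add: ip_diff_self ip_sym)

lemma ip_diff_self_le:
  assumes "x \<in> V" "y \<in> V" "z \<in> V"
  shows "ip (x - z) (x - z) \<le> 2 * ip (x - y) (x - y) + 2 * ip (y - z) (y - z)"
  using ip_add_self_le[of "x - y" "y - z"] assms V_diff by simp

lemma ip_Cauchy_Schwarz: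
  assumes x: "x \<in> V" and y: "y \<in> V"
  shows "(ip x y)\<^sup>2 \<le> ip x x * ip y y"
proof -
  have q: "0 \<le> ip x x + 2 * t * ip x y + t\<^sup>2 * ip y y" for t
    using ip_nonneg[OF V_add[OF x V_scaleR[OF y, of t]]]
    by (simp add: ip_add_self ip_scaleR ip_scaleR_right V_scaleR x y power2_eq_square mult.assoc)
  show ?thesis
  proof (cases "ip y y = 0")
    case True
    have "ip x y = 0"
    proof (rule ccontr)
      assume "ip x y \<noteq> 0"
      \<comment> \<open>For a null \<open>y\<close> the bound \<open>q\<close> is affine in
        \<open>t\<close>, and this value of \<open>t\<close> makes it equal to -1.\<close>
      then have "2 * (- (ip x x + 1) / (2 * ip x y)) * ip x y = - (ip x x + 1)" by simp
      then show False using q[of "- (ip x x + 1) / (2 * ip x y)"] True by simp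
    qed
    then show ?thesis using True by simp
  next
    case False
    then have "0 < ip y y" using ip_nonneg[OF y] by simp
    then show ?thesis using q[of "- ip x y / ip y y"]
      by (simp add: power2_eq_square field_simps)
  qed
qed

lemma ip_Cauchy_Schwarz_sqrt:
  assumes "x \<in> V" "y \<in> V"
  shows "\<bar>ip x y\<bar> \<le> sqrt (ip x x) * sqrt (ip y y)"
  unfolding real_sqrt_mult[symmetric] using ip_Cauchy_Schwarz[OF assms] by (intro real_le_rsqrt) simp

lemma ip_null: "x \<in> V \<Longrightarrow> y \<in> V \<Longrightarrow> ip x x = 0 \<Longrightarrow> ip x y = 0"
  using ip_Cauchy_Schwarz[of x y] by simp

text \<open>Convergence is measured by the semi-inner product itself, since the carrier has no
  topology. The difference splits into three terms, each handled by Cauchy-Schwarz.\<close>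

lemma ip_tendsto:
  assumes u: "\<And>n. u n \<in> V" "x \<in> V" "(\<lambda>n. ip (u n - x) (u n - x)) \<longlonglongrightarrow> 0"
    and v: "\<And>n. v n \<in> V" "y \<in> V" "(\<lambda>n. ip (v n - y) (v n - y)) \<longlonglongrightarrow> 0"
  shows "(\<lambda>n. ip (u n) (v n)) \<longlonglongrightarrow> ip x y"
proof -
  define a b where "a n = sqrt (ip (u n - x) (u n - x))" and "b n = sqrt (ip (v n - y) (v n - y))" for n
  have a: "a \<longlonglongrightarrow> 0" and b: "b \<longlonglongrightarrow> 0"
    using tendsto_real_sqrt[OF u(3)] tendsto_real_sqrt[OF v(3)] by (simp_all add: a_def[abs_def] b_def[abs_def])
  have "ip (u n) (v n) - ip x y = ip (u n - x) (v n - y) + ip (u n - x) y + ip x (v n - y)" for n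
    using u v by (simp add: ip_diff ip_diff_right V_diff)
  moreover have "\<bar>ip (u n - x) (v n - y)\<bar> \<le> a n * b n" "\<bar>ip (u n - x) y\<bar> \<le> a n * sqrt (ip y y)"
      "\<bar>ip x (v n - y)\<bar> \<le> sqrt (ip x x) * b n" for n
    unfolding a_def b_def using u v V_diff by (auto intro!: ip_Cauchy_Schwarz_sqrt)
  ultimately have le: "\<bar>ip (u n) (v n) - ip x y\<bar> \<le> a n * b n + a n * sqrt (ip y y) + sqrt (ip x x) * b n" for n
    by (smt (verit))
  have "(\<lambda>n. a n * b n + a n * sqrt (ip y y) + sqrt (ip x x) * b n)
      \<longlonglongrightarrow> 0 * 0 + 0 * sqrt (ip y y) + sqrt (ip x x) * 0"
    by (intro tendsto_intros a b)
  then have z: "(\<lambda>n. a n * b n + a n * sqrt (ip y y) + sqrt (ip x x) * b n) \<longlonglongrightarrow> 0" by simp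
  have "(\<lambda>n. ip (u n) (v n) - ip x y) \<longlonglongrightarrow> 0"
    by (rule Lim_null_comparison[OF _ z]) (simp only: real_norm_def le eventually_True)
  then show ?thesis by (rule LIM_zero_cancel)
qed

lemma orthonormal_coeff:
  assumes h: "orthonormal_on V ip n h" and j: "j < n"
  shows "ip (\<Sum>k<n. c k *\<^sub>R h k) (h j) = c j"
proof -
  have hV: "h k \<in> V" if "k < n" for k using h that by (simp add: orthonormal_on_def)
  have "ip (\<Sum>k<n. c k *\<^sub>R h k) (h j) = (\<Sum>k<n. c k * (if k = j then 1 else 0))"
    using h j by (subst ip_sum) (auto simp: V_scaleR hV ip_scaleR orthonormal_on_def intro!: sum.cong)
  also have "\<dots> = c j" using j by (simp add: if_distrib sum.delta cong: if_cong)
  finally show ?thesis .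
qed

lemma orthonormal_residual:
  assumes h: "orthonormal_on V ip n h" and x: "x \<in> V"
  shows "x - (\<Sum>k<n. ip x (h k) *\<^sub>R h k) \<in> V"
    and "j < n \<Longrightarrow> ip (x - (\<Sum>k<n. ip x (h k) *\<^sub>R h k)) (h j) = 0"
proof -
  have hV: "h k \<in> V" if "k < n" for k using h that by (simp add: orthonormal_on_def)
  have s: "(\<Sum>k<n. ip x (h k) *\<^sub>R h k) \<in> V" by (intro V_sum V_scaleR) (use hV in auto)
  then show "x - (\<Sum>k<n. ip x (h k) *\<^sub>R h k) \<in> V" using x by (rule V_diff[rotated])
  show "ip (x - (\<Sum>k<n. ip x (h k) *\<^sub>R h k)) (h j) = 0" if "j < n"
    using orthonormal_coeff[OF h that, of "\<lambda>k. ip x (h k)"] by (simp add: ip_diff x s hV that)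
qed

text \<open>A vector whose residual is already null is skipped, so normalisation never divides by
  zero. Without definiteness the residuals are only null, not zero.\<close>

lemma gram_schmidt:
  assumes "finite P" "P \<subseteq> V"
  shows "\<exists>n h. orthonormal_on V ip n h \<and>
    (\<forall>p\<in>P. ip (p - (\<Sum>k<n. ip p (h k) *\<^sub>R h k)) (p - (\<Sum>k<n. ip p (h k) *\<^sub>R h k)) = 0)"
  using assms
proof (induction P rule: finite_induct)
  case empty
  show ?case by (intro exI[of _ 0]) (simp add: orthonormal_on_def)
next
  case (insert p P)
  then obtain n h where h: "orthonormal_on V ip n h"
    and P: "\<And>x. x \<in> P \<Longrightarrow> ip (x - (\<Sum>k<n. ip x (h k) *\<^sub>R h k)) (x - (\<Sum>k<n. ip x (h k) *\<^sub>R h k)) = 0"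
    by auto
  have p: "p \<in> V" and PV: "P \<subseteq> V" using insert by auto
  define r where "r x = x - (\<Sum>k<n. ip x (h k) *\<^sub>R h k)" for x
  have rV: "r x \<in> V" and rh: "j < n \<Longrightarrow> ip (r x) (h j) = 0" if "x \<in> V" for x j
    unfolding r_def using orthonormal_residual[OF h that] by auto
  have hV: "h k \<in> V" if "k < n" for k using h that by (simp add: orthonormal_on_def)
  show ?case
  proof (cases "ip (r p) (r p) = 0")
    case True
    then show ?thesis using h P unfolding r_def by blast
  next
    case False
    define s where "s = sqrt (ip (r p) (r p))"
    have "0 < ip (r p) (r p)" using False ip_nonneg[OF rV[OF p]] by simp
    then have s: "0 < s" "s * s = ip (r p) (r p)" by (simp_all add: s_def)
    define e where "e = (1 / s) *\<^sub>R r p"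
    define h' where "h' = h(n := e)"
    have eV: "e \<in> V" unfolding e_def by (intro V_scaleR rV p)
    have ee: "ip e e = 1" using s
      by (simp add: e_def ip_scaleR ip_scaleR_right V_scaleR rV p s(2)[symmetric])
    have eh: "ip e (h j) = 0" "ip (h j) e = 0" if "j < n" for j
      using rh[OF p that] by (simp_all add: e_def ip_scaleR ip_scaleR_right rV p hV that ip_sym[of "h j"])
    have on: "orthonormal_on V ip (Suc n) h'"
      using h eV ee eh by (auto simp: orthonormal_on_def h'_def less_Suc_eq)
    have res: "x - (\<Sum>k<Suc n. ip x (h' k) *\<^sub>R h' k) = r x - ip (r x) e *\<^sub>R e" if x: "x \<in> V" for x
    proof -
      have s: "(\<Sum>k<n. ip x (h k) *\<^sub>R h k) \<in> V" by (intro V_sum V_scaleR) (use hV in auto)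
      have "ip (\<Sum>k<n. ip x (h k) *\<^sub>R h k) e = (\<Sum>k<n. 0)"
        by (subst ip_sum) (auto simp: V_scaleR hV eV ip_scaleR eh intro!: sum.cong)
      then have "ip (r x) e = ip x e" unfolding r_def by (simp add: ip_diff x s eV)
      then show ?thesis by (simp add: h'_def r_def)
    qed
    have "ip (x - (\<Sum>k<Suc n. ip x (h' k) *\<^sub>R h' k)) (x - (\<Sum>k<Suc n. ip x (h' k) *\<^sub>R h' k)) = 0"
      if x: "x \<in> insert p P" for x
    proof (cases "x = p")
      case True
      have "ip (r p) e = s"
        using s by (simp add: e_def ip_scaleR_right rV p s(2)[symmetric])
      then have "r p - ip (r p) e *\<^sub>R e = 0" using s by (simp add: e_def)
      then show ?thesis unfolding True res[OF p] by (simp add: ip_0 V_0)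
    next
      case False
      then have x: "x \<in> P" "x \<in> V" using that PV by auto
      \<comment> \<open>A null residual is orthogonal to \<open>e\<close> by Cauchy-Schwarz, so
        enlarging the system leaves the residuals of the earlier points as they were.\<close>
      have 0: "ip (r x) (r x) = 0" using P[OF x(1)] by (simp add: r_def)
      then show ?thesis unfolding res[OF x(2)] by (simp add: ip_null rV x eV)
    qed
    then show ?thesis using on by blast
  qed
qed

end

lemma hilbert_on_imp_semi_inner_on: "hilbert_on V ip \<Longrightarrow> semi_inner_on V ip"
  unfolding hilbert_on_def semi_inner_on_def by auto

lemma hilbert_on_complete:
  assumes "hilbert_on V ip" "\<And>n :: nat. u n \<in> V"
    and "\<forall>e>0. \<exists>N. \<forall>m\<ge>N. \<forall>n\<ge>N. sqrt (ip (u m - u n) (u m - u n)) < e"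
  shows "\<exists>l\<in>V. (\<lambda>n. sqrt (ip (u n - l) (u n - l))) \<longlonglongrightarrow> 0"
proof -
  have "\<forall>u :: nat \<Rightarrow> 'a. (\<forall>n. u n \<in> V) \<longrightarrow>
      (\<forall>e>0. \<exists>N. \<forall>m\<ge>N. \<forall>n\<ge>N. sqrt (ip (u m - u n) (u m - u n)) < e) \<longrightarrow>
      (\<exists>l\<in>V. (\<lambda>n. sqrt (ip (u n - l) (u n - l))) \<longlonglongrightarrow> 0)"
    using assms(1) unfolding hilbert_on_def by (elim conjE)
  then show ?thesis using assms(2,3) by simp
qed

text \<open>The point \<open>p\<close> minimises \<open>ip u u - 2 * \<phi> u\<close> over the closure of \<open>U\<close>. With \<open>U = V\<close> this is the
  Riesz representation theorem, with \<open>\<phi> = ip x\<close> it is the projection theorem.\<close>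

lemma hilbert_representation:
  fixes \<phi> :: "'h::real_vector \<Rightarrow> real"
  assumes H: "hilbert_on V ip" and U: "subspace U" "U \<subseteq> V"
    and \<phi>: "\<And>x y. x \<in> U \<Longrightarrow> y \<in> U \<Longrightarrow> \<phi> (x + y) = \<phi> x + \<phi> y"
      "\<And>c x. x \<in> U \<Longrightarrow> \<phi> (c *\<^sub>R x) = c * \<phi> x"
      "\<And>x. x \<in> U \<Longrightarrow> \<bar>\<phi> x\<bar> \<le> C * sqrt (ip x x)"
  shows "\<exists>p\<in>V. (\<forall>u\<in>U. ip p u = \<phi> u) \<and> (\<exists>u. (\<forall>n. u n \<in> U) \<and> (\<lambda>n. ip (u n - p) (u n - p)) \<longlonglongrightarrow> 0)"
proof -
  interpret semi_inner_on V ip by (rule hilbert_on_imp_semi_inner_on[OF H])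
  define F where "F x = ip x x - 2 * \<phi> x" for x
  define m where "m = (INF x\<in>U. F x)"
  have U0: "0 \<in> U" by (rule subspace_0[OF U(1)])
  have UV: "x \<in> V" if "x \<in> U" for x using U(2) that by auto
  have bdd: "bdd_below (F ` U)"
  proof (rule bdd_belowI2)
    fix x assume x: "x \<in> U"
    define N where "N = sqrt (ip x x)"
    have "ip x x = N\<^sup>2" unfolding N_def using ip_nonneg[OF UV[OF x]] by simp
    moreover have "\<phi> x \<le> C * N" using \<phi>(3)[OF x] by (simp add: N_def)
    moreover have "0 \<le> (N - C)\<^sup>2" by simp
    ultimately show "- (C\<^sup>2) \<le> F x" by (simp add: F_def power2_eq_square algebra_simps)
  qed
  have m_le: "m \<le> F x" if "x \<in> U" for x unfolding m_def by (rule cINF_lower[OF bdd that])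
  have "\<exists>x\<in>U. F x < m + inverse (real (Suc n))" for n
    using cINF_less_iff[of U F "m + inverse (real (Suc n))"] bdd U0 unfolding m_def[symmetric] by auto
  then obtain u where u: "\<And>n. u n \<in> U" "\<And>n. F (u n) < m + inverse (real (Suc n))" by metis
  \<comment> \<open>The parallelogram identity at the midpoint, where \<open>F\<close> is at least
    \<open>m\<close>: it forces minimising sequences to be Cauchy.\<close>
  have par: "ip (x - y) (x - y) \<le> 2 * (F x - m) + 2 * (F y - m)" if "x \<in> U" "y \<in> U" for x y
  proof -
    have z: "(1/2) *\<^sub>R (x + y) \<in> U" using that U(1) by (intro subspace_scale subspace_add)
    have "4 * F ((1/2) *\<^sub>R (x + y)) = ip x x + 2 * ip x y + ip y y - 4 * \<phi> x - 4 * \<phi> y"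
    proof -
      have "4 * ip ((1/2) *\<^sub>R (x + y)) ((1/2) *\<^sub>R (x + y)) = ip x x + 2 * ip x y + ip y y"
        using that UV by (simp add: ip_scaleR ip_scaleR_right V_scaleR V_add ip_add_self)
      moreover have "\<phi> ((1/2) *\<^sub>R (x + y)) = (1/2) * (\<phi> x + \<phi> y)"
        using that by (simp only: \<phi> subspace_add[OF U(1)])
      ultimately show ?thesis unfolding F_def by (simp add: algebra_simps)
    qed
    with m_le[OF z] show ?thesis using that UV by (simp add: F_def ip_diff_self)
  qed
  have "\<forall>e>0. \<exists>N. \<forall>m\<ge>N. \<forall>n\<ge>N. sqrt (ip (u m - u n) (u m - u n)) < e"
  proof (intro allI impI)
    fix e :: real assume e: "0 < e"
    obtain N where N: "inverse (real (Suc N)) < e\<^sup>2 / 4" using reals_Archimedean[of "e\<^sup>2 / 4"] e by auto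
    have "sqrt (ip (u k - u n) (u k - u n)) < e" if "k \<ge> N" "n \<ge> N" for k n
    proof -
      have "inverse (real (Suc i)) \<le> inverse (real (Suc N))" if "i \<ge> N" for i
        using that by (intro le_imp_inverse_le) auto
      then have "F (u i) - m < e\<^sup>2 / 4" if "i \<ge> N" for i
        using u(2)[of i] N that by (smt (verit))
      from this[OF that(1)] this[OF that(2)] have "ip (u k - u n) (u k - u n) < e\<^sup>2"
        using par[OF u(1)[of k] u(1)[of n]] by simp
      then have "sqrt (ip (u k - u n) (u k - u n)) < sqrt (e\<^sup>2)" by (simp only: real_sqrt_less_iff)
      then show ?thesis using e by simp
    qed
    then show "\<exists>N. \<forall>m\<ge>N. \<forall>n\<ge>N. sqrt (ip (u m - u n) (u m - u n)) < e" by blast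
  qed
  from hilbert_on_complete[OF H UV[OF u(1)] this]
  obtain l where l: "l \<in> V" "(\<lambda>n. sqrt (ip (u n - l) (u n - l))) \<longlonglongrightarrow> 0"
    by (elim bexE)
  have "(\<lambda>n. (sqrt (ip (u n - l) (u n - l)))\<^sup>2) \<longlonglongrightarrow> 0\<^sup>2" by (intro tendsto_intros l(2))
  then have lim: "(\<lambda>n. ip (u n - l) (u n - l)) \<longlonglongrightarrow> 0"
    unfolding real_sqrt_pow2[OF ip_nonneg[OF V_diff[OF UV[OF u(1)] l(1)]]] by simp
  have "ip l x = \<phi> x" if x: "x \<in> U" for x
  proof -
    \<comment> \<open>Compares the minimum with the value at \<open>u n + t *\<^sub>R x\<close>. In
      the limit a quadratic in \<open>t\<close> without constant term is nonnegative for all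
      \<open>t\<close>, so its linear coefficient vanishes.\<close>
    have ge: "0 \<le> inverse (real (Suc n)) + 2 * t * (ip (u n) x - \<phi> x) + t\<^sup>2 * ip x x" for n t
    proof -
      have "u n + t *\<^sub>R x \<in> U" using u(1) x U(1) by (intro subspace_add subspace_scale)
      then have "m \<le> F (u n + t *\<^sub>R x)" by (rule m_le)
      also have "\<dots> = F (u n) + 2 * t * (ip (u n) x - \<phi> x) + t\<^sup>2 * ip x x"
        using u(1)[of n] x UV subspace_scale[OF U(1) x]
        by (simp add: F_def ip_add_self ip_scaleR ip_scaleR_right V_scaleR \<phi> power2_eq_square algebra_simps)
      finally show ?thesis using u(2)[of n] by simp
    qed
    have iplim: "(\<lambda>n. ip (u n) x) \<longlonglongrightarrow> ip l x"
      using ip_tendsto[of u l "\<lambda>_. x" x] u(1) UV l(1) lim x V_0 by (simp add: ip_0)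
    have q: "0 \<le> 2 * t * (ip l x - \<phi> x) + t\<^sup>2 * ip x x" for t
    proof -
      have "(\<lambda>n. inverse (real (Suc n)) + 2 * t * (ip (u n) x - \<phi> x) + t\<^sup>2 * ip x x)
          \<longlonglongrightarrow> 0 + 2 * t * (ip l x - \<phi> x) + t\<^sup>2 * ip x x"
        by (intro tendsto_intros iplim LIMSEQ_inverse_real_of_nat)
      then show ?thesis using ge by (intro LIMSEQ_le_const) auto
    qed
    \<comment> \<open>Adding 1 makes \<open>b\<close> positive even when \<open>ip x x = 0\<close>,
      so that \<open>t = - a / b\<close> can be inserted in all cases.\<close>
    define a b where "a = ip l x - \<phi> x" and "b = ip x x + 1"
    have b: "0 < b" using ip_nonneg[OF UV[OF x]] by (simp add: b_def)
    have "0 \<le> 2 * (- a / b) * a + (- a / b)\<^sup>2 * ip x x" unfolding a_def by (rule q)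
    also have "\<dots> \<le> 2 * (- a / b) * a + (- a / b)\<^sup>2 * b"
      by (intro add_left_mono mult_left_mono) (auto simp: b_def)
    also have "\<dots> = - a\<^sup>2 / b" using b by (simp add: power2_eq_square field_simps)
    finally have "a\<^sup>2 \<le> 0" using b by (simp add: zero_le_divide_iff divide_le_0_iff)
    then show ?thesis by (simp add: a_def)
  qed
  then show ?thesis using l(1) u(1) lim by blast
qed

section \<open>Square integrable random elements\<close>

definition sq_integrable :: "'w measure \<Rightarrow> ('w \<Rightarrow> 'x::{banach, second_countable_topology}) \<Rightarrow> bool"
  where "sq_integrable M \<eta> \<longleftrightarrow> \<eta> \<in> borel_measurable M \<and> integrable M (\<lambda>\<omega>. (norm (\<eta> \<omega>))\<^sup>2)"

lemma sq_integrableD: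
  assumes "sq_integrable M \<eta>"
  shows "\<eta> \<in> borel_measurable M" "integrable M (\<lambda>\<omega>. (norm (\<eta> \<omega>))\<^sup>2)"
  using assms by (auto simp: sq_integrable_def)

lemma sq_integrable_real:
  "sq_integrable M (Y :: 'w \<Rightarrow> real) \<longleftrightarrow> Y \<in> borel_measurable M \<and> integrable M (\<lambda>\<omega>. (Y \<omega>)\<^sup>2)"
  by (simp add: sq_integrable_def)

lemma norm_add_sq_le: "(norm (x + y :: 'x::real_normed_vector))\<^sup>2 \<le> 2 * (norm x)\<^sup>2 + 2 * (norm y)\<^sup>2"
proof -
  have "(norm (x + y))\<^sup>2 \<le> (norm x + norm y)\<^sup>2"
    by (intro power_mono norm_triangle_ineq) auto
  also have "\<dots> \<le> 2 * (norm x)\<^sup>2 + 2 * (norm y)\<^sup>2"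
    using sum_squares_bound[of "norm x" "norm y"] by (simp add: power2_sum)
  finally show ?thesis .
qed

lemma sq_integrable_bound:
  assumes "integrable M g" "\<eta> \<in> borel_measurable M" "\<And>\<omega>. \<omega> \<in> space M \<Longrightarrow> (norm (\<eta> \<omega>))\<^sup>2 \<le> g \<omega>"
  shows "sq_integrable M \<eta>"
proof -
  note [measurable] = assms(2)
  have "integrable M (\<lambda>\<omega>. (norm (\<eta> \<omega>))\<^sup>2)"
    by (rule Bochner_Integration.integrable_bound[OF assms(1)]) (use assms(3) in \<open>force intro!: AE_I2\<close>)+
  with assms(2) show ?thesis by (simp add: sq_integrable_def)
qed

lemma sq_integrable_add:
  assumes "sq_integrable M \<eta>" "sq_integrable M \<zeta>"
  shows "sq_integrable M (\<lambda>\<omega>. \<eta> \<omega> + \<zeta> \<omega>)"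
  by (rule sq_integrable_bound[where g = "\<lambda>\<omega>. 2 * (norm (\<eta> \<omega>))\<^sup>2 + 2 * (norm (\<zeta> \<omega>))\<^sup>2"])
    (use sq_integrableD[OF assms(1)] sq_integrableD[OF assms(2)] norm_add_sq_le in auto)

lemma sq_integrable_scaleR:
  assumes "sq_integrable M \<eta>"
  shows "sq_integrable M (\<lambda>\<omega>. c *\<^sub>R \<eta> \<omega>)"
  by (rule sq_integrable_bound[where g = "\<lambda>\<omega>. c\<^sup>2 * (norm (\<eta> \<omega>))\<^sup>2"])
    (use sq_integrableD[OF assms(1)] in \<open>auto simp: power_mult_distrib\<close>)

lemma sq_integrable_scaleR_left:
  assumes "sq_integrable M (Y :: 'w \<Rightarrow> real)"
  shows "sq_integrable M (\<lambda>\<omega>. Y \<omega> *\<^sub>R x)"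
  by (rule sq_integrable_bound[where g = "\<lambda>\<omega>. (norm (Y \<omega>))\<^sup>2 * (norm x)\<^sup>2"])
    (use sq_integrableD[OF assms(1)] in \<open>auto simp: power_mult_distrib\<close>)

lemma sq_integrable_cmult:
  "sq_integrable M (Y :: 'w \<Rightarrow> real) \<Longrightarrow> sq_integrable M (\<lambda>\<omega>. c * Y \<omega>)"
  using sq_integrable_scaleR[of M Y c] by simp

lemma sq_integrable_diff:
  assumes "sq_integrable M \<eta>" "sq_integrable M \<zeta>"
  shows "sq_integrable M (\<lambda>\<omega>. \<eta> \<omega> - \<zeta> \<omega>)"
  using sq_integrable_add[OF assms(1) sq_integrable_scaleR[OF assms(2), of "-1"]] by simp

lemma sq_integrable_zero: "sq_integrable M (\<lambda>\<omega>. 0)"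
  by (simp add: sq_integrable_def)

lemma sq_integrable_sum:
  "(\<And>i. i \<in> I \<Longrightarrow> sq_integrable M (Y i)) \<Longrightarrow> sq_integrable M (\<lambda>\<omega>. \<Sum>i\<in>I. Y i \<omega>)"
  by (induction I rule: infinite_finite_induct) (auto simp: sq_integrable_zero sq_integrable_add)

lemma bounded_linear_sq:
  assumes "bounded_linear f"
  obtains C where "0 \<le> C" "\<And>x. (norm (f x))\<^sup>2 \<le> C * (norm x)\<^sup>2"
proof -
  from bounded_linear.bounded[OF assms] obtain K where "\<And>x. norm (f x) \<le> norm x * K" by blast
  then have "(norm (f x))\<^sup>2 \<le> K\<^sup>2 * (norm x)\<^sup>2" for x
    using power_mono[OF \<open>norm (f x) \<le> norm x * K\<close>, of 2] by (simp add: power_mult_distrib mult.commute)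
  then show thesis by (intro that[of "K\<^sup>2"]) auto
qed

lemma bounded_linear_borel:
  fixes f :: "'x::real_normed_vector \<Rightarrow> 'y::real_normed_vector"
  shows "bounded_linear f \<Longrightarrow> f \<in> borel_measurable borel"
  by (intro borel_measurable_continuous_onI linear_continuous_on)

lemma sq_integrable_bounded_linear:
  assumes "sq_integrable M \<eta>" "bounded_linear f"
  shows "sq_integrable M (\<lambda>\<omega>. f (\<eta> \<omega>))"
proof -
  obtain C where C: "\<And>x. (norm (f x))\<^sup>2 \<le> C * (norm x)\<^sup>2" using bounded_linear_sq[OF assms(2)] by blast
  show ?thesis
    by (rule sq_integrable_bound[where g = "\<lambda>\<omega>. C * (norm (\<eta> \<omega>))\<^sup>2"])
      (use sq_integrableD[OF assms(1)] C measurable_compose[OF _ bounded_linear_borel[OF assms(2)]] in auto)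
qed

lemma sq_integrable_times:
  assumes "sq_integrable M (Y :: 'w \<Rightarrow> real)" "sq_integrable M \<eta>"
  shows "integrable M (\<lambda>\<omega>. Y \<omega> *\<^sub>R \<eta> \<omega>)"
proof (rule Bochner_Integration.integrable_bound[where f = "\<lambda>\<omega>. (Y \<omega>)\<^sup>2 + (norm (\<eta> \<omega>))\<^sup>2"])
  note [measurable] = sq_integrableD(1)[OF assms(1)] sq_integrableD(1)[OF assms(2)]
  show "integrable M (\<lambda>\<omega>. (Y \<omega>)\<^sup>2 + (norm (\<eta> \<omega>))\<^sup>2)"
    using sq_integrableD(2)[OF assms(1)] sq_integrableD(2)[OF assms(2)] by simp
  show "(\<lambda>\<omega>. Y \<omega> *\<^sub>R \<eta> \<omega>) \<in> borel_measurable M" by simp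
  have "\<bar>a\<bar> * b \<le> a\<^sup>2 + b\<^sup>2" if "0 \<le> b" for a b :: real
  proof -
    have "0 \<le> \<bar>a\<bar> * b" "2 * (\<bar>a\<bar> * b) \<le> a\<^sup>2 + b\<^sup>2"
      using that sum_squares_bound[of "\<bar>a\<bar>" b] by simp_all
    then show ?thesis by linarith
  qed
  then show "AE \<omega> in M. norm (Y \<omega> *\<^sub>R \<eta> \<omega>) \<le> norm ((Y \<omega>)\<^sup>2 + (norm (\<eta> \<omega>))\<^sup>2)" by simp
qed

lemma sq_integrable_mult:
  "sq_integrable M (Y :: 'w \<Rightarrow> real) \<Longrightarrow> sq_integrable M Z \<Longrightarrow> integrable M (\<lambda>\<omega>. Y \<omega> * Z \<omega>)"
  using sq_integrable_times[of M Y Z] by simp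

lemma sq_integrable_cong_AE:
  assumes "sq_integrable M \<eta>" "\<zeta> \<in> borel_measurable M" "AE \<omega> in M. \<eta> \<omega> = \<zeta> \<omega>"
  shows "sq_integrable M \<zeta>"
proof -
  note [measurable] = sq_integrableD(1)[OF assms(1)] assms(2)
  have "integrable M (\<lambda>\<omega>. (norm (\<zeta> \<omega>))\<^sup>2)"
    by (rule integrable_cong_AE_imp[OF sq_integrableD(2)[OF assms(1)]]) (use assms(3) in auto)
  then show ?thesis using assms(2) by (simp add: sq_integrable_def)
qed

lemma L2_semi_inner: "semi_inner_on {Y. sq_integrable M Y} (\<lambda>Y Z. \<integral>\<omega>. Y \<omega> * Z \<omega> \<partial>M)"
proof
  show "subspace {Y :: 'a \<Rightarrow> real. sq_integrable M Y}"
    unfolding subspace_def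
    using sq_integrable_zero[of M] sq_integrable_add[of M] sq_integrable_cmult[of M]
    by (auto simp: zero_fun_def plus_fun_def scaleR_fun_def)
next
  fix X Y Z :: "'a \<Rightarrow> real" and c :: real
  assume "X \<in> {Y. sq_integrable M Y}" "Y \<in> {Y. sq_integrable M Y}"
  then have XY: "sq_integrable M X" "sq_integrable M Y" by simp_all
  show "(\<integral>\<omega>. X \<omega> * Y \<omega> \<partial>M) = (\<integral>\<omega>. Y \<omega> * X \<omega> \<partial>M)"
    by (simp only: mult.commute)
  show "(\<integral>\<omega>. (c *\<^sub>R X) \<omega> * Y \<omega> \<partial>M) = c * (\<integral>\<omega>. X \<omega> * Y \<omega> \<partial>M)"
    by (simp only: scaleR_fun_def real_scaleR_def mult.assoc integral_mult_right_zero)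
  assume "Z \<in> {Y. sq_integrable M Y}"
  then show "(\<integral>\<omega>. (X + Y) \<omega> * Z \<omega> \<partial>M) = (\<integral>\<omega>. X \<omega> * Z \<omega> \<partial>M) + (\<integral>\<omega>. Y \<omega> * Z \<omega> \<partial>M)"
    using XY by (simp add: distrib_right sq_integrable_mult)
qed simp

section \<open>Second moments and completeness over a probability space\<close>

context prob_space
begin

lemma sq_integrable_const: "sq_integrable M (\<lambda>\<omega>. x)"
  by (simp add: sq_integrable_def)

lemma sq_integrable_integrable:
  assumes "sq_integrable M \<eta>"
  shows "integrable M \<eta>"
  using sq_integrable_times[OF sq_integrable_const[of 1] assms] by simp

lemma expectation_sq_le:
  assumes "sq_integrable M (Y :: 'a \<Rightarrow> real)"
  shows "(expectation Y)\<^sup>2 \<le> expectation (\<lambda>\<omega>. (Y \<omega>)\<^sup>2)"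
proof -
  have "0 \<le> variance Y" by simp
  moreover have "variance Y = expectation (\<lambda>\<omega>. (Y \<omega>)\<^sup>2) - (expectation Y)\<^sup>2"
    by (rule variance_eq[OF sq_integrable_integrable[OF assms]]) (use sq_integrableD(2)[OF assms] in simp)
  ultimately show ?thesis by linarith
qed

lemma expectation_norm_le_sqrt:
  assumes "sq_integrable M \<eta>"
  shows "expectation (\<lambda>\<omega>. norm (\<eta> \<omega>)) \<le> sqrt (expectation (\<lambda>\<omega>. (norm (\<eta> \<omega>))\<^sup>2))"
proof -
  have "sq_integrable M (\<lambda>\<omega>. norm (\<eta> \<omega>))"
    using sq_integrableD[OF assms] by (simp add: sq_integrable_def)
  then show ?thesis by (intro real_le_rsqrt) (use expectation_sq_le in force)
qed

lemma expectation_sq_eq_0: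
  assumes "sq_integrable M \<eta>" "expectation (\<lambda>\<omega>. (norm (\<eta> \<omega>))\<^sup>2) = 0"
  shows "AE \<omega> in M. \<eta> \<omega> = 0"
  using integral_nonneg_eq_0_iff_AE[OF sq_integrableD(2)[OF assms(1)]] assms(2) by simp

lemma expectation_add_sq_le:
  assumes "sq_integrable M \<eta>" "sq_integrable M \<zeta>"
  shows "expectation (\<lambda>\<omega>. (norm (\<eta> \<omega> + \<zeta> \<omega>))\<^sup>2)
    \<le> 2 * expectation (\<lambda>\<omega>. (norm (\<eta> \<omega>))\<^sup>2) + 2 * expectation (\<lambda>\<omega>. (norm (\<zeta> \<omega>))\<^sup>2)"
proof -
  note i = sq_integrableD(2)[OF assms(1)] sq_integrableD(2)[OF assms(2)]
  have "expectation (\<lambda>\<omega>. (norm (\<eta> \<omega> + \<zeta> \<omega>))\<^sup>2)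
      \<le> expectation (\<lambda>\<omega>. 2 * (norm (\<eta> \<omega>))\<^sup>2 + 2 * (norm (\<zeta> \<omega>))\<^sup>2)"
    by (rule integral_mono) (use i norm_add_sq_le sq_integrableD(2)[OF sq_integrable_add[OF assms]] in auto)
  then show ?thesis using i by simp
qed

text \<open>The sequence is also Cauchy in the mean, so a subsequence converges almost everywhere.
  Fatou's lemma along this subsequence bounds the distance of \<open>s n\<close> from the limit by
  the Cauchy bound.\<close>

lemma sq_integrable_complete:
  fixes s :: "nat \<Rightarrow> 'a \<Rightarrow> 'x::{banach, second_countable_topology}"
  assumes s: "\<And>n. sq_integrable M (s n)"
    and cauchy: "\<And>e. 0 < e \<Longrightarrow> \<exists>N. \<forall>m\<ge>N. \<forall>n\<ge>N. expectation (\<lambda>\<omega>. (norm (s m \<omega> - s n \<omega>))\<^sup>2) < e"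
  shows "\<exists>l. sq_integrable M l \<and> (\<lambda>n. expectation (\<lambda>\<omega>. (norm (s n \<omega> - l \<omega>))\<^sup>2)) \<longlonglongrightarrow> 0"
proof -
  note [measurable] = sq_integrableD(1)[OF s]
  have "\<exists>N. \<forall>i\<ge>N. \<forall>j\<ge>N. expectation (\<lambda>\<omega>. norm (s i \<omega> - s j \<omega>)) < e" if e: "0 < e" for e
  proof -
    obtain N where N: "\<And>m n. m \<ge> N \<Longrightarrow> n \<ge> N \<Longrightarrow> expectation (\<lambda>\<omega>. (norm (s m \<omega> - s n \<omega>))\<^sup>2) < e\<^sup>2"
      using cauchy[of "e\<^sup>2"] e by auto
    have "expectation (\<lambda>\<omega>. norm (s m \<omega> - s n \<omega>)) < e" if "m \<ge> N" "n \<ge> N" for m n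
    proof -
      have "expectation (\<lambda>\<omega>. norm (s m \<omega> - s n \<omega>)) \<le> sqrt (expectation (\<lambda>\<omega>. (norm (s m \<omega> - s n \<omega>))\<^sup>2))"
        by (rule expectation_norm_le_sqrt[OF sq_integrable_diff[OF s s]])
      also have "\<dots> < sqrt (e\<^sup>2)" using N[OF that] by (simp only: real_sqrt_less_iff)
      finally show ?thesis using e by simp
    qed
    then show ?thesis by blast
  qed
  then obtain r where r: "strict_mono r" and AE: "AE x in M. Cauchy (\<lambda>i. s (r i) x)"
    using cauchy_L1_AE_cauchy_subseq[of M s] sq_integrable_integrable[OF s] by blast
  define l where "l x = lim (\<lambda>i. s (r i) x)" for x
  have [measurable]: "l \<in> borel_measurable M" unfolding l_def by simp
  have lim: "AE x in M. (\<lambda>i. s (r i) x) \<longlonglongrightarrow> l x"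
    using AE by eventually_elim (simp add: l_def Cauchy_convergent_iff convergent_LIMSEQ_iff)
  have bound: "\<exists>N. \<forall>n\<ge>N. (\<integral>\<^sup>+x. ennreal ((norm (s n x - l x))\<^sup>2) \<partial>M) \<le> ennreal e" if e: "0 < e" for e
  proof -
    obtain N where N: "\<And>m n. m \<ge> N \<Longrightarrow> n \<ge> N \<Longrightarrow> expectation (\<lambda>\<omega>. (norm (s m \<omega> - s n \<omega>))\<^sup>2) < e"
      using cauchy[OF e] by auto
    have "(\<integral>\<^sup>+x. ennreal ((norm (s n x - l x))\<^sup>2) \<partial>M) \<le> ennreal e" if n: "n \<ge> N" for n
    proof -
      have "AE x in M. ennreal ((norm (s n x - l x))\<^sup>2) = liminf (\<lambda>i. ennreal ((norm (s n x - s (r i) x))\<^sup>2))"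
        using lim
      proof eventually_elim
        fix x assume "(\<lambda>i. s (r i) x) \<longlonglongrightarrow> l x"
        then have "(\<lambda>i. ennreal ((norm (s n x - s (r i) x))\<^sup>2)) \<longlonglongrightarrow> ennreal ((norm (s n x - l x))\<^sup>2)"
          by (intro tendsto_intros)
        then show "ennreal ((norm (s n x - l x))\<^sup>2) = liminf (\<lambda>i. ennreal ((norm (s n x - s (r i) x))\<^sup>2))"
          by (rule lim_imp_Liminf[OF sequentially_bot, symmetric])
      qed
      then have "(\<integral>\<^sup>+x. ennreal ((norm (s n x - l x))\<^sup>2) \<partial>M)
          = (\<integral>\<^sup>+x. liminf (\<lambda>i. ennreal ((norm (s n x - s (r i) x))\<^sup>2)) \<partial>M)"
        by (rule nn_integral_cong_AE)
      also have "\<dots> \<le> liminf (\<lambda>i. \<integral>\<^sup>+x. ennreal ((norm (s n x - s (r i) x))\<^sup>2) \<partial>M)"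
        by (rule nn_integral_liminf) simp
      also have "\<dots> \<le> ennreal e"
      proof (rule Liminf_le)
        have "\<forall>\<^sub>F i in sequentially. r i \<ge> N"
          using eventually_ge_at_top[of N] by eventually_elim (use seq_suble[OF r] le_trans in blast)
        then show "\<forall>\<^sub>F i in sequentially. (\<integral>\<^sup>+x. ennreal ((norm (s n x - s (r i) x))\<^sup>2) \<partial>M) \<le> ennreal e"
        proof eventually_elim
          fix i assume "r i \<ge> N"
          have "(\<integral>\<^sup>+x. ennreal ((norm (s n x - s (r i) x))\<^sup>2) \<partial>M)
              = ennreal (expectation (\<lambda>\<omega>. (norm (s n \<omega> - s (r i) \<omega>))\<^sup>2))"
            by (rule nn_integral_eq_integral) (use sq_integrableD(2)[OF sq_integrable_diff[OF s s]] in auto)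
          also have "\<dots> \<le> ennreal e" using N[OF n \<open>r i \<ge> N\<close>] by (intro ennreal_leI) simp
          finally show "(\<integral>\<^sup>+x. ennreal ((norm (s n x - s (r i) x))\<^sup>2) \<partial>M) \<le> ennreal e" .
        qed
      qed simp
      finally show ?thesis .
    qed
    then show ?thesis by blast
  qed
  have sqd: "sq_integrable M (\<lambda>x. s n x - l x) \<and> expectation (\<lambda>\<omega>. (norm (s n \<omega> - l \<omega>))\<^sup>2) \<le> e"
    if "(\<integral>\<^sup>+x. ennreal ((norm (s n x - l x))\<^sup>2) \<partial>M) \<le> ennreal e" "0 < e" for n e
  proof -
    have "integrable M (\<lambda>x. (norm (s n x - l x))\<^sup>2)"
      by (rule integrableI_bounded) (use that in \<open>auto intro: le_less_trans\<close>)
    moreover from this have "ennreal (expectation (\<lambda>\<omega>. (norm (s n \<omega> - l \<omega>))\<^sup>2)) \<le> ennreal e"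
      using that(1) by (subst (asm) nn_integral_eq_integral) auto
    ultimately show ?thesis using that(2) by (simp add: sq_integrable_def)
  qed
  obtain N where "sq_integrable M (\<lambda>x. s N x - l x)" using bound[of 1] sqd[of _ 1] by auto
  from sq_integrable_diff[OF s[of N] this] have "sq_integrable M l" by simp
  moreover have "(\<lambda>n. expectation (\<lambda>\<omega>. (norm (s n \<omega> - l \<omega>))\<^sup>2)) \<longlonglongrightarrow> 0"
  proof (rule LIMSEQ_I)
    fix e :: real assume "0 < e"
    then obtain N where "\<forall>n\<ge>N. (\<integral>\<^sup>+x. ennreal ((norm (s n x - l x))\<^sup>2) \<partial>M) \<le> ennreal (e / 2)"
      using bound[of "e / 2"] by auto
    then have "expectation (\<lambda>\<omega>. (norm (s n \<omega> - l \<omega>))\<^sup>2) \<le> e / 2" if "n \<ge> N" for n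
      using sqd[of n "e / 2"] \<open>0 < e\<close> that by simp
    then have "\<forall>n\<ge>N. expectation (\<lambda>\<omega>. (norm (s n \<omega> - l \<omega>))\<^sup>2) < e"
      using \<open>0 < e\<close> by fastforce
    then show "\<exists>N. \<forall>n\<ge>N. norm (expectation (\<lambda>\<omega>. (norm (s n \<omega> - l \<omega>))\<^sup>2) - 0) < e"
      by auto
  qed
  ultimately show ?thesis by blast
qed

end

section \<open>Gaussian variables\<close>

context prob_space
begin

text \<open>One formula covers the degenerate and the non-degenerate case; together with its
  converse it allows all later arguments to avoid the case distinction in
  \<open>centered_gaussian\<close>.\<close>

lemma centered_gaussian_imp_char:
  assumes "centered_gaussian M Y"
  shows "sq_integrable M Y"
    and "(\<integral>\<omega>. iexp (u * Y \<omega>) \<partial>M) = complex_of_real (exp (- (u\<^sup>2 * expectation (\<lambda>\<omega>. (Y \<omega>)\<^sup>2) / 2)))"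
proof -
  have Y[measurable]: "Y \<in> borel_measurable M" using assms by (simp add: centered_gaussian_def)
  have "sq_integrable M Y \<and>
    (\<integral>\<omega>. iexp (u * Y \<omega>) \<partial>M) = complex_of_real (exp (- (u\<^sup>2 * expectation (\<lambda>\<omega>. (Y \<omega>)\<^sup>2) / 2)))"
  proof (cases "AE \<omega> in M. Y \<omega> = 0")
    case True
    have "sq_integrable M Y"
      by (rule sq_integrable_cong_AE[OF sq_integrable_zero Y]) (use True in auto)
    moreover have "expectation (\<lambda>\<omega>. (Y \<omega>)\<^sup>2) = expectation (\<lambda>\<omega>. 0)"
      by (rule integral_cong_AE) (use True in auto)
    moreover have "(\<integral>\<omega>. iexp (u * Y \<omega>) \<partial>M) = (\<integral>\<omega>. 1 \<partial>M)"
      by (rule integral_cong_AE) (use True in auto)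
    ultimately show ?thesis by (simp add: prob_space)
  next
    case False
    then obtain \<sigma> where \<sigma>: "0 < \<sigma>" and D: "distributed M lborel Y (normal_density 0 \<sigma>)"
      using assms by (auto simp: centered_gaussian_def)
    have "expectation Y = 0" using normal_distributed_expectation[OF \<sigma> D] .
    then have var: "expectation (\<lambda>\<omega>. (Y \<omega>)\<^sup>2) = \<sigma>\<^sup>2" using normal_distributed_variance[OF \<sigma> D] by simp
    \<comment> \<open>A function that is not integrable has integral 0 by convention; the value
      \<open>\<sigma>\<^sup>2\<close> is positive, hence the square is integrable.\<close>
    then have "integrable M (\<lambda>\<omega>. (Y \<omega>)\<^sup>2)"
      using \<sigma> not_integrable_integral_eq[of M "\<lambda>\<omega>. (Y \<omega>)\<^sup>2"] by fastforce
    then have sq: "sq_integrable M Y" by (simp add: sq_integrable_def)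
    have "distributed M lborel (\<lambda>\<omega>. Y \<omega> / \<sigma>) std_normal_density"
      using D normal_standard_normal_convert[OF \<sigma>, of Y 0] by simp
    then have d: "distr M lborel (\<lambda>\<omega>. Y \<omega> / \<sigma>) = std_normal_distribution"
      by (simp add: distributed_def)
    have "(\<integral>\<omega>. iexp (u * Y \<omega>) \<partial>M) = (\<integral>\<omega>. iexp ((u * \<sigma>) * (Y \<omega> / \<sigma>)) \<partial>M)"
      using \<sigma> by simp
    also have "\<dots> = (\<integral>x. iexp ((u * \<sigma>) * x) \<partial>distr M lborel (\<lambda>\<omega>. Y \<omega> / \<sigma>))"
      by (subst integral_distr) auto
    also have "\<dots> = char std_normal_distribution (u * \<sigma>)" unfolding d char_def ..
    also have "\<dots> = complex_of_real (exp (- (u\<^sup>2 * \<sigma>\<^sup>2 / 2)))"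
      unfolding char_std_normal_distribution by (simp add: power_mult_distrib)
    finally show ?thesis using sq var by simp
  qed
  then show "sq_integrable M Y"
    "(\<integral>\<omega>. iexp (u * Y \<omega>) \<partial>M) = complex_of_real (exp (- (u\<^sup>2 * expectation (\<lambda>\<omega>. (Y \<omega>)\<^sup>2) / 2)))"
    by auto
qed

text \<open>Uniqueness of characteristic functions identifies the law of \<open>Y\<close>, scaled by
  its standard deviation, as standard normal. For \<open>v = 0\<close> scaling is impossible and the
  law is the point mass at 0.\<close>

lemma centered_gaussian_charI:
  assumes Y[measurable]: "Y \<in> borel_measurable M" and v: "0 \<le> v"
    and char: "\<And>u. (\<integral>\<omega>. iexp (u * Y \<omega>) \<partial>M) = complex_of_real (exp (- (u\<^sup>2 * v / 2)))"
  shows "centered_gaussian M Y" "expectation (\<lambda>\<omega>. (Y \<omega>)\<^sup>2) = v"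
proof -
  have "centered_gaussian M Y \<and> expectation (\<lambda>\<omega>. (Y \<omega>)\<^sup>2) = v"
  proof (cases "v = 0")
    case True
    have "char (distr M borel Y) = char (return borel 0)"
    proof
      fix t
      have "char (distr M borel Y) t = (\<integral>\<omega>. iexp (t * Y \<omega>) \<partial>M)"
        unfolding char_def by (subst integral_distr) auto
      also have "\<dots> = char (return borel 0) t"
        unfolding char char_def by (subst integral_return) (auto simp: True)
      finally show "char (distr M borel Y) t = char (return borel 0) t" .
    qed
    moreover have "real_distribution (distr M borel Y)" "real_distribution (return borel 0)"
      by (simp_all add: real_distribution_def real_distribution_axioms_def prob_space_distr prob_space_return)
    ultimately have d: "distr M borel Y = return borel 0" using Levy_uniqueness by blast
    have "AE x in distr M borel Y. x = 0" unfolding d by (subst AE_return) auto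
    then have AE: "AE \<omega> in M. Y \<omega> = 0" by (subst (asm) AE_distr_iff) auto
    then have "expectation (\<lambda>\<omega>. (Y \<omega>)\<^sup>2) = expectation (\<lambda>\<omega>. 0)"
      by (intro integral_cong_AE) auto
    with AE show ?thesis by (simp add: centered_gaussian_def True)
  next
    case False
    define \<sigma> where "\<sigma> = sqrt v"
    have \<sigma>: "0 < \<sigma>" "\<sigma>\<^sup>2 = v" using False v by (auto simp: \<sigma>_def)
    have "char (distr M borel (\<lambda>\<omega>. Y \<omega> / \<sigma>)) = char std_normal_distribution"
    proof
      fix t
      have "char (distr M borel (\<lambda>\<omega>. Y \<omega> / \<sigma>)) t = (\<integral>\<omega>. iexp ((t / \<sigma>) * Y \<omega>) \<partial>M)"
        unfolding char_def by (subst integral_distr) auto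
      also have "\<dots> = complex_of_real (exp (- (t\<^sup>2 / 2)))"
        unfolding char \<sigma>(2)[symmetric] using \<sigma>(1) by (simp add: power_divide)
      finally show "char (distr M borel (\<lambda>\<omega>. Y \<omega> / \<sigma>)) t = char std_normal_distribution t"
        unfolding char_std_normal_distribution by simp
    qed
    moreover have "real_distribution (distr M borel (\<lambda>\<omega>. Y \<omega> / \<sigma>))"
      by (simp add: real_distribution_def real_distribution_axioms_def prob_space_distr)
    ultimately have d: "distr M borel (\<lambda>\<omega>. Y \<omega> / \<sigma>) = std_normal_distribution"
      using Levy_uniqueness real_dist_normal_dist by blast
    have "distr M lborel (\<lambda>\<omega>. Y \<omega> / \<sigma>) = distr M borel (\<lambda>\<omega>. Y \<omega> / \<sigma>)"
      by (rule distr_cong) auto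
    with d have "distributed M lborel (\<lambda>\<omega>. Y \<omega> / \<sigma>) std_normal_density"
      by (simp add: distributed_def)
    then have D: "distributed M lborel Y (normal_density 0 \<sigma>)"
      using normal_standard_normal_convert[OF \<sigma>(1), of Y 0] by simp
    have "expectation Y = 0" by (rule normal_distributed_expectation[OF \<sigma>(1) D])
    then have "expectation (\<lambda>\<omega>. (Y \<omega>)\<^sup>2) = v"
      using normal_distributed_variance[OF \<sigma>(1) D] \<sigma>(2) by simp
    with D show ?thesis using \<sigma>(1) by (auto simp: centered_gaussian_def)
  qed
  then show "centered_gaussian M Y" "expectation (\<lambda>\<omega>. (Y \<omega>)\<^sup>2) = v" by auto
qed

end

text \<open>The value of the characteristic functional at \<open>f\<close> depends only on the
  variance of \<open>f\<close>. Two probability spaces are allowed, since the lemma serves both for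
  reflections on \<open>M\<close> and for the comparison with \<open>gaussian_seq\<close>.\<close>

lemma gaussian_law_unique:
  fixes \<zeta> :: "'w \<Rightarrow> 'x::{real_normed_vector, second_countable_topology}" and \<zeta>' :: "'v \<Rightarrow> 'x"
  assumes M: "prob_space M" and N: "prob_space N"
    and meas: "\<zeta> \<in> borel_measurable M" "\<zeta>' \<in> borel_measurable N"
    and gauss: "\<And>f :: 'x \<Rightarrow> real. bounded_linear f \<Longrightarrow> centered_gaussian M (\<lambda>\<omega>. f (\<zeta> \<omega>))"
      "\<And>f :: 'x \<Rightarrow> real. bounded_linear f \<Longrightarrow> centered_gaussian N (\<lambda>\<omega>. f (\<zeta>' \<omega>))"
    and var: "\<And>f :: 'x \<Rightarrow> real. bounded_linear f \<Longrightarrow> (\<integral>\<omega>. (f (\<zeta> \<omega>))\<^sup>2 \<partial>M) = (\<integral>\<omega>. (f (\<zeta>' \<omega>))\<^sup>2 \<partial>N)"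
  shows "distr M borel \<zeta> = distr N borel \<zeta>'"
proof (rule distr_eqI_char[OF M N meas])
  fix f :: "'x \<Rightarrow> real" assume f: "bounded_linear f"
  show "(\<integral>x. iexp (f (\<zeta> x)) \<partial>M) = (\<integral>x. iexp (f (\<zeta>' x)) \<partial>N)"
    using prob_space.centered_gaussian_imp_char(2)[OF M gauss(1)[OF f], of 1]
      prob_space.centered_gaussian_imp_char(2)[OF N gauss(2)[OF f], of 1] var[OF f] by simp
qed

lemma norm_iexp_diff_le: "norm (iexp a - iexp b) \<le> \<bar>a - b\<bar>"
proof -
  have "iexp a - iexp b = iexp b * (iexp (a - b) - 1)"
    by (simp add: algebra_simps exp_add[symmetric])
  then have "norm (iexp a - iexp b) = norm (iexp (a - b) - 1)" by (simp add: norm_mult)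
  also have "\<dots> \<le> \<bar>a - b\<bar>" using iexp_approx1[of "a - b" 0] by simp
  finally show ?thesis .
qed

text \<open>The map \<open>\<lambda>s. iexp (u * s)\<close> is Lipschitz with constant
  \<open>\<bar>u\<bar>\<close>, so the characteristic functions converge; the variances converge
  too. The limit therefore has a Gaussian characteristic function.\<close>

lemma (in prob_space) centered_gaussian_L2_limit:
  assumes Y: "sq_integrable M Y" and Z: "\<And>n. centered_gaussian M (Z n)"
    and lim: "(\<lambda>n. expectation (\<lambda>\<omega>. (Z n \<omega> - Y \<omega>)\<^sup>2)) \<longlonglongrightarrow> 0"
  shows "centered_gaussian M Y"
proof (rule centered_gaussian_charI(1)[OF sq_integrableD(1)[OF Y]])
  fix u :: real
  note sqZ = centered_gaussian_imp_char(1)[OF Z]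
  note [measurable] = sq_integrableD(1)[OF Y] sq_integrableD(1)[OF sqZ]
  note sqD = sq_integrable_diff[OF sqZ Y]
  define d where "d n = sqrt (expectation (\<lambda>\<omega>. (Z n \<omega> - Y \<omega>)\<^sup>2))" for n
  have d: "d \<longlonglongrightarrow> 0" unfolding d_def using tendsto_real_sqrt[OF lim] by simp
  have char_lim: "(\<lambda>n. \<integral>\<omega>. iexp (u * Z n \<omega>) \<partial>M) \<longlonglongrightarrow> (\<integral>\<omega>. iexp (u * Y \<omega>) \<partial>M)"
  proof (rule tendstoI, unfold dist_norm)
    have le: "norm ((\<integral>\<omega>. iexp (u * Z n \<omega>) \<partial>M) - (\<integral>\<omega>. iexp (u * Y \<omega>) \<partial>M)) \<le> \<bar>u\<bar> * d n" for n
    proof -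
      have i: "complex_integrable M (\<lambda>\<omega>. iexp (u * Z n \<omega>))" "complex_integrable M (\<lambda>\<omega>. iexp (u * Y \<omega>))"
        using cexp_integrable[of M "\<lambda>_. 1" "\<lambda>\<omega>. u * Z n \<omega>"] cexp_integrable[of M "\<lambda>_. 1" "\<lambda>\<omega>. u * Y \<omega>"] by simp_all
      have "norm ((\<integral>\<omega>. iexp (u * Z n \<omega>) \<partial>M) - (\<integral>\<omega>. iexp (u * Y \<omega>) \<partial>M))
          = norm (\<integral>\<omega>. iexp (u * Z n \<omega>) - iexp (u * Y \<omega>) \<partial>M)"
        by (simp only: Bochner_Integration.integral_diff[OF i])
      also have "\<dots> \<le> (\<integral>\<omega>. norm (iexp (u * Z n \<omega>) - iexp (u * Y \<omega>)) \<partial>M)"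
        by (rule integral_norm_bound)
      also have "\<dots> \<le> (\<integral>\<omega>. \<bar>u\<bar> * norm (Z n \<omega> - Y \<omega>) \<partial>M)"
      proof (rule integral_mono)
        show "integrable M (\<lambda>\<omega>. norm (iexp (u * Z n \<omega>) - iexp (u * Y \<omega>)))"
          by (rule integrable_norm[OF Bochner_Integration.integrable_diff[OF i]])
        show "integrable M (\<lambda>\<omega>. \<bar>u\<bar> * norm (Z n \<omega> - Y \<omega>))"
          using sq_integrable_integrable[OF sqD] by (intro integrable_mult_right integrable_norm)
        show "norm (iexp (u * Z n \<omega>) - iexp (u * Y \<omega>)) \<le> \<bar>u\<bar> * norm (Z n \<omega> - Y \<omega>)" for \<omega>
          using norm_iexp_diff_le[of "u * Z n \<omega>" "u * Y \<omega>"]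
          by (simp add: abs_mult[symmetric] right_diff_distrib)
      qed
      also have "\<dots> = \<bar>u\<bar> * expectation (\<lambda>\<omega>. norm (Z n \<omega> - Y \<omega>))" by (rule integral_mult_right_zero)
      also have "\<dots> \<le> \<bar>u\<bar> * d n" unfolding d_def
        using expectation_norm_le_sqrt[OF sqD] by (intro mult_left_mono) auto
      finally show ?thesis .
    qed
    fix e :: real assume "0 < e"
    moreover have "(\<lambda>n. \<bar>u\<bar> * d n) \<longlonglongrightarrow> \<bar>u\<bar> * 0" by (intro tendsto_intros d)
    ultimately have "\<forall>\<^sub>F n in sequentially. \<bar>u\<bar> * d n < e" by (intro order_tendstoD(2)) auto
    then show "\<forall>\<^sub>F n in sequentially. norm ((\<integral>\<omega>. iexp (u * Z n \<omega>) \<partial>M) - (\<integral>\<omega>. iexp (u * Y \<omega>) \<partial>M)) < e"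
      by eventually_elim (use le le_less_trans in blast)
  qed
  have var_lim: "(\<lambda>n. expectation (\<lambda>\<omega>. (Z n \<omega>)\<^sup>2)) \<longlonglongrightarrow> expectation (\<lambda>\<omega>. (Y \<omega>)\<^sup>2)"
  proof -
    interpret L2: semi_inner_on "{Y. sq_integrable M Y}" "\<lambda>Y Z. expectation (\<lambda>\<omega>. Y \<omega> * Z \<omega>)"
      by (rule L2_semi_inner)
    show ?thesis
      using L2.ip_tendsto[of Z Y Z Y] sqZ Y lim by (simp add: power2_eq_square)
  qed
  have "(\<lambda>n. complex_of_real (exp (- (u\<^sup>2 * expectation (\<lambda>\<omega>. (Z n \<omega>)\<^sup>2) / 2))))
      \<longlonglongrightarrow> complex_of_real (exp (- (u\<^sup>2 * expectation (\<lambda>\<omega>. (Y \<omega>)\<^sup>2) / 2)))"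
    by (intro tendsto_intros var_lim) auto
  then show "(\<integral>\<omega>. iexp (u * Y \<omega>) \<partial>M) = complex_of_real (exp (- (u\<^sup>2 * expectation (\<lambda>\<omega>. (Y \<omega>)\<^sup>2) / 2)))"
    using char_lim unfolding centered_gaussian_imp_char(2)[OF Z] by (rule LIMSEQ_unique[rotated])
qed simp

section \<open>Gaussian spaces and the reproducing kernel Hilbert space\<close>

lemma sum_fun_apply: "(\<Sum>i\<in>I. f i) = (\<lambda>x. \<Sum>i\<in>I. f i x)"
  by (induction I rule: infinite_finite_induct) (auto simp: fun_eq_iff)

lemma scaleR_fun_apply: "(c *\<^sub>R f) x = c *\<^sub>R f x"
  by (simp add: scaleR_fun_def)

section \<open>Closed subspaces of square integrable functions\<close>

definition cov :: "'w measure \<Rightarrow> ('w \<Rightarrow> real) \<Rightarrow> ('w \<Rightarrow> real) \<Rightarrow> real"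
  where "cov M Y Z = (\<integral>\<omega>. Y \<omega> * Z \<omega> \<partial>M)"

lemma cov_semi_inner: "semi_inner_on {Y. sq_integrable M Y} (cov M)"
  using L2_semi_inner[of M] by (simp add: cov_def[abs_def])

lemma cov_self: "cov M Y Y = (\<integral>\<omega>. (Y \<omega>)\<^sup>2 \<partial>M)"
  by (simp add: cov_def power2_eq_square)

lemma cov_diff_self: "cov M (Y - Z) (Y - Z) = (\<integral>\<omega>. (Y \<omega> - Z \<omega>)\<^sup>2 \<partial>M)"
  by (simp add: cov_self)

lemma (in prob_space) cov_complete:
  assumes Z: "\<And>n. sq_integrable M (Z n)"
    and "\<forall>e>0. \<exists>N. \<forall>m\<ge>N. \<forall>n\<ge>N. cov M (Z m - Z n) (Z m - Z n) < e"
  shows "\<exists>Y. sq_integrable M Y \<and> (\<lambda>n. cov M (Z n - Y) (Z n - Y)) \<longlonglongrightarrow> 0"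
  using sq_integrable_complete[of Z] assms unfolding cov_diff_self by simp

text \<open>The closure is taken among functions, not classes: with \<open>Y\<close> it contains
  every measurable function that agrees with \<open>Y\<close> almost everywhere.\<close>

definition L2_closure :: "'w measure \<Rightarrow> ('w \<Rightarrow> real) set \<Rightarrow> ('w \<Rightarrow> real) set"
  where "L2_closure M W = {Y. sq_integrable M Y \<and>
    (\<exists>Z :: nat \<Rightarrow> 'w \<Rightarrow> real. (\<forall>n. Z n \<in> W) \<and> (\<lambda>n. cov M (Z n - Y) (Z n - Y)) \<longlonglongrightarrow> 0)}"

lemma L2_closure_superset:
  assumes "\<And>Y. Y \<in> W \<Longrightarrow> sq_integrable M Y"
  shows "W \<subseteq> L2_closure M W"
  using assms by (auto simp: L2_closure_def cov_def intro!: exI[of _ "\<lambda>_. _"])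

lemma subspace_L2_closure:
  assumes W: "subspace W" "\<And>Y. Y \<in> W \<Longrightarrow> sq_integrable M Y"
  shows "subspace (L2_closure M W)"
proof -
  interpret L2: semi_inner_on "{Y. sq_integrable M Y}" "cov M" by (rule cov_semi_inner)
  have "X + Y \<in> L2_closure M W" if XY: "X \<in> L2_closure M W" "Y \<in> L2_closure M W" for X Y
  proof -
    from XY obtain A B where X: "sq_integrable M X" "\<And>n. A n \<in> W" "(\<lambda>n. cov M (A n - X) (A n - X)) \<longlonglongrightarrow> 0"
      and Y: "sq_integrable M Y" "\<And>n. B n \<in> W" "(\<lambda>n. cov M (B n - Y) (B n - Y)) \<longlonglongrightarrow> 0"
      unfolding L2_closure_def by blast
    have sq: "A n - X \<in> {Y. sq_integrable M Y}" "B n - Y \<in> {Y. sq_integrable M Y}" for n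
      using L2.V_diff X Y W(2) by simp_all
    have "(\<lambda>n. 2 * cov M (A n - X) (A n - X) + 2 * cov M (B n - Y) (B n - Y)) \<longlonglongrightarrow> 2 * 0 + 2 * 0"
      by (intro tendsto_intros X Y)
    then have lim: "(\<lambda>n. 2 * cov M (A n - X) (A n - X) + 2 * cov M (B n - Y) (B n - Y)) \<longlonglongrightarrow> 0" by simp
    have "(\<lambda>n. cov M ((A n - X) + (B n - Y)) ((A n - X) + (B n - Y))) \<longlonglongrightarrow> 0"
      by (rule tendsto_sandwich[OF _ _ tendsto_const lim])
        (use L2.ip_add_self_le[OF sq] L2.ip_nonneg[OF L2.V_add[OF sq]] in \<open>auto intro!: always_eventually\<close>)
    moreover have "(A n - X) + (B n - Y) = (A n + B n) - (X + Y)" for n by simp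
    ultimately have "(\<lambda>n. cov M ((A n + B n) - (X + Y)) ((A n + B n) - (X + Y))) \<longlonglongrightarrow> 0" by simp
    moreover have "A n + B n \<in> W" for n using W(1) X Y by (simp add: subspace_add)
    ultimately show ?thesis using L2.V_add[of X Y] X(1) Y(1)
      unfolding L2_closure_def by (auto intro!: exI[of _ "\<lambda>n. A n + B n"])
  qed
  moreover have "c *\<^sub>R X \<in> L2_closure M W" if X: "X \<in> L2_closure M W" for c X
  proof -
    from X obtain A where X: "sq_integrable M X" "\<And>n. A n \<in> W" "(\<lambda>n. cov M (A n - X) (A n - X)) \<longlonglongrightarrow> 0"
      unfolding L2_closure_def by blast
    have sq: "A n - X \<in> {Y. sq_integrable M Y}" for n
      using L2.V_diff X W(2) by simp_all
    have "cov M (c *\<^sub>R A n - c *\<^sub>R X) (c *\<^sub>R A n - c *\<^sub>R X) = c * (c * cov M (A n - X) (A n - X))" for n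
      using L2.ip_scaleR[OF sq L2.V_scaleR[OF sq]] L2.ip_scaleR_right[OF sq sq]
      by (simp add: scaleR_diff_right)
    moreover have "(\<lambda>n. c * (c * cov M (A n - X) (A n - X))) \<longlonglongrightarrow> c * (c * 0)"
      by (intro tendsto_intros X)
    ultimately have "(\<lambda>n. cov M (c *\<^sub>R A n - c *\<^sub>R X) (c *\<^sub>R A n - c *\<^sub>R X)) \<longlonglongrightarrow> 0" by simp
    moreover have "c *\<^sub>R A n \<in> W" for n using W(1) X by (simp add: subspace_scale)
    ultimately show ?thesis using L2.V_scaleR[of X c] X(1)
      unfolding L2_closure_def by (auto intro!: exI[of _ "\<lambda>n. c *\<^sub>R A n"])
  qed
  moreover have "0 \<in> L2_closure M W"
    using L2_closure_superset[of W M] W subspace_0 by blast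
  ultimately show ?thesis unfolding subspace_def by blast
qed

text \<open>A diagonal choice: \<open>A n\<close> in \<open>W\<close> has squared distance less than
  \<open>1 / (n + 1)\<close> from \<open>Z n\<close>, so it shares the limit of
  \<open>Z n\<close>.\<close>

lemma L2_closure_closed:
  assumes W: "\<And>Y. Y \<in> W \<Longrightarrow> sq_integrable M Y"
    and Y: "sq_integrable M Y" and Z: "\<And>n :: nat. Z n \<in> L2_closure M W"
    and lim: "(\<lambda>n. cov M (Z n - Y) (Z n - Y)) \<longlonglongrightarrow> 0"
  shows "Y \<in> L2_closure M W"
proof -
  interpret L2: semi_inner_on "{Y. sq_integrable M Y}" "cov M" by (rule cov_semi_inner)
  have sqZ: "sq_integrable M (Z n)" for n using Z by (simp add: L2_closure_def)
  have "\<exists>A\<in>W. cov M (A - Z n) (A - Z n) < inverse (real (Suc n))" for n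
  proof -
    obtain A where A: "\<And>i. A i \<in> W" "(\<lambda>i. cov M (A i - Z n) (A i - Z n)) \<longlonglongrightarrow> 0"
      using Z[of n] unfolding L2_closure_def by blast
    then have "\<forall>\<^sub>F i in sequentially. cov M (A i - Z n) (A i - Z n) < inverse (real (Suc n))"
      by (intro order_tendstoD(2)[OF A(2)]) simp
    then show ?thesis using A(1) by (meson eventually_sequentially order_refl)
  qed
  then obtain A where A: "\<And>n. A n \<in> W" "\<And>n. cov M (A n - Z n) (A n - Z n) < inverse (real (Suc n))"
    by metis
  have "(\<lambda>n. 2 * inverse (real (Suc n)) + 2 * cov M (Z n - Y) (Z n - Y)) \<longlonglongrightarrow> 2 * 0 + 2 * 0"
    by (intro tendsto_intros lim LIMSEQ_inverse_real_of_nat)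
  then have lim': "(\<lambda>n. 2 * inverse (real (Suc n)) + 2 * cov M (Z n - Y) (Z n - Y)) \<longlonglongrightarrow> 0" by simp
  have "cov M (A n - Y) (A n - Y) \<le> 2 * inverse (real (Suc n)) + 2 * cov M (Z n - Y) (Z n - Y)" for n
    using L2.ip_diff_self_le[of "A n" "Z n" Y] A(2)[of n] W[OF A(1)] sqZ Y by (smt (verit) mem_Collect_eq)
  moreover have "0 \<le> cov M (A n - Y) (A n - Y)" for n by (simp add: cov_self)
  ultimately have "(\<lambda>n. cov M (A n - Y) (A n - Y)) \<longlonglongrightarrow> 0"
    by (intro tendsto_sandwich[OF _ _ tendsto_const lim']) (auto intro!: always_eventually)
  then show ?thesis using Y A(1) unfolding L2_closure_def by blast
qed

text \<open>Joint normality is encoded by linearity: every linear combination of members is again a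
  member and hence Gaussian. The closedness clause also gives invariance under almost sure
  modification, see \<open>G_AE_cong\<close>.\<close>

locale gaussian_space = prob_space M for M :: "'w measure" +
  fixes G :: "('w \<Rightarrow> real) set"
  assumes G_subspace: "subspace G"
    and G_gaussian: "Y \<in> G \<Longrightarrow> centered_gaussian M Y"
    and G_closed: "sq_integrable M Y \<Longrightarrow> (\<And>n :: nat. Z n \<in> G) \<Longrightarrow>
      (\<lambda>n. cov M (Z n - Y) (Z n - Y)) \<longlonglongrightarrow> 0 \<Longrightarrow> Y \<in> G"
begin

sublocale L2: semi_inner_on "{Y. sq_integrable M Y}" "cov M" by (rule cov_semi_inner)

lemma G_sq_integrable: "Y \<in> G \<Longrightarrow> sq_integrable M Y"
  using G_gaussian centered_gaussian_imp_char(1) by blast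

lemma G_borel: "Y \<in> G \<Longrightarrow> Y \<in> borel_measurable M"
  using G_sq_integrable sq_integrableD(1) by blast

lemma G_AE_cong:
  assumes "Y \<in> G" "Z \<in> borel_measurable M" "AE \<omega> in M. Y \<omega> = Z \<omega>"
  shows "Z \<in> G"
proof (rule G_closed)
  show "sq_integrable M Z"
    using sq_integrable_cong_AE[OF G_sq_integrable[OF assms(1)] assms(2,3)] .
  note [measurable] = G_borel[OF assms(1)] assms(2)
  have "cov M (Y - Z) (Y - Z) = (\<integral>\<omega>. 0 \<partial>M)"
    unfolding cov_diff_self by (rule integral_cong_AE) (use assms(3) in auto)
  then show "(\<lambda>n. cov M (Y - Z) (Y - Z)) \<longlonglongrightarrow> 0" by simp
qed (use assms(1) in auto)

lemma L2_closure_subset: "W \<subseteq> G \<Longrightarrow> L2_closure M W \<subseteq> G"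
  unfolding L2_closure_def using G_closed by blast

lemma G_sum: "(\<And>i. i \<in> I \<Longrightarrow> Y i \<in> G) \<Longrightarrow> (\<lambda>\<omega>. \<Sum>i\<in>I. Y i \<omega>) \<in> G"
  using subspace_sum[OF G_subspace, of I Y] by (simp add: sum_fun_apply)

lemma G_cmult: "Y \<in> G \<Longrightarrow> (\<lambda>\<omega>. c * Y \<omega>) \<in> G"
  using subspace_scale[OF G_subspace, of Y c] by (simp add: scaleR_fun_def)

lemma G_diff: "Y \<in> G \<Longrightarrow> Z \<in> G \<Longrightarrow> (\<lambda>\<omega>. Y \<omega> - Z \<omega>) \<in> G"
  using subspace_diff[OF G_subspace, of Y Z] by (simp add: fun_diff_def)

end

lemma gaussian_space_L2_closure:
  assumes "prob_space M" and W: "subspace W" "\<And>Y. Y \<in> W \<Longrightarrow> centered_gaussian M Y"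
  shows "gaussian_space M (L2_closure M W)"
proof -
  interpret prob_space M by fact
  have sq: "sq_integrable M Y" if "Y \<in> W" for Y
    using centered_gaussian_imp_char(1) W(2) that by blast
  show ?thesis
  proof
    show "subspace (L2_closure M W)" by (rule subspace_L2_closure[OF W(1) sq])
    show "centered_gaussian M Y" if "Y \<in> L2_closure M W" for Y
    proof -
      from that obtain Z where "sq_integrable M Y" "\<And>n. Z n \<in> W" "(\<lambda>n. cov M (Z n - Y) (Z n - Y)) \<longlonglongrightarrow> 0"
        unfolding L2_closure_def by blast
      then show ?thesis
        using centered_gaussian_L2_limit[of Y Z] W(2) unfolding cov_diff_self by blast
    qed
  qed (rule L2_closure_closed[OF sq])
qed

lemma span_process_gaussian:
  assumes "centered_gaussian_process M \<xi>" "Y \<in> span (range \<xi>)"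
  shows "centered_gaussian M Y"
proof -
  obtain S r where S: "finite S" "S \<subseteq> range \<xi>" and Y: "Y = (\<Sum>a\<in>S. r a *\<^sub>R a)"
    using assms(2) unfolding span_explicit by blast
  \<comment> \<open>Different indices may carry the same function. One index is selected for each
    function in \<open>S\<close>, so that the combination becomes a sum over indices.\<close>
  obtain U where U: "inj_on \<xi> U" "S = \<xi> ` U" using S(2) unfolding subset_image_inj by blast
  have "Y = (\<Sum>t\<in>U. r (\<xi> t) *\<^sub>R \<xi> t)" unfolding Y U(2) using U(1) by (simp add: sum.reindex)
  then have Yeq: "Y = (\<lambda>\<omega>. \<Sum>t\<in>U. r (\<xi> t) * \<xi> t \<omega>)"
    unfolding sum_fun_apply scaleR_fun_def real_scaleR_def .
  have "finite U" using S(1) U finite_image_iff by blast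
  then have "centered_gaussian_vector M U \<xi>"
    using assms(1) by (simp add: centered_gaussian_process_def)
  then have "\<forall>c. centered_gaussian M (\<lambda>\<omega>. \<Sum>t\<in>U. c t * \<xi> t \<omega>)"
    unfolding centered_gaussian_vector_def .
  from spec[OF this, of "\<lambda>t. r (\<xi> t)"] show ?thesis unfolding Yeq .
qed

lemma cov_eq_on_span:
  assumes S: "\<And>s. s \<in> S \<Longrightarrow> sq_integrable M s" and X: "sq_integrable M X" and Y: "sq_integrable M Y"
    and eq: "\<And>s. s \<in> S \<Longrightarrow> cov M X s = cov M Y s" and Z: "Z \<in> span S"
  shows "sq_integrable M Z \<and> cov M X Z = cov M Y Z"
proof -
  interpret L2: semi_inner_on "{Y. sq_integrable M Y}" "cov M" by (rule cov_semi_inner)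
  show ?thesis using Z
  proof (induction rule: span_induct_alt)
    case base
    have "sq_integrable M (0 :: _ \<Rightarrow> real)" using L2.V_0 by simp
    then show ?case by (simp add: cov_def sq_integrable_zero)
  next
    case (step c s z)
    then have "c *\<^sub>R s \<in> {Y. sq_integrable M Y}" "z \<in> {Y. sq_integrable M Y}" using S L2.V_scaleR[of s c] by simp_all
    then show ?case
      using step S X Y eq L2.V_add[of "c *\<^sub>R s" z] by (simp add: L2.ip_add_right L2.ip_scaleR_right del: plus_fun_apply)
  qed
qed

text \<open>\<open>Y\<close> is a limit of elements of the span, all orthogonal to \<open>Y\<close>,
  and is therefore orthogonal to itself. This is the device for showing that two variables in the
  closed span of the process agree almost surely.\<close>

lemma L2_closure_span_orthogonal:
  assumes S: "\<And>s. s \<in> S \<Longrightarrow> sq_integrable M s" and Y: "Y \<in> L2_closure M (span S)"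
    and orth: "\<And>s. s \<in> S \<Longrightarrow> cov M Y s = 0"
  shows "cov M Y Y = 0"
proof -
  interpret L2: semi_inner_on "{Y. sq_integrable M Y}" "cov M" by (rule cov_semi_inner)
  obtain Z where sq: "sq_integrable M Y" and Z: "\<And>n. Z n \<in> span S" "(\<lambda>n. cov M (Z n - Y) (Z n - Y)) \<longlonglongrightarrow> 0"
    using Y unfolding L2_closure_def by blast
  have z: "sq_integrable M (Z n)" "cov M Y (Z n) = 0" for n
    using cov_eq_on_span[of S M Y 0 "Z n"] S sq orth Z(1) L2.V_0 by (auto simp: L2.ip_0 cov_def)
  have "(\<lambda>n. cov M Y (Z n)) \<longlonglongrightarrow> cov M Y Y"
    using L2.ip_tendsto[of "\<lambda>_. Y" Y Z Y] sq z(1) Z(2) by (simp add: cov_def)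
  then have "(\<lambda>n::nat. 0 :: real) \<longlonglongrightarrow> cov M Y Y" by (simp only: z(2))
  then show ?thesis using LIMSEQ_unique tendsto_const by blast
qed

text \<open>The space is the image of the closed span \<open>G\<close> of the process under
  \<open>\<Phi> Y = (\<lambda>t. cov M Y (\<xi> t))\<close>, which sends \<open>\<xi> t\<close> to
  the kernel section at \<open>t\<close>. Two elements of \<open>G\<close> with the same image
  differ by a null variable, so the covariance of arbitrarily chosen preimages is a well-defined
  inner product. Completeness is inherited from the square integrable functions.\<close>

lemma rkhs_exists:
  fixes \<xi> :: "'t \<Rightarrow> 'w \<Rightarrow> real"
  assumes "prob_space M" and \<xi>: "\<And>t. sq_integrable M (\<xi> t)"
  shows "\<exists>V ip. is_rkhs (covariance_function M \<xi>) V ip"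
proof -
  interpret prob_space M by fact
  interpret L2: semi_inner_on "{Y. sq_integrable M Y}" "cov M" by (rule cov_semi_inner)
  define W where "W = span (range \<xi>)"
  define G where "G = L2_closure M W"
  \<comment> \<open>Only the integrability half of \<open>cov_eq_on_span\<close> is wanted; its two
    compared variables are both filled with the dummy \<open>\<xi> undefined\<close>.\<close>
  have Wsq: "sq_integrable M Z" if "Z \<in> W" for Z
    using cov_eq_on_span[of "range \<xi>" M "\<xi> undefined" "\<xi> undefined" Z] \<xi> that by (auto simp: W_def)
  have Gsub: "subspace G" unfolding G_def W_def by (rule subspace_L2_closure) (auto simp: Wsq[unfolded W_def])
  have Gsq: "sq_integrable M Y" if "Y \<in> G" for Y using that by (simp add: G_def L2_closure_def)
  have Gin: "Y \<in> {Y. sq_integrable M Y}" if "Y \<in> G" for Y using Gsq that by simp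
  have \<xi>G: "\<xi> t \<in> G" for t
    using L2_closure_superset[of W M] Wsq span_base[of "\<xi> t" "range \<xi>"] by (auto simp: G_def W_def)
  define \<Phi> where "\<Phi> Y = (\<lambda>t. cov M Y (\<xi> t))" for Y
  have \<Phi>_add: "\<Phi> (X + Y) = \<Phi> X + \<Phi> Y" if "X \<in> G" "Y \<in> G" for X Y
    using Gsq that \<xi> by (simp add: \<Phi>_def fun_eq_iff L2.ip_add)
  have \<Phi>_scaleR: "\<Phi> (c *\<^sub>R X) = c *\<^sub>R \<Phi> X" if "X \<in> G" for c X
    using Gsq that \<xi> by (simp add: \<Phi>_def fun_eq_iff L2.ip_scaleR scaleR_fun_apply)
  have \<Phi>_diff: "\<Phi> (X - Y) = \<Phi> X - \<Phi> Y" if "X \<in> G" "Y \<in> G" for X Y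
    using Gsq that \<xi> by (simp add: \<Phi>_def fun_eq_iff L2.ip_diff)
  define J where "J x = (SOME Y. Y \<in> G \<and> \<Phi> Y = x)" for x
  have J: "J x \<in> G" "\<Phi> (J x) = x" if "x \<in> \<Phi> ` G" for x
    unfolding J_def using someI_ex[of "\<lambda>Y. Y \<in> G \<and> \<Phi> Y = x"] that by blast+
  have null: "cov M (X - Y) (X - Y) = 0" if "X \<in> G" "Y \<in> G" "\<Phi> X = \<Phi> Y" for X Y
  proof (rule L2_closure_span_orthogonal)
    show "X - Y \<in> L2_closure M (span (range \<xi>))"
      using subspace_diff[OF Gsub that(1,2)] by (simp add: G_def W_def)
    show "cov M (X - Y) s = 0" if "s \<in> range \<xi>" for s
      using fun_cong[OF \<open>\<Phi> X = \<Phi> Y\<close>] Gsq \<open>X \<in> G\<close> \<open>Y \<in> G\<close> that \<xi> by (auto simp: \<Phi>_def L2.ip_diff)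
  qed (use \<xi> in auto)
  have eq: "cov M X Z = cov M Y Z" if "X \<in> G" "Y \<in> G" "\<Phi> X = \<Phi> Y" "Z \<in> G" for X Y Z
    using L2.ip_null[OF L2.V_diff[OF Gin[OF that(1)] Gin[OF that(2)]] Gin[OF that(4)] null[OF that(1-3)]]
      L2.ip_diff[OF Gin[OF that(1)] Gin[OF that(2)] Gin[OF that(4)]] by simp
  define ip where "ip x y = cov M (J x) (J y)" for x y
  have ip: "ip (\<Phi> X) (\<Phi> Y) = cov M X Y" if "X \<in> G" "Y \<in> G" for X Y
  proof -
    have JX: "J (\<Phi> X) \<in> G" "\<Phi> (J (\<Phi> X)) = \<Phi> X" using J[OF imageI[OF that(1)]] by auto
    have JY: "J (\<Phi> Y) \<in> G" "\<Phi> (J (\<Phi> Y)) = \<Phi> Y" using J[OF imageI[OF that(2)]] by auto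
    have "ip (\<Phi> X) (\<Phi> Y) = cov M X (J (\<Phi> Y))" unfolding ip_def by (rule eq[OF JX(1) that(1) JX(2) JY(1)])
    also have "\<dots> = cov M (J (\<Phi> Y)) X" using L2.ip_sym Gin that JY(1) by blast
    also have "\<dots> = cov M Y X" by (rule eq[OF JY(1) that(2) JY(2) that(1)])
    also have "\<dots> = cov M X Y" using L2.ip_sym Gin that by blast
    finally show ?thesis .
  qed
  have K: "(\<lambda>s. covariance_function M \<xi> s t) = \<Phi> (\<xi> t)" for t
    by (simp add: \<Phi>_def covariance_function_def cov_def mult.commute)
  have "hilbert_on (\<Phi> ` G) ip"
    unfolding hilbert_on_def
  proof (intro conjI ballI allI impI)
    show "subspace (\<Phi> ` G)"
      unfolding subspace_def
    proof (intro conjI ballI allI)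
      show "0 \<in> \<Phi> ` G"
        using \<Phi>_scaleR[OF subspace_0[OF Gsub], of 0] subspace_0[OF Gsub] by (auto intro!: image_eqI[of _ _ 0])
      show "x + y \<in> \<Phi> ` G" if "x \<in> \<Phi> ` G" "y \<in> \<Phi> ` G" for x y
        using that subspace_add[OF Gsub] by (auto simp: \<Phi>_add[symmetric])
      show "c *\<^sub>R x \<in> \<Phi> ` G" if "x \<in> \<Phi> ` G" for c x
        using that subspace_scale[OF Gsub] by (auto simp: \<Phi>_scaleR[symmetric])
    qed
    fix x y assume "x \<in> \<Phi> ` G" "y \<in> \<Phi> ` G"
    then obtain X Y where X: "X \<in> G" "x = \<Phi> X" and Y: "Y \<in> G" "y = \<Phi> Y" by blast
    show "ip x y = ip y x" using X Y ip L2.ip_sym[OF Gin Gin] by simp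
    show "ip (c *\<^sub>R x) y = c * ip x y" for c
      using X Y ip subspace_scale[OF Gsub] L2.ip_scaleR[OF Gin Gin] by (simp add: \<Phi>_scaleR[symmetric])
    fix z assume "z \<in> \<Phi> ` G"
    then obtain Z where Z: "Z \<in> G" "z = \<Phi> Z" by blast
    show "ip (x + y) z = ip x z + ip y z"
      using X Y Z ip subspace_add[OF Gsub] L2.ip_add[OF Gin Gin Gin] by (simp add: \<Phi>_add[symmetric])
  next
    fix x assume "x \<in> \<Phi> ` G"
    then obtain X where X: "X \<in> G" "x = \<Phi> X" by blast
    show "0 \<le> ip x x" using X ip L2.ip_nonneg[OF Gin] by simp
    assume "ip x x = 0"
    then have "cov M X X = 0" using X ip by simp
    then have "cov M X (\<xi> t) = 0" for t by (rule L2.ip_null[OF Gin[OF X(1)] Gin[OF \<xi>G]])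
    then show "x = 0" by (simp add: X(2) \<Phi>_def fun_eq_iff)
  next
    fix u :: "nat \<Rightarrow> 't \<Rightarrow> real"
    assume u: "\<forall>n. u n \<in> \<Phi> ` G"
      and cauchy: "\<forall>e>0. \<exists>N. \<forall>m\<ge>N. \<forall>n\<ge>N. sqrt (ip (u m - u n) (u m - u n)) < e"
    define Z where "Z n = J (u n)" for n
    have Z: "Z n \<in> G" "u n = \<Phi> (Z n)" for n using J[of "u n"] u by (simp_all add: Z_def)
    have ipd: "ip (u n - \<Phi> Y) (u n - \<Phi> Y) = cov M (Z n - Y) (Z n - Y)" if "Y \<in> G" for n Y
      unfolding Z(2) \<Phi>_diff[OF Z(1) that, symmetric]
      using ip[OF subspace_diff[OF Gsub Z(1) that] subspace_diff[OF Gsub Z(1) that]] .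
    have "\<forall>e>0. \<exists>N. \<forall>m\<ge>N. \<forall>n\<ge>N. cov M (Z m - Z n) (Z m - Z n) < e"
    proof (intro allI impI)
      fix e :: real assume e: "0 < e"
      have "0 < sqrt e" using e by simp
      then obtain N where N: "\<forall>m\<ge>N. \<forall>n\<ge>N. sqrt (ip (u m - u n) (u m - u n)) < sqrt e"
        using cauchy by blast
      have "cov M (Z m - Z n) (Z m - Z n) < e" if "m \<ge> N" "n \<ge> N" for m n
      proof -
        have "sqrt (ip (u m - u n) (u m - u n)) < sqrt e" using N that by blast
        then show ?thesis using ipd[OF Z(1), of m n] by (simp only: real_sqrt_less_iff Z(2)[of n, symmetric])
      qed
      then show "\<exists>N. \<forall>m\<ge>N. \<forall>n\<ge>N. cov M (Z m - Z n) (Z m - Z n) < e" by blast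
    qed
    from cov_complete[OF Gsq[OF Z(1)] this]
    obtain Y where Y: "sq_integrable M Y" "(\<lambda>n. cov M (Z n - Y) (Z n - Y)) \<longlonglongrightarrow> 0" by (elim exE conjE)
    have YG: "Y \<in> G" unfolding G_def
      by (rule L2_closure_closed[OF Wsq Y(1) _ Y(2)]) (use Z(1) in \<open>simp_all add: G_def\<close>)
    have "(\<lambda>n. sqrt (cov M (Z n - Y) (Z n - Y))) \<longlonglongrightarrow> sqrt 0" by (intro tendsto_intros Y(2))
    then show "\<exists>l\<in>\<Phi> ` G. (\<lambda>n. sqrt (ip (u n - l) (u n - l))) \<longlonglongrightarrow> 0"
      using YG by (intro bexI[of _ "\<Phi> Y"]) (simp_all add: ipd)
  qed
  moreover have "(\<lambda>s. covariance_function M \<xi> s t) \<in> \<Phi> ` G" for t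
    unfolding K using \<xi>G by blast
  moreover have "ip x (\<lambda>s. covariance_function M \<xi> s t) = x t" if "x \<in> \<Phi> ` G" for x t
  proof -
    obtain X where "x = \<Phi> X" "X \<in> G" using \<open>x \<in> \<Phi> ` G\<close> by (rule imageE)
    then show ?thesis unfolding K using ip[OF _ \<xi>G] by (simp add: \<Phi>_def)
  qed
  ultimately have "is_rkhs (covariance_function M \<xi>) (\<Phi> ` G) ip"
    by (simp add: is_rkhs_def)
  then show ?thesis by blast
qed

lemma is_rkhs_rkhs:
  assumes "prob_space M" "\<And>t. sq_integrable M (\<xi> t)"
  shows "is_rkhs (covariance_function M \<xi>) (rkhs (covariance_function M \<xi>)) (rkhs_inner (covariance_function M \<xi>))"
proof -
  obtain V ip where "is_rkhs (covariance_function M \<xi>) V ip" using rkhs_exists[OF assms(1), of \<xi>] assms(2) by blast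
  then have "is_rkhs (covariance_function M \<xi>) (fst (V, ip)) (snd (V, ip))" by simp
  then show ?thesis unfolding rkhs_def rkhs_inner_def rkhs_structure_def
    by (rule someI[of "\<lambda>p. is_rkhs (covariance_function M \<xi>) (fst p) (snd p)"])
qed

text \<open>On the span of the process, \<open>\<Phi>\<close> maps \<open>\<xi> t\<close> to the
  kernel section \<open>k t\<close> and preserves inner products. The kernel sections span a dense
  subspace of \<open>V\<close>, so each \<open>x\<close> is a limit of vectors
  \<open>\<Phi> (Z n)\<close>; by isometry \<open>Z n\<close> is Cauchy, and its limit is a choice
  for \<open>J x\<close>.\<close>

lemma rkhs_isometry:
  fixes \<xi> :: "'t \<Rightarrow> 'w \<Rightarrow> real"
  assumes "prob_space M" and \<xi>: "\<And>t. sq_integrable M (\<xi> t)"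
    and V: "is_rkhs (covariance_function M \<xi>) V ip"
  shows "\<exists>J. (\<forall>x\<in>V. J x \<in> L2_closure M (span (range \<xi>)) \<and> (\<forall>t. cov M (J x) (\<xi> t) = x t)) \<and>
    (\<forall>x\<in>V. \<forall>y\<in>V. cov M (J x) (J y) = ip x y)"
proof -
  interpret prob_space M by fact
  interpret L2: semi_inner_on "{Y. sq_integrable M Y}" "cov M" by (rule cov_semi_inner)
  have H: "hilbert_on V ip" using V by (simp add: is_rkhs_def)
  interpret V: semi_inner_on V ip by (rule hilbert_on_imp_semi_inner_on[OF H])
  define k where "k t = (\<lambda>s. covariance_function M \<xi> s t)" for t
  have k: "k t \<in> V" "x \<in> V \<Longrightarrow> ip x (k t) = x t" for t x
    using V by (auto simp: is_rkhs_def k_def)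
  define W where "W = span (range \<xi>)"
  define G where "G = L2_closure M W"
  have Wsq: "sq_integrable M Z" if "Z \<in> W" for Z
    using cov_eq_on_span[of "range \<xi>" M "\<xi> undefined" "\<xi> undefined" Z] \<xi> that by (auto simp: W_def)
  have Gsub: "subspace G" unfolding G_def W_def by (rule subspace_L2_closure) (auto simp: Wsq[unfolded W_def])
  have Gsq: "sq_integrable M Y" if "Y \<in> G" for Y using that by (simp add: G_def L2_closure_def)
  define \<Phi> where "\<Phi> Y = (\<lambda>t. cov M Y (\<xi> t))" for Y
  have \<Phi>_add: "\<Phi> (X + Y) = \<Phi> X + \<Phi> Y" if "sq_integrable M X" "sq_integrable M Y" for X Y
    using that \<xi> by (simp add: \<Phi>_def fun_eq_iff L2.ip_add)
  have \<Phi>_scaleR: "\<Phi> (c *\<^sub>R X) = c *\<^sub>R \<Phi> X" if "sq_integrable M X" for c X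
    using that \<xi> by (simp add: \<Phi>_def fun_eq_iff L2.ip_scaleR scaleR_fun_apply)
  have \<Phi>_diff: "\<Phi> (X - Y) = \<Phi> X - \<Phi> Y" if "sq_integrable M X" "sq_integrable M Y" for X Y
    using that \<xi> by (simp add: \<Phi>_def fun_eq_iff L2.ip_diff)
  have \<Phi>_0: "\<Phi> 0 = 0" by (simp add: \<Phi>_def fun_eq_iff cov_def)
  have \<Phi>\<xi>: "\<Phi> (\<xi> t) = k t" for t
    by (simp add: \<Phi>_def k_def covariance_function_def cov_def mult.commute)
  have span_ip: "sq_integrable M Z \<and> \<Phi> Z \<in> V \<and> (\<forall>Y. sq_integrable M Y \<longrightarrow> \<Phi> Y \<in> V \<longrightarrow> ip (\<Phi> Y) (\<Phi> Z) = cov M Y Z)"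
    if "Z \<in> W" for Z
    using that unfolding W_def
  proof (induction rule: span_induct_alt)
    case base
    have "ip v 0 = 0" if "v \<in> V" for v using V.ip_sym[OF V.V_0 that] V.ip_0[OF that] by simp
    then show ?case using \<Phi>_0 V.V_0 L2.V_0 by (auto simp: cov_def zero_fun_def)
  next
    case (step c s z)
    obtain t where s: "s = \<xi> t" using step(1) by (rule rangeE)
    have sq: "sq_integrable M (c *\<^sub>R \<xi> t)" using \<xi> L2.V_scaleR[of "\<xi> t" c] by simp
    then have sq': "sq_integrable M (c *\<^sub>R \<xi> t + z)" using L2.V_add[of "c *\<^sub>R \<xi> t" z] step(2) by simp
    have "ip (\<Phi> Y) (k t) = cov M Y (\<xi> t)" if "\<Phi> Y \<in> V" for Y
      using k(2)[OF that, of t] unfolding \<Phi>_def by simp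
    then show ?case
      using \<xi> step(2) sq sq' k(1)[of t]
      by (simp add: s \<Phi>_add \<Phi>_scaleR \<Phi>\<xi> V.V_add V.V_scaleR V.ip_add_right V.ip_scaleR_right
          L2.ip_add_right L2.ip_scaleR_right del: plus_fun_apply)
  qed
  have Wsub: "subspace W" by (simp add: W_def)
  have iso: "ip (\<Phi> Y) (\<Phi> Z) = cov M Y Z" if "Y \<in> W" "Z \<in> W" for Y Z
    using span_ip[OF that(1)] span_ip[OF that(2)] by simp
  have "\<exists>Y. Y \<in> G \<and> \<Phi> Y = x \<and> cov M Y Y = ip x x" if x: "x \<in> V" for x
  proof -
    have kV: "span (range k) \<subseteq> V" using k(1) by (intro span_minimal V.subspace) auto
    have "\<exists>p\<in>V. (\<forall>u\<in>span (range k). ip p u = ip x u) \<and>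
      (\<exists>u. (\<forall>n. u n \<in> span (range k)) \<and> (\<lambda>n. ip (u n - p) (u n - p)) \<longlonglongrightarrow> 0)"
    proof (rule hilbert_representation[OF H subspace_span kV, where C = "sqrt (ip x x)"])
      fix u v assume uv: "u \<in> span (range k)" "v \<in> span (range k)"
      show "ip x (u + v) = ip x u + ip x v" using uv kV x by (intro V.ip_add_right) auto
    next
      fix c u assume u: "u \<in> span (range k)"
      show "ip x (c *\<^sub>R u) = c * ip x u" using u kV x by (intro V.ip_scaleR_right) auto
      show "\<bar>ip x u\<bar> \<le> sqrt (ip x x) * sqrt (ip u u)" using u kV x by (intro V.ip_Cauchy_Schwarz_sqrt) auto
    qed
    then obtain p u where p: "p \<in> V" "\<And>u. u \<in> span (range k) \<Longrightarrow> ip p u = ip x u"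
      and u: "\<And>n. u n \<in> span (range k)" "(\<lambda>n. ip (u n - p) (u n - p)) \<longlonglongrightarrow> 0" by blast
    \<comment> \<open>Density of the kernel sections: the projection \<open>p\<close> of
      \<open>x\<close> onto the closure of their span has the same inner products with them as
      \<open>x\<close>, which by the reproducing property means the same values.\<close>
    have "p t = x t" for t
      using p(2)[OF span_base[of "k t"]] k(2)[OF p(1)] k(2)[OF x] by auto
    then have px: "p = x" by (rule ext)
    have "span (range k) \<subseteq> \<Phi> ` W"
    proof (rule span_minimal)
      show "range k \<subseteq> \<Phi> ` W"
        using span_base[of _ "range \<xi>"] by (auto simp: \<Phi>\<xi>[symmetric] W_def)
      show "subspace (\<Phi> ` W)" unfolding subspace_def
      proof (intro conjI ballI allI)
        show "0 \<in> \<Phi> ` W" using \<Phi>_0 span_zero[of "range \<xi>"] by (intro image_eqI[of _ _ 0]) (simp_all add: W_def)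
        show "a + b \<in> \<Phi> ` W" if "a \<in> \<Phi> ` W" "b \<in> \<Phi> ` W" for a b
          using that span_add[of _ "range \<xi>"] Wsq by (auto simp: \<Phi>_add[symmetric] W_def)
        show "c *\<^sub>R a \<in> \<Phi> ` W" if "a \<in> \<Phi> ` W" for c a
          using that span_scale[of _ "range \<xi>"] Wsq by (auto simp: \<Phi>_scaleR[symmetric] W_def)
      qed
    qed
    then have "\<forall>n. \<exists>Z. Z \<in> W \<and> u n = \<Phi> Z" using u(1) by blast
    then obtain Z where Z: "\<And>n. Z n \<in> W" "\<And>n. u n = \<Phi> (Z n)" by metis
    have uV: "u n \<in> V" for n using u(1) kV by auto
    have lim: "(\<lambda>n. ip (u n - x) (u n - x)) \<longlonglongrightarrow> 0" using u(2) px by simp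
    have covZ: "cov M (Z m - Z n) (Z m - Z n) = ip (u m - u n) (u m - u n)" for m n
      unfolding Z(2) \<Phi>_diff[OF Wsq[OF Z(1)] Wsq[OF Z(1)], symmetric]
      by (rule iso[OF subspace_diff[OF Wsub Z(1) Z(1)] subspace_diff[OF Wsub Z(1) Z(1)], symmetric])
    have "\<forall>e>0. \<exists>N. \<forall>m\<ge>N. \<forall>n\<ge>N. cov M (Z m - Z n) (Z m - Z n) < e"
    proof (intro allI impI)
      fix e :: real assume e: "0 < e"
      have "\<forall>\<^sub>F n in sequentially. ip (u n - x) (u n - x) < e / 4"
        by (rule order_tendstoD(2)[OF lim]) (use e in simp)
      then obtain N where N: "\<And>n. n \<ge> N \<Longrightarrow> ip (u n - x) (u n - x) < e / 4"
        unfolding eventually_sequentially by blast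
      have "cov M (Z m - Z n) (Z m - Z n) < e" if "m \<ge> N" "n \<ge> N" for m n
        using V.ip_diff_self_le[OF uV[of m] x uV[of n]] N[OF that(1)] N[OF that(2)] V.ip_minus_commute[OF x uV[of n]]
        unfolding covZ by linarith
      then show "\<exists>N. \<forall>m\<ge>N. \<forall>n\<ge>N. cov M (Z m - Z n) (Z m - Z n) < e" by blast
    qed
    from cov_complete[OF Wsq[OF Z(1)] this]
    obtain Y where Y: "sq_integrable M Y" "(\<lambda>n. cov M (Z n - Y) (Z n - Y)) \<longlonglongrightarrow> 0" by (elim exE conjE)
    have "Y \<in> G" unfolding G_def L2_closure_def using Y Z(1) by blast
    moreover have "cov M Y (\<xi> t) = x t" for t
    proof (rule LIMSEQ_unique)
      show "(\<lambda>n. cov M (Z n) (\<xi> t)) \<longlonglongrightarrow> cov M Y (\<xi> t)"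
        using L2.ip_tendsto[of Z Y "\<lambda>_. \<xi> t" "\<xi> t"] Wsq[OF Z(1)] Y \<xi> by (simp add: cov_def)
      have "(\<lambda>n. ip (u n) (k t)) \<longlonglongrightarrow> ip x (k t)"
        using V.ip_tendsto[of u x "\<lambda>_. k t" "k t"] uV x lim k(1) V.V_0 by (simp add: V.ip_0)
      then show "(\<lambda>n. cov M (Z n) (\<xi> t)) \<longlonglongrightarrow> x t"
        using k(2)[OF uV] k(2)[OF x] by (simp add: Z(2) \<Phi>_def)
    qed
    moreover have "cov M Y Y = ip x x"
    proof (rule LIMSEQ_unique)
      show "(\<lambda>n. cov M (Z n) (Z n)) \<longlonglongrightarrow> cov M Y Y"
        using L2.ip_tendsto[of Z Y Z Y] Wsq[OF Z(1)] Y by simp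
      show "(\<lambda>n. cov M (Z n) (Z n)) \<longlonglongrightarrow> ip x x"
        using V.ip_tendsto[of u x u x] uV x lim iso[OF Z(1) Z(1)] by (simp add: Z(2))
    qed
    ultimately show ?thesis by (auto simp: \<Phi>_def)
  qed
  then obtain J where J: "\<And>x. x \<in> V \<Longrightarrow> J x \<in> G" "\<And>x. x \<in> V \<Longrightarrow> \<Phi> (J x) = x"
      "\<And>x. x \<in> V \<Longrightarrow> cov M (J x) (J x) = ip x x" by metis
  have "cov M (J x) (J y) = ip x y" if x: "x \<in> V" and y: "y \<in> V" for x y
  proof -
    have xy: "x + y \<in> V" using x y V.V_add by blast
    \<comment> \<open>\<open>J\<close> is chosen separately for each \<open>x\<close>, hence
      additive only up to a null variable. Discarding \<open>D\<close> turns preservation of norms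
      into preservation of inner products by polarisation.\<close>
    define D where "D = J x + J y - J (x + y)"
    have DG: "D \<in> G" "J x + J y \<in> G"
      unfolding D_def using J(1)[OF x] J(1)[OF y] J(1)[OF xy] Gsub by (auto intro: subspace_add subspace_diff)
    have sq: "sq_integrable M (J x)" "sq_integrable M (J y)" "sq_integrable M (J (x + y))" "sq_integrable M D"
        "sq_integrable M (J x + J y)"
      using Gsq J(1)[OF x] J(1)[OF y] J(1)[OF xy] DG by blast+
    have "\<Phi> D = 0"
      unfolding D_def using sq by (simp add: \<Phi>_diff \<Phi>_add J(2) x y xy)
    then have "cov M D (\<xi> t) = 0" for t by (simp add: \<Phi>_def fun_eq_iff)
    then have D0: "cov M D D = 0"
      using DG \<xi> by (intro L2_closure_span_orthogonal[of "range \<xi>" M D]) (auto simp: G_def W_def)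
    have "cov M (J x + J y) (J x + J y) = cov M (J (x + y) + D) (J (x + y) + D)" by (simp add: D_def)
    also have "\<dots> = cov M (J (x + y)) (J (x + y))"
      using sq D0 L2.ip_null[of D "J (x + y)"] L2.ip_sym[of D "J (x + y)"] by (simp add: L2.ip_add_self)
    also have "\<dots> = ip (x + y) (x + y)" by (rule J(3)[OF xy])
    finally show ?thesis
      using sq x y by (simp add: L2.ip_add_self V.ip_add_self J(3))
  qed
  moreover have "cov M (J x) (\<xi> t) = x t" if "x \<in> V" for x t
    using fun_cong[OF J(2)[OF that], of t] by (simp add: \<Phi>_def)
  ultimately show ?thesis using J(1) by (intro exI[of _ J]) (simp add: G_def W_def)
qed

section \<open>Fernique's theorem\<close>

text \<open>The coordinates of the product space carry two independent copies of
  \<open>\<eta>\<close>, and Fubini's theorem factors the characteristic functional of the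
  pair.\<close>

lemma gaussian_pair_char:
  fixes \<eta> :: "'w \<Rightarrow> 'x::{banach, second_countable_topology}" and p q :: "'x \<Rightarrow> real"
  assumes "prob_space M" and \<eta>[measurable]: "\<eta> \<in> borel_measurable M"
    and gauss: "\<And>f :: 'x \<Rightarrow> real. bounded_linear f \<Longrightarrow> centered_gaussian M (\<lambda>\<omega>. f (\<eta> \<omega>))"
    and p: "bounded_linear p" and q: "bounded_linear q"
  shows "(\<integral>z. iexp (p (\<eta> (fst z)) + q (\<eta> (snd z))) \<partial>(M \<Otimes>\<^sub>M M))
    = complex_of_real (exp (- (((\<integral>\<omega>. (p (\<eta> \<omega>))\<^sup>2 \<partial>M) + (\<integral>\<omega>. (q (\<eta> \<omega>))\<^sup>2 \<partial>M)) / 2)))"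
proof -
  interpret prob_space M by fact
  interpret P: pair_prob_space M M ..
  note [measurable] = bounded_linear_borel[OF p] bounded_linear_borel[OF q]
  have int: "complex_integrable (M \<Otimes>\<^sub>M M) (\<lambda>z. iexp (p (\<eta> (fst z)) + q (\<eta> (snd z))))"
    by (rule P.P.integrable_const_bound[of _ 1]) auto
  have "(\<integral>z. iexp (p (\<eta> (fst z)) + q (\<eta> (snd z))) \<partial>(M \<Otimes>\<^sub>M M))
      = (\<integral>x. \<integral>y. iexp (p (\<eta> x) + q (\<eta> y)) \<partial>M \<partial>M)"
    using P.integral_fst'[OF int] by simp
  also have "\<dots> = (\<integral>x. iexp (p (\<eta> x)) * (\<integral>y. iexp (q (\<eta> y)) \<partial>M) \<partial>M)"
    by (simp add: exp_add distrib_left)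
  also have "\<dots> = (\<integral>x. iexp (p (\<eta> x)) \<partial>M) * (\<integral>y. iexp (q (\<eta> y)) \<partial>M)"
    by (rule integral_mult_left_zero)
  also have "\<dots> = complex_of_real (exp (- (expectation (\<lambda>\<omega>. (p (\<eta> \<omega>))\<^sup>2) / 2)))
      * complex_of_real (exp (- (expectation (\<lambda>\<omega>. (q (\<eta> \<omega>))\<^sup>2) / 2)))"
    using centered_gaussian_imp_char(2)[OF gauss[OF p], of 1]
      centered_gaussian_imp_char(2)[OF gauss[OF q], of 1] by simp
  also have "\<dots> = complex_of_real (exp (- ((expectation (\<lambda>\<omega>. (p (\<eta> \<omega>))\<^sup>2) + expectation (\<lambda>\<omega>. (q (\<eta> \<omega>))\<^sup>2)) / 2)))"
    unfolding of_real_mult[symmetric] exp_add[symmetric] by (simp add: add_divide_distrib)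
  finally show ?thesis .
qed

text \<open>A rotation of a pair of independent copies by 45 degrees preserves its law. Transposed
  to functionals it turns \<open>(g, h)\<close> into \<open>(p, q)\<close>, and the pointwise
  identity of \<open>p\<close> squared plus \<open>q\<close> squared with \<open>g\<close> squared
  plus \<open>h\<close> squared keeps the sum of the variances.\<close>

lemma gaussian_rotation:
  fixes \<eta> :: "'w \<Rightarrow> 'x::{banach, second_countable_topology}"
  assumes M: "prob_space M" and \<eta>[measurable]: "\<eta> \<in> borel_measurable M"
    and gauss: "\<And>f :: 'x \<Rightarrow> real. bounded_linear f \<Longrightarrow> centered_gaussian M (\<lambda>\<omega>. f (\<eta> \<omega>))"
  shows "distr (M \<Otimes>\<^sub>M M) borel (\<lambda>z. ((1 / sqrt 2) *\<^sub>R (\<eta> (fst z) + \<eta> (snd z)), (1 / sqrt 2) *\<^sub>R (\<eta> (fst z) - \<eta> (snd z))))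
    = distr (M \<Otimes>\<^sub>M M) borel (\<lambda>z. (\<eta> (fst z), \<eta> (snd z)))"
proof (rule distr_eqI_char)
  interpret prob_space M by fact
  interpret P: pair_prob_space M M ..
  show "prob_space (M \<Otimes>\<^sub>M M)" "prob_space (M \<Otimes>\<^sub>M M)" by (rule P.P.prob_space_axioms)+
  fix F :: "'x \<times> 'x \<Rightarrow> real" assume F: "bounded_linear F"
  define g h where "g a = F (a, 0)" and "h b = F (0, b)" for a b
  have g: "bounded_linear g" and h: "bounded_linear h"
    unfolding g_def h_def
    by (auto intro!: bounded_linear_compose[OF F] bounded_linear_Pair bounded_linear_ident bounded_linear_zero)
  have F_eq: "F (a, b) = g a + h b" for a b
    using linear_add[OF bounded_linear.linear[OF F], of "(a, 0)" "(0, b)"] by (simp add: g_def h_def)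
  define p q where "p a = (1 / sqrt 2) *\<^sub>R (g a + h a)" and "q a = (1 / sqrt 2) *\<^sub>R (g a - h a)" for a
  have p: "bounded_linear p" and q: "bounded_linear q"
    unfolding p_def q_def
    by (rule bounded_linear_compose[OF bounded_linear_scaleR_right bounded_linear_add[OF g h]]
        bounded_linear_compose[OF bounded_linear_scaleR_right bounded_linear_sub[OF g h]])+
  have "F ((1 / sqrt 2) *\<^sub>R (a + b), (1 / sqrt 2) *\<^sub>R (a - b)) = p a + q b" for a b
    unfolding F_eq p_def q_def
      linear_cmul[OF bounded_linear.linear[OF g]] linear_cmul[OF bounded_linear.linear[OF h]]
      linear_add[OF bounded_linear.linear[OF g]] linear_diff[OF bounded_linear.linear[OF h]]
    by (simp add: algebra_simps add_divide_distrib diff_divide_distrib)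
  moreover have "expectation (\<lambda>\<omega>. (p (\<eta> \<omega>))\<^sup>2) + expectation (\<lambda>\<omega>. (q (\<eta> \<omega>))\<^sup>2)
      = expectation (\<lambda>\<omega>. (g (\<eta> \<omega>))\<^sup>2) + expectation (\<lambda>\<omega>. (h (\<eta> \<omega>))\<^sup>2)"
  proof -
    have i: "integrable M (\<lambda>\<omega>. (f (\<eta> \<omega>))\<^sup>2)" if "bounded_linear f" for f :: "'x \<Rightarrow> real"
      using centered_gaussian_imp_char(1)[OF gauss[OF that]] by (simp add: sq_integrable_real)
    have "(p a)\<^sup>2 + (q a)\<^sup>2 = (g a)\<^sup>2 + (h a)\<^sup>2" for a
      by (simp add: p_def q_def power_mult_distrib power_divide power2_sum power2_diff field_simps)
    then have "expectation (\<lambda>\<omega>. (p (\<eta> \<omega>))\<^sup>2 + (q (\<eta> \<omega>))\<^sup>2)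
      = expectation (\<lambda>\<omega>. (g (\<eta> \<omega>))\<^sup>2 + (h (\<eta> \<omega>))\<^sup>2)" by simp
    then show ?thesis
      by (simp only: Bochner_Integration.integral_add[OF i[OF p] i[OF q]] Bochner_Integration.integral_add[OF i[OF g] i[OF h]])
  qed
  ultimately show "(\<integral>z. iexp (F ((1 / sqrt 2) *\<^sub>R (\<eta> (fst z) + \<eta> (snd z)), (1 / sqrt 2) *\<^sub>R (\<eta> (fst z) - \<eta> (snd z)))) \<partial>(M \<Otimes>\<^sub>M M))
      = (\<integral>z. iexp (F (\<eta> (fst z), \<eta> (snd z))) \<partial>(M \<Otimes>\<^sub>M M))"
    using gaussian_pair_char[OF M \<eta> _ p q] gaussian_pair_char[OF M \<eta> _ g h] gauss
    by (simp add: F_eq[of "\<eta> _" "\<eta> _"])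
qed measurable

text \<open>The left side is the probability that one copy is large and an independent one small. By
  rotation invariance the same holds for the scaled sum and difference of the copies; a large sum
  with a small difference forces both copies to be large, and independence squares the
  probability.\<close>

lemma gaussian_tail_step:
  fixes \<eta> :: "'w \<Rightarrow> 'x::{banach, second_countable_topology}"
  assumes M: "prob_space M" and \<eta>[measurable]: "\<eta> \<in> borel_measurable M"
    and gauss: "\<And>f :: 'x \<Rightarrow> real. bounded_linear f \<Longrightarrow> centered_gaussian M (\<lambda>\<omega>. f (\<eta> \<omega>))"
  shows "measure M {\<omega>\<in>space M. t < norm (\<eta> \<omega>)} * measure M {\<omega>\<in>space M. norm (\<eta> \<omega>) \<le> s}
    \<le> (measure M {\<omega>\<in>space M. (t - s) / sqrt 2 < norm (\<eta> \<omega>)})\<^sup>2"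
proof -
  interpret prob_space M by fact
  interpret P: pair_prob_space M M ..
  let ?M2 = "M \<Otimes>\<^sub>M M"
  have prod: "measure ?M2 {z\<in>space ?M2. A (fst z) \<and> B (snd z)} = measure M {\<omega>\<in>space M. A \<omega>} * measure M {\<omega>\<in>space M. B \<omega>}"
    if [measurable]: "Measurable.pred M A" "Measurable.pred M B" for A B
  proof -
    have "{z\<in>space ?M2. A (fst z) \<and> B (snd z)} = {\<omega>\<in>space M. A \<omega>} \<times> {\<omega>\<in>space M. B \<omega>}"
      by (auto simp: space_pair_measure)
    moreover have "emeasure ?M2 ({\<omega>\<in>space M. A \<omega>} \<times> {\<omega>\<in>space M. B \<omega>})
        = emeasure M {\<omega>\<in>space M. A \<omega>} * emeasure M {\<omega>\<in>space M. B \<omega>}"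
      by (rule emeasure_pair_measure_Times) measurable
    ultimately show ?thesis by (simp only: measure_def enn2real_mult)
  qed
  define \<zeta> where "\<zeta> z = ((1 / sqrt 2) *\<^sub>R (\<eta> (fst z) + \<eta> (snd z)), (1 / sqrt 2) *\<^sub>R (\<eta> (fst z) - \<eta> (snd z)))" for z
  define \<zeta>0 where "\<zeta>0 z = (\<eta> (fst z), \<eta> (snd z))" for z
  have [measurable]: "\<zeta> \<in> borel_measurable ?M2" "\<zeta>0 \<in> borel_measurable ?M2"
    unfolding \<zeta>_def[abs_def] \<zeta>0_def[abs_def] by measurable
  define S where "S = {x :: 'x \<times> 'x. t < norm (fst x) \<and> norm (snd x) \<le> s}"
  have [measurable]: "(\<lambda>x :: 'x \<times> 'x. norm (fst x)) \<in> borel_measurable borel"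
      "(\<lambda>x :: 'x \<times> 'x. norm (snd x)) \<in> borel_measurable borel"
    by (intro borel_measurable_continuous_onI continuous_intros)+
  have "{x \<in> space borel. t < norm (fst x) \<and> norm (snd x) \<le> s} \<in> sets (borel :: ('x \<times> 'x) measure)"
    by measurable
  then have S: "S \<in> sets borel" by (simp add: S_def)
  have "measure M {\<omega>\<in>space M. t < norm (\<eta> \<omega>)} * measure M {\<omega>\<in>space M. norm (\<eta> \<omega>) \<le> s}
      = measure ?M2 {z\<in>space ?M2. t < norm (\<eta> (fst z)) \<and> norm (\<eta> (snd z)) \<le> s}"
    by (rule prod[symmetric]) measurable
  also have "\<dots> = measure (distr ?M2 borel \<zeta>0) S"
    using S by (subst measure_distr) (auto simp: S_def \<zeta>0_def intro!: arg_cong[where f = "measure ?M2"])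
  also have "\<dots> = measure (distr ?M2 borel \<zeta>) S"
    unfolding \<zeta>_def[abs_def] \<zeta>0_def[abs_def]
    by (rule arg_cong[where f = "\<lambda>N. measure N S", OF gaussian_rotation[OF M \<eta>, symmetric]]) (rule gauss)
  also have "\<dots> = measure ?M2 {z\<in>space ?M2. \<zeta> z \<in> S}"
    using S by (subst measure_distr) (auto intro!: arg_cong[where f = "measure ?M2"])
  also have "\<dots> \<le> measure ?M2 {z\<in>space ?M2. (t - s) / sqrt 2 < norm (\<eta> (fst z)) \<and> (t - s) / sqrt 2 < norm (\<eta> (snd z))}"
  proof (rule P.P.finite_measure_mono)
    show "{z\<in>space ?M2. \<zeta> z \<in> S} \<subseteq> {z\<in>space ?M2. (t - s) / sqrt 2 < norm (\<eta> (fst z)) \<and> (t - s) / sqrt 2 < norm (\<eta> (snd z))}"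
    proof safe
      fix a b assume "\<zeta> (a, b) \<in> S"
      then have "t < norm (\<eta> a + \<eta> b) / sqrt 2" "norm (\<eta> a - \<eta> b) / sqrt 2 \<le> s"
        by (simp_all add: S_def \<zeta>_def)
      then have "sqrt 2 * t < norm (\<eta> a + \<eta> b)" "norm (\<eta> a - \<eta> b) \<le> sqrt 2 * s"
        by (simp_all add: pos_less_divide_eq pos_divide_le_eq mult.commute)
      moreover have "norm (\<eta> a + \<eta> b) \<le> norm (2 *\<^sub>R \<eta> a) + norm (\<eta> a - \<eta> b)"
          "norm (\<eta> a + \<eta> b) \<le> norm (2 *\<^sub>R \<eta> b) + norm (\<eta> a - \<eta> b)"
        using norm_triangle_ineq4[of "2 *\<^sub>R \<eta> a" "\<eta> a - \<eta> b"] norm_triangle_ineq[of "2 *\<^sub>R \<eta> b" "\<eta> a - \<eta> b"]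
        by (simp_all add: scaleR_2 add.commute)
      ultimately have "sqrt 2 * (t - s) < 2 * norm (\<eta> a)" "sqrt 2 * (t - s) < 2 * norm (\<eta> b)"
        by (simp_all add: algebra_simps)
      moreover have "(t - s) / sqrt 2 = (1 / 2) * (sqrt 2 * (t - s))" by (simp add: field_simps)
      ultimately have "(t - s) / sqrt 2 < norm (\<eta> a)" "(t - s) / sqrt 2 < norm (\<eta> b)" by linarith+
      then show "(t - s) / sqrt 2 < norm (\<eta> (fst (a, b)))" "(t - s) / sqrt 2 < norm (\<eta> (snd (a, b)))"
        by simp_all
    qed
  qed measurable
  also have "\<dots> = (measure M {\<omega>\<in>space M. (t - s) / sqrt 2 < norm (\<eta> \<omega>)})\<^sup>2"
    unfolding power2_eq_square by (rule prod) measurable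
  finally show ?thesis .
qed

lemma tail_tendsto_0:
  fixes \<eta> :: "'w \<Rightarrow> 'x::{banach, second_countable_topology}"
  assumes "prob_space M" and [measurable]: "\<eta> \<in> borel_measurable M"
  shows "(\<lambda>n. measure M {\<omega>\<in>space M. real n < norm (\<eta> \<omega>)}) \<longlonglongrightarrow> 0"
proof -
  interpret prob_space M by fact
  have "(\<lambda>n. measure M {\<omega>\<in>space M. real n < norm (\<eta> \<omega>)}) \<longlonglongrightarrow> measure M (\<Inter>n. {\<omega>\<in>space M. real n < norm (\<eta> \<omega>)})"
    by (rule finite_Lim_measure_decseq) (auto simp: decseq_def)
  also have "(\<Inter>n. {\<omega>\<in>space M. real n < norm (\<eta> \<omega>)}) = {}"
  proof (rule equals0I)
    fix \<omega> assume \<omega>: "\<omega> \<in> (\<Inter>n. {\<omega>\<in>space M. real n < norm (\<eta> \<omega>)})"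
    obtain n where "norm (\<eta> \<omega>) < real n" using reals_Archimedean2 by blast
    moreover have "real n < norm (\<eta> \<omega>)" using \<omega> by simp
    ultimately show False by simp
  qed
  finally show ?thesis by simp
qed

text \<open>\<open>gaussian_tail_step\<close> is iterated along radii growing like powers of 3/2.
  The tails decay at least like powers of 1/4, which beats the squared radii, growing like powers of
  9/4.\<close>

lemma gaussian_sq_integrable:
  fixes \<eta> :: "'w \<Rightarrow> 'x::{banach, second_countable_topology}"
  assumes M: "prob_space M" and \<eta>[measurable]: "\<eta> \<in> borel_measurable M"
    and gauss: "\<And>f :: 'x \<Rightarrow> real. bounded_linear f \<Longrightarrow> centered_gaussian M (\<lambda>\<omega>. f (\<eta> \<omega>))"
  shows "sq_integrable M \<eta>"
proof -
  interpret prob_space M by fact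
  define q where "q t = measure M {\<omega>\<in>space M. t < norm (\<eta> \<omega>)}" for t
  have q_mono: "q t' \<le> q t" if "t \<le> t'" for t t'
    unfolding q_def by (rule finite_measure_mono) (use that in auto)
  have q_nonneg: "0 \<le> q t" for t by (simp add: q_def)
  have "\<forall>\<^sub>F n in sequentially. q (real n) < 1 / 8"
    using tail_tendsto_0[OF M \<eta>] unfolding q_def by (rule order_tendstoD(2)) simp
  then obtain N where N: "q (real n) < 1 / 8" if "n \<ge> N" for n
    unfolding eventually_sequentially by blast
  \<comment> \<open>\<open>Suc N\<close> instead of \<open>N\<close> also gives
    \<open>1 \<le> s\<close>. The bound 1/8 starts the recursion, and it leaves at least mass 1/2 in
    the ball of radius \<open>s\<close>, whence the factor 2 in \<open>step\<close>.\<close>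
  define s where "s = real (Suc N)"
  have s: "1 \<le> s" "q s \<le> 1 / 8" using N[of "Suc N"] by (auto simp: s_def)
  have step: "q t \<le> 2 * (q ((t - s) / sqrt 2))\<^sup>2" for t
  proof -
    have "measure M {\<omega>\<in>space M. norm (\<eta> \<omega>) \<le> s} = 1 - q s"
      unfolding q_def by (subst prob_compl[symmetric]) (auto intro!: arg_cong[where f = prob])
    then have "1 / 2 \<le> measure M {\<omega>\<in>space M. norm (\<eta> \<omega>) \<le> s}" using s by simp
    then have "q t * (1 / 2) \<le> q t * measure M {\<omega>\<in>space M. norm (\<eta> \<omega>) \<le> s}"
      by (rule mult_left_mono) (rule q_nonneg)
    also have "\<dots> \<le> (q ((t - s) / sqrt 2))\<^sup>2"
      using gaussian_tail_step[OF M \<eta> gauss] unfolding q_def .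
    finally show ?thesis by simp
  qed
  \<comment> \<open>Closed form of the recursion \<open>t_Suc\<close> with start \<open>s\<close>.
    The factor 3/2 is a rational upper bound for \<open>sqrt 2\<close>, which makes
    \<open>(t (Suc n) - s) / sqrt 2\<close> at least \<open>t n\<close>.\<close>
  define t where "t n = s * (3 * (3 / 2) ^ n - 2)" for n :: nat
  have t0: "t 0 = s" by (simp add: t_def)
  have t_Suc: "t (Suc n) = (3 / 2) * t n + s" for n by (simp add: t_def algebra_simps)
  have t_nonneg: "0 \<le> t n" for n
    by (induction n) (use s in \<open>auto simp: t0 t_Suc\<close>)
  have t_le: "t n \<le> 3 * s * (3 / 2) ^ n" for n using s by (simp add: t_def algebra_simps)
  have sqrt2: "sqrt 2 \<le> 3 / 2" by (rule real_le_lsqrt) (auto simp: power2_eq_square)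
  have q_t: "q (t n) \<le> 1 / 8 * (1 / 4) ^ n" for n
  proof (induction n)
    case 0
    then show ?case using s by (simp add: t0)
  next
    case (Suc n)
    have "t n * sqrt 2 \<le> t n * (3 / 2)" by (rule mult_left_mono[OF sqrt2 t_nonneg])
    then have "t n \<le> (t (Suc n) - s) / sqrt 2" by (simp add: t_Suc field_simps)
    then have "q ((t (Suc n) - s) / sqrt 2) \<le> 1 / 8 * (1 / 4) ^ n" using q_mono Suc.IH by (meson order_trans)
    then have "2 * (q ((t (Suc n) - s) / sqrt 2))\<^sup>2 \<le> 2 * (1 / 8 * (1 / 4) ^ n)\<^sup>2"
      using q_nonneg by (intro mult_left_mono power_mono) auto
    also have "\<dots> = 1 / 32 * (1 / 4) ^ n * (1 / 4) ^ n" by (simp add: power2_eq_square)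
    also have "\<dots> \<le> 1 / 32 * (1 / 4) ^ n * 1" by (intro mult_left_mono power_le_one) auto
    finally show ?case using step[of "t (Suc n)"] by simp
  qed
  \<comment> \<open>Bounds the contribution of the shell between the radii \<open>t n\<close> and
    \<open>t (Suc n)\<close>. The series is dominated by a geometric one with ratio 9/4 times 1/4,
    that is, 9/16.\<close>
  define a where "a n = (t (Suc n))\<^sup>2 * q (t n)" for n
  have a_nonneg: "0 \<le> a n" for n by (simp add: a_def q_nonneg)
  have "summable a"
  proof (rule summable_comparison_test')
    show "summable (\<lambda>n. (9 * s\<^sup>2 * (9 / 4) * (1 / 8)) * (9 / 16) ^ n)"
      by (intro summable_mult summable_geometric) simp
    fix n
    have "a n \<le> (3 * s * (3 / 2) ^ Suc n)\<^sup>2 * (1 / 8 * (1 / 4) ^ n)"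
      unfolding a_def by (rule mult_mono[OF power_mono[OF t_le t_nonneg] q_t _ q_nonneg]) simp
    also have "(3 * s * (3 / 2) ^ Suc n)\<^sup>2 = 9 * s\<^sup>2 * (9 / 4) * (9 / 4) ^ n"
      by (simp add: power_mult_distrib power2_eq_square power_mult_distrib[symmetric])
    also have "\<dots> * (1 / 8 * (1 / 4) ^ n) = (9 * s\<^sup>2 * (9 / 4) * (1 / 8)) * ((9 / 4) ^ n * (1 / 4) ^ n)"
      by simp
    also have "(9 / 4) ^ n * (1 / 4) ^ n = (9 / 16 :: real) ^ n"
      by (simp add: power_mult_distrib[symmetric])
    finally show "norm (a n) \<le> (9 * s\<^sup>2 * (9 / 4) * (1 / 8)) * (9 / 16) ^ n"
      using a_nonneg by simp
  qed
  \<comment> \<open>Outside the ball of radius \<open>s = t 0\<close> the least radius reaching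
    \<open>norm (\<eta> \<omega>)\<close> has a positive index \<open>Suc k\<close>, so
    \<open>\<omega>\<close> lies in the shell with index \<open>k\<close>, and that single term of
    the series suffices.\<close>
  have pointwise: "ennreal ((norm (\<eta> \<omega>))\<^sup>2) \<le> ennreal (s\<^sup>2) + (\<Sum>n. ennreal ((t (Suc n))\<^sup>2) * indicator {\<omega>\<in>space M. t n < norm (\<eta> \<omega>)} \<omega>)"
    if \<omega>: "\<omega> \<in> space M" for \<omega>
  proof (cases "norm (\<eta> \<omega>) \<le> s")
    case True
    then have "ennreal ((norm (\<eta> \<omega>))\<^sup>2) \<le> ennreal (s\<^sup>2)" by (intro ennreal_leI power_mono) auto
    then show ?thesis by (simp add: add_increasing2)
  next
    case False
    have "\<exists>n. norm (\<eta> \<omega>) \<le> t n"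
    proof -
      obtain n where n: "norm (\<eta> \<omega>) + 2 < (3 / 2) ^ n" using real_arch_pow[of "3/2" "norm (\<eta> \<omega>) + 2"] by auto
      have "norm (\<eta> \<omega>) \<le> 3 * (3 / 2) ^ n - 2" using n norm_ge_zero[of "\<eta> \<omega>"] by linarith
      also have "\<dots> = 1 * (3 * (3 / 2) ^ n - 2)" by simp
      also have "\<dots> \<le> t n" unfolding t_def
      proof (rule mult_right_mono[OF s(1)])
        have "2 < (3 / 2 :: real) ^ n" using n norm_ge_zero[of "\<eta> \<omega>"] by linarith
        then show "0 \<le> 3 * (3 / 2 :: real) ^ n - 2" by simp
      qed
      finally show ?thesis by blast
    qed
    define m where "m = (LEAST n. norm (\<eta> \<omega>) \<le> t n)"
    have m: "norm (\<eta> \<omega>) \<le> t m" unfolding m_def by (rule LeastI_ex) fact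
    then obtain k where k: "m = Suc k" using False t0 by (cases m) auto
    then have "\<not> norm (\<eta> \<omega>) \<le> t k" unfolding m_def by (metis lessI not_less_Least)
    then have "ennreal ((norm (\<eta> \<omega>))\<^sup>2) \<le> ennreal ((t (Suc k))\<^sup>2) * indicator {\<omega>\<in>space M. t k < norm (\<eta> \<omega>)} \<omega>"
      using m k \<omega> by (auto intro!: ennreal_leI power_mono)
    also have "\<dots> \<le> (\<Sum>n. ennreal ((t (Suc n))\<^sup>2) * indicator {\<omega>\<in>space M. t n < norm (\<eta> \<omega>)} \<omega>)"
      using sum_le_suminf[OF summableI, of "{k}" "\<lambda>n. ennreal ((t (Suc n))\<^sup>2) * indicator {\<omega>\<in>space M. t n < norm (\<eta> \<omega>)} \<omega>"]
      by (simp only: finite.intros sum.insert sum.empty empty_iff add_0_right zero_le not_False_eq_True)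
    finally show ?thesis by (simp add: add_increasing)
  qed
  have "(\<integral>\<^sup>+\<omega>. ennreal ((norm (\<eta> \<omega>))\<^sup>2) \<partial>M)
      \<le> (\<integral>\<^sup>+\<omega>. ennreal (s\<^sup>2) + (\<Sum>n. ennreal ((t (Suc n))\<^sup>2) * indicator {\<omega>\<in>space M. t n < norm (\<eta> \<omega>)} \<omega>) \<partial>M)"
    by (rule nn_integral_mono) (rule pointwise)
  also have "\<dots> = ennreal (s\<^sup>2) + (\<Sum>n. \<integral>\<^sup>+\<omega>. ennreal ((t (Suc n))\<^sup>2) * indicator {\<omega>\<in>space M. t n < norm (\<eta> \<omega>)} \<omega> \<partial>M)"
    by (subst nn_integral_add) (auto simp: nn_integral_suminf emeasure_space_1)
  also have "\<dots> = ennreal (s\<^sup>2) + (\<Sum>n. ennreal (a n))"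
    by (simp add: nn_integral_cmult_indicator emeasure_eq_measure q_def[symmetric] a_def ennreal_mult'' q_nonneg)
  also have "\<dots> < \<infinity>"
    by (simp add: suminf_ennreal2[OF a_nonneg \<open>summable a\<close>])
  finally have "integrable M (\<lambda>\<omega>. (norm (\<eta> \<omega>))\<^sup>2)"
    by (intro integrableI_bounded) auto
  then show ?thesis by (simp add: sq_integrable_def)
qed

section \<open>The standard Gaussian sequence\<close>

lemma prob_space_gaussian_seq: "prob_space gaussian_seq"
  unfolding gaussian_seq_def by (intro prob_space_PiM prob_space_normal_density) simp

lemma measurable_gaussian_seq_coord[measurable]: "(\<lambda>g. g k) \<in> borel_measurable gaussian_seq"
proof -
  have "(\<lambda>g. g k) \<in> measurable gaussian_seq (density lborel std_normal_density)"
    unfolding gaussian_seq_def by (rule measurable_component_singleton) simp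
  then show ?thesis by (simp cong: measurable_cong_sets)
qed

lemma distr_gaussian_seq_coord: "distr gaussian_seq borel (\<lambda>g. g k) = std_normal_distribution"
proof -
  have "distr gaussian_seq borel (\<lambda>g. g k) = distr gaussian_seq std_normal_distribution (\<lambda>g. g k)"
    by (rule distr_cong) auto
  also have "\<dots> = std_normal_distribution"
    unfolding gaussian_seq_def by (rule distr_PiM_component) (auto intro: prob_space_normal_density)
  finally show ?thesis .
qed

lemma indep_gaussian_seq: "prob_space.indep_vars gaussian_seq (\<lambda>_. borel) (\<lambda>k g. g k) UNIV"
proof -
  interpret prob_space gaussian_seq by (rule prob_space_gaussian_seq)
  have sets: "sets (\<Pi>\<^sub>M k\<in>UNIV. (borel :: real measure)) = sets gaussian_seq"
    unfolding gaussian_seq_def by (rule sets_PiM_cong) auto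
  have "distr gaussian_seq (\<Pi>\<^sub>M k\<in>UNIV. borel) (\<lambda>x. \<lambda>k\<in>UNIV. x k) = gaussian_seq"
    using distr_id2[OF sets] by (simp add: restrict_UNIV)
  also have "\<dots> = (\<Pi>\<^sub>M k\<in>UNIV. distr gaussian_seq borel (\<lambda>g. g k))"
    unfolding distr_gaussian_seq_coord by (rule gaussian_seq_def)
  finally show ?thesis
    by (subst indep_vars_iff_distr_eq_PiM) simp_all
qed

text \<open>The one place where independence of the coordinates enters, through the product formula
  for characteristic functions. Afterwards only variances are compared.\<close>

lemma gaussian_seq_sum:
  fixes c :: "nat \<Rightarrow> real"
  shows "centered_gaussian gaussian_seq (\<lambda>g. \<Sum>k<n. c k * g k)"
    and "(\<integral>g. (\<Sum>k<n. c k * g k)\<^sup>2 \<partial>gaussian_seq) = (\<Sum>k<n. (c k)\<^sup>2)"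
proof -
  interpret prob_space gaussian_seq by (rule prob_space_gaussian_seq)
  have char: "(\<integral>g. iexp (u * (\<Sum>k<n. c k * g k)) \<partial>gaussian_seq)
      = complex_of_real (exp (- (u\<^sup>2 * (\<Sum>k<n. (c k)\<^sup>2) / 2)))" for u
  proof -
    have "indep_vars (\<lambda>_. borel) (\<lambda>k g. c k * g k) UNIV"
      by (rule indep_vars_compose2[OF indep_gaussian_seq]) simp
    then have ind: "indep_vars (\<lambda>_. borel) (\<lambda>k g. c k * g k) {..<n}"
      by (rule indep_vars_subset) simp
    have "(\<integral>g. iexp (u * (\<Sum>k<n. c k * g k)) \<partial>gaussian_seq)
        = char (distr gaussian_seq borel (\<lambda>g. \<Sum>k<n. c k * g k)) u"
      unfolding char_def by (subst integral_distr) auto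
    also have "\<dots> = (\<Prod>k<n. char (distr gaussian_seq borel (\<lambda>g. c k * g k)) u)"
      by (rule char_distr_sum[OF ind])
    also have "\<dots> = (\<Prod>k<n. complex_of_real (exp (- (u\<^sup>2 * (c k)\<^sup>2 / 2))))"
    proof (rule prod.cong[OF refl])
      fix k
      have "char (distr gaussian_seq borel (\<lambda>g. c k * g k)) u = (\<integral>g. iexp ((u * c k) * g k) \<partial>gaussian_seq)"
        unfolding char_def by (subst integral_distr) (auto simp: mult.assoc)
      also have "\<dots> = char (distr gaussian_seq borel (\<lambda>g. g k)) (u * c k)"
        unfolding char_def by (subst integral_distr) auto
      also have "\<dots> = complex_of_real (exp (- (u\<^sup>2 * (c k)\<^sup>2 / 2)))"
        unfolding distr_gaussian_seq_coord char_std_normal_distribution by (simp add: power_mult_distrib)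
      finally show "char (distr gaussian_seq borel (\<lambda>g. c k * g k)) u = complex_of_real (exp (- (u\<^sup>2 * (c k)\<^sup>2 / 2)))" .
    qed
    also have "\<dots> = complex_of_real (exp (\<Sum>k<n. - (u\<^sup>2 * (c k)\<^sup>2 / 2)))"
      by (simp add: exp_sum)
    also have "(\<Sum>k<n. - (u\<^sup>2 * (c k)\<^sup>2 / 2)) = - (u\<^sup>2 * (\<Sum>k<n. (c k)\<^sup>2) / 2)"
      by (simp add: sum_negf sum_distrib_left sum_divide_distrib)
    finally show ?thesis .
  qed
  show "centered_gaussian gaussian_seq (\<lambda>g. \<Sum>k<n. c k * g k)"
    "(\<integral>g. (\<Sum>k<n. c k * g k)\<^sup>2 \<partial>gaussian_seq) = (\<Sum>k<n. (c k)\<^sup>2)"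
    by (rule centered_gaussian_charI[OF _ _ char]; simp add: sum_nonneg)+
qed

section \<open>Vector valued sums over a Gaussian space\<close>

lemma bounded_linear_sum_scaleR:
  assumes "bounded_linear f"
  shows "f (\<Sum>k\<in>I. c k *\<^sub>R x k) = (\<Sum>k\<in>I. c k *\<^sub>R f (x k))"
  by (subst linear_sum[OF bounded_linear.linear[OF assms]])
    (simp add: linear_cmul[OF bounded_linear.linear[OF assms]])

context gaussian_space
begin

lemma semi_inner_on_G: "semi_inner_on G (cov M)"
  using G_subspace G_sq_integrable L2.ip_sym L2.ip_add L2.ip_scaleR L2.ip_nonneg
  by unfold_locales auto

lemma orthonormal_sum_cov:
  assumes Z: "orthonormal_on G (cov M) n Z"
  shows "(\<lambda>\<omega>. \<Sum>k<n. c k * Z k \<omega>) \<in> G"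
    and "cov M (\<lambda>\<omega>. \<Sum>k<n. c k * Z k \<omega>) (\<lambda>\<omega>. \<Sum>k<n. c k * Z k \<omega>) = (\<Sum>k<n. (c k)\<^sup>2)"
    and "Y \<in> G \<Longrightarrow> cov M (\<lambda>\<omega>. \<Sum>k<n. c k * Z k \<omega>) Y = (\<Sum>k<n. c k * cov M (Z k) Y)"
proof -
  interpret G: semi_inner_on G "cov M" by (rule semi_inner_on_G)
  have ZG: "Z k \<in> G" if "k < n" for k using Z that by (simp add: orthonormal_on_def)
  have eq: "(\<lambda>\<omega>. \<Sum>k<n. c k * Z k \<omega>) = (\<Sum>k<n. c k *\<^sub>R Z k)"
    by (simp add: sum_fun_apply scaleR_fun_def)
  show in_G: "(\<lambda>\<omega>. \<Sum>k<n. c k * Z k \<omega>) \<in> G"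
    unfolding eq by (intro G.V_sum G.V_scaleR) (use ZG in auto)
  show cY: "cov M (\<lambda>\<omega>. \<Sum>k<n. c k * Z k \<omega>) Y = (\<Sum>k<n. c k * cov M (Z k) Y)" if "Y \<in> G" for Y
    unfolding eq by (subst G.ip_sum) (use ZG that in \<open>auto intro!: sum.cong simp: G.V_scaleR G.ip_scaleR\<close>)
  have "cov M (Z k) (\<lambda>\<omega>. \<Sum>k<n. c k * Z k \<omega>) = c k" if "k < n" for k
    using G.orthonormal_coeff[OF Z that, of c] G.ip_sym[OF ZG[OF that] in_G] unfolding eq by simp
  then show "cov M (\<lambda>\<omega>. \<Sum>k<n. c k * Z k \<omega>) (\<lambda>\<omega>. \<Sum>k<n. c k * Z k \<omega>) = (\<Sum>k<n. (c k)\<^sup>2)"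
    unfolding cY[OF in_G] by (simp add: power2_eq_square)
qed

text \<open>Orthonormal elements of a Gaussian space behave like independent standard Gaussians:
  applied to either sum, a functional \<open>f\<close> yields a centered Gaussian variable with
  variance \<open>\<Sum>k<n. (f (x k))\<^sup>2\<close>.\<close>

lemma orthonormal_sum_law:
  fixes x :: "nat \<Rightarrow> 'x::{banach, second_countable_topology}"
  assumes Z: "orthonormal_on G (cov M) n Z"
  shows "distr M borel (\<lambda>\<omega>. \<Sum>k<n. Z k \<omega> *\<^sub>R x k) = distr gaussian_seq borel (\<lambda>g. \<Sum>k<n. g k *\<^sub>R x k)"
proof (rule gaussian_law_unique)
  have ZG: "Z k \<in> G" if "k < n" for k using Z that by (simp add: orthonormal_on_def)
  show "prob_space M" by (rule prob_space_axioms)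
  show "prob_space gaussian_seq" by (rule prob_space_gaussian_seq)
  show "(\<lambda>\<omega>. \<Sum>k<n. Z k \<omega> *\<^sub>R x k) \<in> borel_measurable M"
    by (intro borel_measurable_sum borel_measurable_scaleR) (use ZG G_borel in auto)
  show "(\<lambda>g. \<Sum>k<n. g k *\<^sub>R x k) \<in> borel_measurable gaussian_seq" by measurable
  fix f :: "'x \<Rightarrow> real" assume f: "bounded_linear f"
  have fZ: "f (\<Sum>k<n. c k *\<^sub>R x k) = (\<Sum>k<n. f (x k) * c k)" for c
    unfolding bounded_linear_sum_scaleR[OF f] by (simp add: mult.commute)
  show "centered_gaussian M (\<lambda>\<omega>. f (\<Sum>k<n. Z k \<omega> *\<^sub>R x k))"
    unfolding fZ by (rule G_gaussian[OF orthonormal_sum_cov(1)[OF Z]])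
  show "centered_gaussian gaussian_seq (\<lambda>\<omega>. f (\<Sum>k<n. \<omega> k *\<^sub>R x k))"
    unfolding fZ by (rule gaussian_seq_sum)
  show "expectation (\<lambda>\<omega>. (f (\<Sum>k<n. Z k \<omega> *\<^sub>R x k))\<^sup>2) = (\<integral>g. (f (\<Sum>k<n. g k *\<^sub>R x k))\<^sup>2 \<partial>gaussian_seq)"
    unfolding fZ gaussian_seq_sum(2) using orthonormal_sum_cov(2)[OF Z, of "\<lambda>k. f (x k)"]
    by (simp add: cov_self)
qed

text \<open>The bridge to the gamma norm: its Gaussian averages become expectations over the given
  probability space.\<close>

lemma orthonormal_sum_norm:
  fixes x :: "nat \<Rightarrow> 'x::{banach, second_countable_topology}"
  assumes Z: "orthonormal_on G (cov M) n Z"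
  shows "expectation (\<lambda>\<omega>. (norm (\<Sum>k<n. Z k \<omega> *\<^sub>R x k))\<^sup>2)
    = (\<integral>g. (norm (\<Sum>k<n. g k *\<^sub>R x k))\<^sup>2 \<partial>gaussian_seq)"
proof -
  have ZG: "Z k \<in> G" if "k < n" for k using Z that by (simp add: orthonormal_on_def)
  have [measurable]: "(\<lambda>\<omega>. \<Sum>k<n. Z k \<omega> *\<^sub>R x k) \<in> borel_measurable M"
    by (intro borel_measurable_sum borel_measurable_scaleR) (use ZG G_borel in auto)
  have "expectation (\<lambda>\<omega>. (norm (\<Sum>k<n. Z k \<omega> *\<^sub>R x k))\<^sup>2)
      = (\<integral>y. (norm y)\<^sup>2 \<partial>distr M borel (\<lambda>\<omega>. \<Sum>k<n. Z k \<omega> *\<^sub>R x k))"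
    by (subst integral_distr) auto
  also have "\<dots> = (\<integral>g. (norm (\<Sum>k<n. g k *\<^sub>R x k))\<^sup>2 \<partial>gaussian_seq)"
    unfolding orthonormal_sum_law[OF Z] by (subst integral_distr) auto
  finally show ?thesis .
qed

text \<open>The reflection \<open>\<zeta> - 2 * S\<close> of \<open>\<zeta>\<close> in its conditional expectation \<open>S\<close> has the law of \<open>\<zeta>\<close>. By
  convexity it controls both \<open>S\<close> and \<open>\<zeta> - S\<close>, without any independence argument.\<close>

definition cond_sum :: "nat \<Rightarrow> (nat \<Rightarrow> 'w \<Rightarrow> real) \<Rightarrow> ('w \<Rightarrow> 'x::{banach, second_countable_topology}) \<Rightarrow> 'w \<Rightarrow> 'x"
  where "cond_sum n Z \<zeta> \<omega> = (\<Sum>k<n. Z k \<omega> *\<^sub>R expectation (\<lambda>\<omega>. Z k \<omega> *\<^sub>R \<zeta> \<omega>))"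

text \<open>Functionals commute with the Bochner integral. Hence each functional of
  \<open>cond_sum\<close> is the orthogonal projection of that functional of \<open>\<zeta>\<close>
  onto the span of the \<open>Z k\<close>.\<close>

lemma cond_sum_bounded_linear:
  fixes \<zeta> :: "'w \<Rightarrow> 'x::{banach, second_countable_topology}" and f :: "'x \<Rightarrow> real"
  assumes Z: "orthonormal_on G (cov M) n Z" and \<zeta>: "sq_integrable M \<zeta>" and f: "bounded_linear f"
  shows "f (cond_sum n Z \<zeta> \<omega>) = (\<Sum>k<n. cov M (Z k) (\<lambda>\<omega>. f (\<zeta> \<omega>)) * Z k \<omega>)"
proof -
  have ZG: "Z k \<in> G" if "k < n" for k using Z that by (simp add: orthonormal_on_def)
  have "f (expectation (\<lambda>\<omega>. Z k \<omega> *\<^sub>R \<zeta> \<omega>)) = cov M (Z k) (\<lambda>\<omega>. f (\<zeta> \<omega>))" if "k < n" for k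
    using integral_bounded_linear[OF f sq_integrable_times[OF G_sq_integrable[OF ZG[OF that]] \<zeta>]]
    by (simp add: linear_cmul[OF bounded_linear.linear[OF f]] cov_def)
  then show ?thesis unfolding cond_sum_def bounded_linear_sum_scaleR[OF f]
    by (intro sum.cong) (auto simp: mult.commute)
qed

lemma sq_integrable_cond_sum:
  assumes Z: "orthonormal_on G (cov M) n Z"
  shows "sq_integrable M (cond_sum n Z \<zeta>)"
  unfolding cond_sum_def[abs_def]
  by (intro sq_integrable_sum sq_integrable_scaleR_left G_sq_integrable)
    (use Z in \<open>auto simp: orthonormal_on_def\<close>)

lemma cond_sum_in_G:
  fixes \<zeta> :: "'w \<Rightarrow> 'x::{banach, second_countable_topology}" and f :: "'x \<Rightarrow> real"
  assumes "orthonormal_on G (cov M) n Z" "sq_integrable M \<zeta>" "bounded_linear f"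
  shows "(\<lambda>\<omega>. f (cond_sum n Z \<zeta> \<omega>)) \<in> G"
  unfolding cond_sum_bounded_linear[OF assms] by (rule orthonormal_sum_cov(1)[OF assms(1)])

lemma reflection_law:
  fixes \<zeta> :: "'w \<Rightarrow> 'x::{banach, second_countable_topology}"
  assumes Z: "orthonormal_on G (cov M) n Z" and \<zeta>: "sq_integrable M \<zeta>"
    and G: "\<And>f :: 'x \<Rightarrow> real. bounded_linear f \<Longrightarrow> (\<lambda>\<omega>. f (\<zeta> \<omega>)) \<in> G"
  shows "distr M borel (\<lambda>\<omega>. \<zeta> \<omega> - 2 *\<^sub>R cond_sum n Z \<zeta> \<omega>) = distr M borel \<zeta>"
proof (rule gaussian_law_unique)
  interpret G: semi_inner_on G "cov M" by (rule semi_inner_on_G)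
  note sqS = sq_integrable_cond_sum[OF Z, of \<zeta>]
  show "prob_space M" "prob_space M" by (rule prob_space_axioms)+
  show "\<zeta> \<in> borel_measurable M" by (rule sq_integrableD(1)[OF \<zeta>])
  show "(\<lambda>\<omega>. \<zeta> \<omega> - 2 *\<^sub>R cond_sum n Z \<zeta> \<omega>) \<in> borel_measurable M"
    by (rule sq_integrableD(1)[OF sq_integrable_diff[OF \<zeta> sq_integrable_scaleR[OF sqS]]])
  fix f :: "'x \<Rightarrow> real" assume f: "bounded_linear f"
  define Y S where "Y = (\<lambda>\<omega>. f (\<zeta> \<omega>))" and "S = (\<lambda>\<omega>. f (cond_sum n Z \<zeta> \<omega>))"
  have Y: "Y \<in> G" and S: "S \<in> G" unfolding Y_def S_def by (rule G[OF f], rule cond_sum_in_G[OF Z \<zeta> f])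
  have S2: "2 *\<^sub>R S \<in> G" by (rule G.V_scaleR[OF S])
  have eq: "(\<lambda>\<omega>. f (\<zeta> \<omega> - 2 *\<^sub>R cond_sum n Z \<zeta> \<omega>)) = Y - 2 *\<^sub>R S"
    using linear_diff[OF bounded_linear.linear[OF f]] linear_cmul[OF bounded_linear.linear[OF f]]
    by (simp add: Y_def S_def fun_eq_iff scaleR_fun_apply)
  show "centered_gaussian M (\<lambda>\<omega>. f (\<zeta> \<omega>))" by (rule G_gaussian[OF G[OF f]])
  show "centered_gaussian M (\<lambda>\<omega>. f (\<zeta> \<omega> - 2 *\<^sub>R cond_sum n Z \<zeta> \<omega>))"
    unfolding eq by (rule G_gaussian[OF G.V_diff[OF Y S2]])
  have ZG: "Z k \<in> G" if "k < n" for k using Z that by (simp add: orthonormal_on_def)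
  have S_eq: "S = (\<lambda>\<omega>. \<Sum>k<n. cov M (Z k) Y * Z k \<omega>)"
    unfolding S_def Y_def by (rule ext) (rule cond_sum_bounded_linear[OF Z \<zeta> f])
  have "cov M S Y = cov M S S"
    unfolding S_eq orthonormal_sum_cov(2)[OF Z] orthonormal_sum_cov(3)[OF Z Y] by (simp add: power2_eq_square)
  then have "cov M (Y - 2 *\<^sub>R S) (Y - 2 *\<^sub>R S) = cov M Y Y"
    using G.ip_sym[OF Y S]
    by (simp add: G.ip_diff_self[OF Y S2] G.ip_scaleR_right[OF S Y] G.ip_scaleR[OF S S2] G.ip_scaleR_right[OF S S])
  then show "expectation (\<lambda>\<omega>. (f (\<zeta> \<omega> - 2 *\<^sub>R cond_sum n Z \<zeta> \<omega>))\<^sup>2) = expectation (\<lambda>\<omega>. (f (\<zeta> \<omega>))\<^sup>2)"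
    unfolding fun_cong[OF eq] Y_def[symmetric] by (simp add: cov_self Y_def)
qed

text \<open>Stated for a general \<open>d\<close> because it is used twice, with the squared norm
  and with the squared distance to a compact convex set.\<close>

lemma reflection_expectation:
  fixes \<zeta> :: "'w \<Rightarrow> 'x::{banach, second_countable_topology}" and d :: "'x \<Rightarrow> real"
  assumes Z: "orthonormal_on G (cov M) n Z" and \<zeta>: "sq_integrable M \<zeta>"
    and G: "\<And>f :: 'x \<Rightarrow> real. bounded_linear f \<Longrightarrow> (\<lambda>\<omega>. f (\<zeta> \<omega>)) \<in> G"
    and d: "d \<in> borel_measurable borel"
  shows "expectation (\<lambda>\<omega>. d (\<zeta> \<omega> - 2 *\<^sub>R cond_sum n Z \<zeta> \<omega>)) = expectation (\<lambda>\<omega>. d (\<zeta> \<omega>))"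
    and "integrable M (\<lambda>\<omega>. d (\<zeta> \<omega>)) \<Longrightarrow> integrable M (\<lambda>\<omega>. d (\<zeta> \<omega> - 2 *\<^sub>R cond_sum n Z \<zeta> \<omega>))"
proof -
  have m: "\<zeta> \<in> borel_measurable M" "(\<lambda>\<omega>. \<zeta> \<omega> - 2 *\<^sub>R cond_sum n Z \<zeta> \<omega>) \<in> borel_measurable M"
    using sq_integrableD(1)[OF \<zeta>] sq_integrableD(1)[OF sq_integrable_cond_sum[OF Z, of \<zeta>]] by simp_all
  have law: "distr M borel (\<lambda>\<omega>. \<zeta> \<omega> - 2 *\<^sub>R cond_sum n Z \<zeta> \<omega>) = distr M borel \<zeta>"
    by (rule reflection_law[OF Z \<zeta>]) (rule G)
  show "expectation (\<lambda>\<omega>. d (\<zeta> \<omega> - 2 *\<^sub>R cond_sum n Z \<zeta> \<omega>)) = expectation (\<lambda>\<omega>. d (\<zeta> \<omega>))"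
    using integral_distr[OF m(1) d] integral_distr[OF m(2) d] law by simp
  show "integrable M (\<lambda>\<omega>. d (\<zeta> \<omega> - 2 *\<^sub>R cond_sum n Z \<zeta> \<omega>))" if "integrable M (\<lambda>\<omega>. d (\<zeta> \<omega>))"
    using integrable_distr_eq[OF m(1) d] integrable_distr_eq[OF m(2) d] law that by simp
qed

lemma cond_sum_norm_le:
  fixes \<zeta> :: "'w \<Rightarrow> 'x::{banach, second_countable_topology}"
  assumes Z: "orthonormal_on G (cov M) n Z" and \<zeta>: "sq_integrable M \<zeta>"
    and G: "\<And>f :: 'x \<Rightarrow> real. bounded_linear f \<Longrightarrow> (\<lambda>\<omega>. f (\<zeta> \<omega>)) \<in> G"
  shows "expectation (\<lambda>\<omega>. (norm (cond_sum n Z \<zeta> \<omega>))\<^sup>2) \<le> expectation (\<lambda>\<omega>. (norm (\<zeta> \<omega>))\<^sup>2)"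
proof -
  define R where "R \<omega> = \<zeta> \<omega> - 2 *\<^sub>R cond_sum n Z \<zeta> \<omega>" for \<omega>
  note sqS = sq_integrable_cond_sum[OF Z, of \<zeta>]
  have sqR: "sq_integrable M R" unfolding R_def[abs_def]
    by (intro sq_integrable_diff sq_integrable_scaleR \<zeta> sqS)
  have ER: "expectation (\<lambda>\<omega>. (norm (R \<omega>))\<^sup>2) = expectation (\<lambda>\<omega>. (norm (\<zeta> \<omega>))\<^sup>2)"
    unfolding R_def by (rule reflection_expectation(1)[OF Z \<zeta>]) (use G in auto)
  have le: "(norm (cond_sum n Z \<zeta> \<omega>))\<^sup>2 \<le> (1 / 2) * (norm (\<zeta> \<omega>))\<^sup>2 + (1 / 2) * (norm (R \<omega>))\<^sup>2" for \<omega>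
  proof -
    have "cond_sum n Z \<zeta> \<omega> = (1 / 2) *\<^sub>R (\<zeta> \<omega> + - R \<omega>)" by (simp add: R_def)
    then have "(norm (cond_sum n Z \<zeta> \<omega>))\<^sup>2 = (1 / 4) * (norm (\<zeta> \<omega> + - R \<omega>))\<^sup>2"
      by (simp add: power_divide)
    then show ?thesis using norm_add_sq_le[of "\<zeta> \<omega>" "- R \<omega>"] by simp
  qed
  have "expectation (\<lambda>\<omega>. (norm (cond_sum n Z \<zeta> \<omega>))\<^sup>2)
      \<le> expectation (\<lambda>\<omega>. (1 / 2) * (norm (\<zeta> \<omega>))\<^sup>2 + (1 / 2) * (norm (R \<omega>))\<^sup>2)"
    by (rule integral_mono) (use sq_integrableD(2)[OF sqS] sq_integrableD(2)[OF \<zeta>] sq_integrableD(2)[OF sqR] le in auto)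
  also have "\<dots> = expectation (\<lambda>\<omega>. (norm (\<zeta> \<omega>))\<^sup>2)"
    using sq_integrableD(2)[OF \<zeta>] sq_integrableD(2)[OF sqR] by (simp add: ER)
  finally show ?thesis .
qed

text \<open>\<open>J\<close> carries an orthonormal system to one in \<open>G\<close>, and the
  Gaussian sum of the values \<open>A (h k)\<close> then has the law of \<open>cond_sum\<close>. Its
  second moment is bounded by that of \<open>\<zeta>\<close>, uniformly in the system.\<close>

lemma gamma_norm_covariance_le:
  fixes \<zeta> :: "'w \<Rightarrow> 'x::{banach, second_countable_topology}"
  assumes \<zeta>: "sq_integrable M \<zeta>" and G: "\<And>f :: 'x \<Rightarrow> real. bounded_linear f \<Longrightarrow> (\<lambda>\<omega>. f (\<zeta> \<omega>)) \<in> G"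
    and J: "\<And>h. h \<in> V \<Longrightarrow> J h \<in> G" "\<And>h h'. h \<in> V \<Longrightarrow> h' \<in> V \<Longrightarrow> cov M (J h) (J h') = ip h h'"
    and A: "\<And>h. h \<in> V \<Longrightarrow> A h = expectation (\<lambda>\<omega>. J h \<omega> *\<^sub>R \<zeta> \<omega>)"
  shows "gamma_norm V ip A \<le> ennreal (sqrt (expectation (\<lambda>\<omega>. (norm (\<zeta> \<omega>))\<^sup>2)))"
  unfolding gamma_norm_def
proof (rule SUP_least)
  fix p assume "p \<in> {(n, h). orthonormal_on V ip n h}"
  then obtain n h where p: "p = (n, h)" and h: "orthonormal_on V ip n h" by blast
  define Z where "Z k = J (h k)" for k
  have Z: "orthonormal_on G (cov M) n Z"
    using h J by (simp add: orthonormal_on_def Z_def)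
  have "(\<Sum>k<n. g k *\<^sub>R A (h k)) = (\<Sum>k<n. g k *\<^sub>R expectation (\<lambda>\<omega>. Z k \<omega> *\<^sub>R \<zeta> \<omega>))" for g :: "nat \<Rightarrow> real"
    using h A by (intro sum.cong) (auto simp: orthonormal_on_def Z_def)
  then have "(\<integral>g. (norm (\<Sum>k<n. g k *\<^sub>R A (h k)))\<^sup>2 \<partial>gaussian_seq)
      = (\<integral>g. (norm (\<Sum>k<n. g k *\<^sub>R expectation (\<lambda>\<omega>. Z k \<omega> *\<^sub>R \<zeta> \<omega>)))\<^sup>2 \<partial>gaussian_seq)" by simp
  also have "\<dots> = expectation (\<lambda>\<omega>. (norm (cond_sum n Z \<zeta> \<omega>))\<^sup>2)"
    unfolding cond_sum_def by (rule orthonormal_sum_norm[OF Z, symmetric])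
  also have "\<dots> \<le> expectation (\<lambda>\<omega>. (norm (\<zeta> \<omega>))\<^sup>2)"
    by (rule cond_sum_norm_le[OF Z \<zeta>]) (rule G)
  finally show "(case p of (n, h) \<Rightarrow> ennreal (sqrt (\<integral>g. (norm (\<Sum>k<n. g k *\<^sub>R A (h k)))\<^sup>2 \<partial>gaussian_seq)))
      \<le> ennreal (sqrt (expectation (\<lambda>\<omega>. (norm (\<zeta> \<omega>))\<^sup>2)))"
    unfolding p by (auto intro!: ennreal_leI real_sqrt_le_mono)
qed

end

text \<open>The midpoint of nearly closest points of \<open>a\<close> and \<open>b\<close> stays in
  the convex set. Nearly, because the infimum need not be attained; the error \<open>e\<close> is
  arbitrary.\<close>

lemma infdist_midpoint_le:
  fixes D :: "'x::real_normed_vector set"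
  assumes D: "convex D" "D \<noteq> {}"
  shows "infdist ((1 / 2) *\<^sub>R (a + b)) D \<le> (infdist a D + infdist b D) / 2"
proof (rule field_le_epsilon)
  fix e :: real assume e: "0 < e"
  have near: "\<exists>d\<in>D. dist a d < infdist a D + e" for a
  proof -
    have "(INF d\<in>D. dist a d) < infdist a D + e" using D(2) e by (simp add: infdist_notempty)
    then show ?thesis using cINF_less_iff[of D "dist a"] D(2) bdd_belowI2[of D 0 "dist a"] by simp
  qed
  obtain c d where c: "c \<in> D" "dist a c < infdist a D + e" and d: "d \<in> D" "dist b d < infdist b D + e"
    using near by metis
  have m: "(1 / 2) *\<^sub>R c + (1 / 2) *\<^sub>R d \<in> D" using convexD[OF D(1) c(1) d(1), of "1/2" "1/2"] by simp
  have "dist ((1 / 2) *\<^sub>R (a + b)) ((1 / 2) *\<^sub>R c + (1 / 2) *\<^sub>R d) = norm ((1 / 2) *\<^sub>R ((a - c) + (b - d)))"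
    by (simp add: dist_norm algebra_simps)
  also have "\<dots> \<le> (1 / 2) * (norm (a - c) + norm (b - d))"
    using norm_triangle_ineq[of "a - c" "b - d"] by simp
  also have "\<dots> \<le> (infdist a D + infdist b D) / 2 + e"
    using c(2) d(2) by (simp add: dist_norm field_simps)
  finally show "infdist ((1 / 2) *\<^sub>R (a + b)) D \<le> (infdist a D + infdist b D) / 2 + e"
    by (rule infdist_le2[OF m])
qed

text \<open>Simple functions with norm at most twice that of \<open>\<eta>\<close> converge
  pointwise. The squared errors are at most \<open>9 * (norm (\<eta> \<omega>))\<^sup>2\<close>, so
  dominated convergence applies.\<close>

lemma simple_function_L2_approx:
  fixes \<eta> :: "'w \<Rightarrow> 'x::{banach, second_countable_topology}"
  assumes \<eta>: "sq_integrable M \<eta>" and e: "0 < e"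
  shows "\<exists>Y. simple_function M Y \<and> integrable M (\<lambda>\<omega>. (norm (\<eta> \<omega> - Y \<omega>))\<^sup>2) \<and> (\<integral>\<omega>. (norm (\<eta> \<omega> - Y \<omega>))\<^sup>2 \<partial>M) < e"
proof -
  note [measurable] = sq_integrableD(1)[OF \<eta>]
  obtain F where F: "\<And>i. simple_function M (F i)" "\<And>x. x \<in> space M \<Longrightarrow> (\<lambda>i. F i x) \<longlonglongrightarrow> \<eta> x"
      "\<And>i x. x \<in> space M \<Longrightarrow> norm (F i x) \<le> 2 * norm (\<eta> x)"
    using borel_measurable_implies_sequence_metric[OF sq_integrableD(1)[OF \<eta>], of 0]
    unfolding dist_norm diff_0_right by metis
  have [measurable]: "F i \<in> borel_measurable M" for i by (rule borel_measurable_simple_function[OF F(1)])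
  have bound: "(norm (\<eta> x - F i x))\<^sup>2 \<le> 9 * (norm (\<eta> x))\<^sup>2" if "x \<in> space M" for x i
  proof -
    have "norm (\<eta> x - F i x) \<le> 3 * norm (\<eta> x)"
      using norm_triangle_ineq4[of "\<eta> x" "F i x"] F(3)[OF that, of i] by simp
    then have "(norm (\<eta> x - F i x))\<^sup>2 \<le> (3 * norm (\<eta> x))\<^sup>2" by (rule power_mono) simp
    then show ?thesis by (simp add: power_mult_distrib)
  qed
  have int: "integrable M (\<lambda>\<omega>. 9 * (norm (\<eta> \<omega>))\<^sup>2)" using sq_integrableD(2)[OF \<eta>] by simp
  have "(\<lambda>i. \<integral>\<omega>. (norm (\<eta> \<omega> - F i \<omega>))\<^sup>2 \<partial>M) \<longlonglongrightarrow> (\<integral>\<omega>. 0 \<partial>M)"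
  proof (rule integral_dominated_convergence[OF _ _ int])
    show "AE x in M. (\<lambda>i. (norm (\<eta> x - F i x))\<^sup>2) \<longlonglongrightarrow> 0"
    proof (rule AE_I2)
      fix x assume "x \<in> space M"
      have "(\<lambda>i. (norm (\<eta> x - F i x))\<^sup>2) \<longlonglongrightarrow> (norm (\<eta> x - \<eta> x))\<^sup>2"
        by (intro tendsto_intros F(2)) fact
      then show "(\<lambda>i. (norm (\<eta> x - F i x))\<^sup>2) \<longlonglongrightarrow> 0" by simp
    qed
    show "AE x in M. norm ((norm (\<eta> x - F i x))\<^sup>2) \<le> 9 * (norm (\<eta> x))\<^sup>2" for i
      using bound by (auto intro!: AE_I2)
  qed measurable
  then have "\<forall>\<^sub>F i in sequentially. (\<integral>\<omega>. (norm (\<eta> \<omega> - F i \<omega>))\<^sup>2 \<partial>M) < e"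
    using e by (intro order_tendstoD(2)) auto
  then obtain i where i: "(\<integral>\<omega>. (norm (\<eta> \<omega> - F i \<omega>))\<^sup>2 \<partial>M) < e" by (auto simp: eventually_sequentially)
  moreover have "integrable M (\<lambda>\<omega>. (norm (\<eta> \<omega> - F i \<omega>))\<^sup>2)"
    by (rule Bochner_Integration.integrable_bound[OF int]) (use bound in \<open>auto intro!: AE_I2\<close>)
  ultimately show ?thesis using F(1) by blast
qed

section \<open>From the random element to the embedding\<close>

context gaussian_space
begin

text \<open>Up to a small error \<open>\<eta>\<close> takes values in a compact convex set \<open>D\<close>. Once the functionals norming
  a finite net of \<open>D\<close> vanish on the residual \<open>R\<close>, its norm is controlled by its distance to \<open>D\<close>.\<close>

lemma cond_sum_approx:
  fixes \<eta> :: "'w \<Rightarrow> 'x::{banach, second_countable_topology}"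
  assumes \<eta>: "sq_integrable M \<eta>" and G: "\<And>f :: 'x \<Rightarrow> real. bounded_linear f \<Longrightarrow> (\<lambda>\<omega>. f (\<eta> \<omega>)) \<in> G"
    and e: "0 < e"
  shows "\<exists>n Z. orthonormal_on G (cov M) n Z \<and> expectation (\<lambda>\<omega>. (norm (\<eta> \<omega> - cond_sum n Z \<eta> \<omega>))\<^sup>2) < e"
proof -
  interpret G: semi_inner_on G "cov M" by (rule semi_inner_on_G)
  obtain Y where Y: "simple_function M Y" "integrable M (\<lambda>\<omega>. (norm (\<eta> \<omega> - Y \<omega>))\<^sup>2)"
      "expectation (\<lambda>\<omega>. (norm (\<eta> \<omega> - Y \<omega>))\<^sup>2) < e / 16"
    using simple_function_L2_approx[OF \<eta>, of "e / 16"] e by auto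
  \<comment> \<open>The finite range alone would not do: the midpoint estimate needs convexity. The
    hull of a finite set is still compact, hence has a finite net.\<close>
  define D where "D = convex hull (Y ` space M)"
  have "finite (Y ` space M)" using Y(1) by (simp add: simple_function_def)
  then have D: "compact D" "convex D"
    unfolding D_def by (simp_all add: finite_imp_compact_convex_hull)
  have YD: "Y \<omega> \<in> D" if "\<omega> \<in> space M" for \<omega>
    unfolding D_def using that by (intro hull_inc) auto
  then have Dne: "D \<noteq> {}" using not_empty by auto
  \<comment> \<open>The two distance terms contribute less than \<open>8 * (e / 16)\<close> and the
    net contributes \<open>32 * \<epsilon>\<^sup>2 = e / 4\<close>; the total stays below
    \<open>3 * e / 4\<close>.\<close>
  define \<epsilon> where "\<epsilon> = sqrt (e / 128)"
  have \<epsilon>: "0 < \<epsilon>" "\<epsilon>\<^sup>2 = e / 128" using e by (simp_all add: \<epsilon>_def)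
  obtain N where N: "finite N" "D \<subseteq> (\<Union>x\<in>N. ball x \<epsilon>)"
    using D(1) \<epsilon>(1) unfolding compact_eq_totally_bounded by blast
  have "\<forall>d :: 'x. \<exists>f. bounded_linear f \<and> f d = norm d \<and> (\<forall>y. \<bar>f y\<bar> \<le> norm y)"
    using norming_functional by metis
  then obtain F where F: "\<And>d :: 'x. bounded_linear (F d)" "\<And>d. F d d = norm d" "\<And>d y. \<bar>F d y\<bar> \<le> norm y"
    by metis
  define p where "p d = (\<lambda>\<omega>. F d (\<eta> \<omega>))" for d
  have pG: "p d \<in> G" for d unfolding p_def by (rule G[OF F(1)])
  \<comment> \<open>The orthonormal system comes from the finitely many variables
    \<open>p d\<close>, so each of them agrees almost surely with its projection. Since
    \<open>F d (S \<omega>)\<close> is this projection, \<open>F d\<close> vanishes on the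
    residual.\<close>
  obtain n Z where Z: "orthonormal_on G (cov M) n Z"
    and res: "\<And>d. d \<in> N \<Longrightarrow> cov M (p d - (\<Sum>k<n. cov M (p d) (Z k) *\<^sub>R Z k)) (p d - (\<Sum>k<n. cov M (p d) (Z k) *\<^sub>R Z k)) = 0"
  proof -
    have "p ` N \<subseteq> G" using pG by blast
    from G.gram_schmidt[OF finite_imageI[OF N(1)] this] show ?thesis using that by auto
  qed
  define S R R' where "S = cond_sum n Z \<eta>" and "R \<omega> = \<eta> \<omega> - S \<omega>" and "R' \<omega> = \<eta> \<omega> - 2 *\<^sub>R S \<omega>" for \<omega>
  have sqS: "sq_integrable M S" unfolding S_def by (rule sq_integrable_cond_sum[OF Z])
  have sqR: "sq_integrable M R" unfolding R_def[abs_def] by (rule sq_integrable_diff[OF \<eta> sqS])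
  have sqR': "sq_integrable M R'" unfolding R'_def[abs_def] by (rule sq_integrable_diff[OF \<eta> sq_integrable_scaleR[OF sqS]])
  note [measurable] = sq_integrableD(1)[OF \<eta>] sq_integrableD(1)[OF sqR] sq_integrableD(1)[OF sqR']
  have vanish: "AE \<omega> in M. F d (R \<omega>) = 0" if d: "d \<in> N" for d
  proof -
    have ZG: "Z k \<in> G" if "k < n" for k using Z that by (simp add: orthonormal_on_def)
    have "F d (R \<omega>) = (p d - (\<Sum>k<n. cov M (p d) (Z k) *\<^sub>R Z k)) \<omega>" for \<omega>
    proof -
      have "F d (R \<omega>) = F d (\<eta> \<omega>) - F d (S \<omega>)"
        unfolding R_def by (rule linear_diff[OF bounded_linear.linear[OF F(1)]])
      also have "F d (S \<omega>) = (\<Sum>k<n. cov M (p d) (Z k) * Z k \<omega>)"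
        unfolding S_def cond_sum_bounded_linear[OF Z \<eta> F(1)] p_def[symmetric]
        using G.ip_sym[OF pG ZG] by (intro sum.cong) auto
      finally show ?thesis by (simp add: p_def sum_fun_apply scaleR_fun_def)
    qed
    then have eq: "(\<lambda>\<omega>. F d (R \<omega>)) = p d - (\<Sum>k<n. cov M (p d) (Z k) *\<^sub>R Z k)" by (rule ext)
    have "sq_integrable M (\<lambda>\<omega>. F d (R \<omega>))" by (rule sq_integrable_bounded_linear[OF sqR F(1)])
    moreover have "expectation (\<lambda>\<omega>. (norm (F d (R \<omega>)))\<^sup>2) = 0"
      using res[OF d] unfolding eq[symmetric] by (simp add: cov_self)
    ultimately show ?thesis by (rule expectation_sq_eq_0)
  qed
  \<comment> \<open>If \<open>F d\<close> norms \<open>d\<close> and kills \<open>r\<close>, then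
    \<open>norm d\<close> is at most \<open>norm (d - r)\<close>, and so \<open>norm r\<close> is at
    most twice \<open>norm (d - r)\<close>. A net point near an almost closest point of
    \<open>D\<close> makes \<open>norm (d - r)\<close> comparable to the distance from
    \<open>r\<close> to \<open>D\<close>.\<close>
  have small: "norm r \<le> 2 * infdist r D + 4 * \<epsilon>" if r: "\<And>d. d \<in> N \<Longrightarrow> F d r = 0" for r
  proof -
    have "(INF d\<in>D. dist r d) < infdist r D + \<epsilon>" using Dne \<epsilon>(1) by (simp add: infdist_notempty)
    then obtain c where c: "c \<in> D" "dist r c < infdist r D + \<epsilon>"
      using cINF_less_iff[of D "dist r"] Dne bdd_belowI2[of D 0 "dist r"] by auto
    then obtain d where d: "d \<in> N" "dist d c < \<epsilon>" using N(2) by (auto simp: ball_def)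
    have rd: "norm (d - r) \<le> infdist r D + 2 * \<epsilon>"
      using dist_triangle[of d r c] c(2) d(2) by (simp add: dist_norm norm_minus_commute)
    have "norm d = F d (d - r)" using F(2)[of d] r[OF d(1)] linear_diff[OF bounded_linear.linear[OF F(1)[of d]]] by simp
    also have "\<dots> \<le> norm (d - r)" using F(3)[of d "d - r"] by simp
    finally have "norm r \<le> 2 * norm (d - r)" using norm_triangle_ineq4[of d "d - r"] by simp
    then show ?thesis using rd by simp
  qed
  have mid: "infdist (R \<omega>) D \<le> (infdist (\<eta> \<omega>) D + infdist (R' \<omega>) D) / 2" for \<omega>
  proof -
    have "R \<omega> = (1 / 2) *\<^sub>R (\<eta> \<omega> + R' \<omega>)" by (simp add: R_def R'_def scaleR_diff_right scaleR_2[symmetric] algebra_simps)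
    then show ?thesis using infdist_midpoint_le[OF D(2) Dne] by metis
  qed
  have "AE \<omega> in M. \<forall>d\<in>N. F d (R \<omega>) = 0" by (rule AE_finite_allI[OF N(1) vanish])
  then have ae: "AE \<omega> in M. (norm (R \<omega>))\<^sup>2 \<le> 4 * (infdist (\<eta> \<omega>) D)\<^sup>2 + 4 * (infdist (R' \<omega>) D)\<^sup>2 + 32 * \<epsilon>\<^sup>2"
  proof eventually_elim
    fix \<omega> assume "\<forall>d\<in>N. F d (R \<omega>) = 0"
    then have "norm (R \<omega>) \<le> 2 * infdist (R \<omega>) D + 4 * \<epsilon>" using small[of "R \<omega>"] by simp
    then have "norm (R \<omega>) \<le> (infdist (\<eta> \<omega>) D + infdist (R' \<omega>) D) + 4 * \<epsilon>" using mid[of \<omega>] by simp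
    then have "(norm (R \<omega>))\<^sup>2 \<le> ((infdist (\<eta> \<omega>) D + infdist (R' \<omega>) D) + 4 * \<epsilon>)\<^sup>2" by (rule power_mono) simp
    also have "\<dots> \<le> 4 * (infdist (\<eta> \<omega>) D)\<^sup>2 + 4 * (infdist (R' \<omega>) D)\<^sup>2 + 32 * \<epsilon>\<^sup>2"
    proof -
      have "((a + b) + 4 * c)\<^sup>2 \<le> 4 * a\<^sup>2 + 4 * b\<^sup>2 + 32 * c\<^sup>2" for a b c :: real
      proof -
        have "4 * a\<^sup>2 + 4 * b\<^sup>2 + 32 * c\<^sup>2 - ((a + b) + 4 * c)\<^sup>2 = 2 * (a - b)\<^sup>2 + (a + b - 4 * c)\<^sup>2"
          by (simp add: power2_eq_square algebra_simps)
        then show ?thesis by (smt (verit) zero_le_power2)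
      qed
      then show ?thesis .
    qed
    finally show "(norm (R \<omega>))\<^sup>2 \<le> 4 * (infdist (\<eta> \<omega>) D)\<^sup>2 + 4 * (infdist (R' \<omega>) D)\<^sup>2 + 32 * \<epsilon>\<^sup>2" .
  qed
  have [measurable]: "(\<lambda>x :: 'x. (infdist x D)\<^sup>2) \<in> borel_measurable borel"
    by (intro borel_measurable_continuous_onI continuous_intros)
  have le: "(infdist (\<eta> \<omega>) D)\<^sup>2 \<le> (norm (\<eta> \<omega> - Y \<omega>))\<^sup>2" if "\<omega> \<in> space M" for \<omega>
    using infdist_le[OF YD[OF that], of "\<eta> \<omega>"] by (intro power_mono) (auto simp: dist_norm infdist_nonneg)
  have i1: "integrable M (\<lambda>\<omega>. (infdist (\<eta> \<omega>) D)\<^sup>2)"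
    by (rule Bochner_Integration.integrable_bound[OF Y(2)]) (use le in \<open>auto intro!: AE_I2\<close>)
  have e1: "expectation (\<lambda>\<omega>. (infdist (\<eta> \<omega>) D)\<^sup>2) < e / 16"
    using integral_mono[OF i1 Y(2)] le Y(3) by fastforce
  have i2: "integrable M (\<lambda>\<omega>. (infdist (R' \<omega>) D)\<^sup>2)"
    and e2: "expectation (\<lambda>\<omega>. (infdist (R' \<omega>) D)\<^sup>2) = expectation (\<lambda>\<omega>. (infdist (\<eta> \<omega>) D)\<^sup>2)"
    unfolding R'_def S_def
    using reflection_expectation[OF Z \<eta> _ \<open>(\<lambda>x. (infdist x D)\<^sup>2) \<in> borel_measurable borel\<close>] G i1 by blast+
  have "expectation (\<lambda>\<omega>. (norm (R \<omega>))\<^sup>2)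
      \<le> expectation (\<lambda>\<omega>. 4 * (infdist (\<eta> \<omega>) D)\<^sup>2 + 4 * (infdist (R' \<omega>) D)\<^sup>2 + 32 * \<epsilon>\<^sup>2)"
    by (rule integral_mono_AE[OF sq_integrableD(2)[OF sqR] _ ae]) (use i1 i2 in simp)
  also have "\<dots> = 8 * expectation (\<lambda>\<omega>. (infdist (\<eta> \<omega>) D)\<^sup>2) + e / 4"
    using i1 i2 by (simp add: e2 \<epsilon>(2) prob_space)
  also have "\<dots> < e" using e1 e by simp
  finally show ?thesis using Z unfolding R_def S_def by blast
qed

text \<open>\<open>J\<close> is linear only up to null variables, and these do not contribute to the
  expectation. The operator norm is bounded by the root of the second moment of
  \<open>\<zeta>\<close>, by Cauchy-Schwarz.\<close>

lemma covariance_operator_bounded: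
  fixes \<zeta> :: "'w \<Rightarrow> 'x::{banach, second_countable_topology}"
  assumes \<zeta>: "sq_integrable M \<zeta>" and V: "semi_inner_on V ip"
    and J: "\<And>h. h \<in> V \<Longrightarrow> J h \<in> G" "\<And>h h'. h \<in> V \<Longrightarrow> h' \<in> V \<Longrightarrow> cov M (J h) (J h') = ip h h'"
  shows "bounded_operator_on V ip (\<lambda>h. expectation (\<lambda>\<omega>. J h \<omega> *\<^sub>R \<zeta> \<omega>))"
proof -
  interpret V: semi_inner_on V ip by fact
  interpret G: semi_inner_on G "cov M" by (rule semi_inner_on_G)
  let ?A = "\<lambda>Y. expectation (\<lambda>\<omega>. Y \<omega> *\<^sub>R \<zeta> \<omega>)"
  have i: "integrable M (\<lambda>\<omega>. Y \<omega> *\<^sub>R \<zeta> \<omega>)" if "Y \<in> G" for Y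
    by (rule sq_integrable_times[OF G_sq_integrable[OF that] \<zeta>])
  have null: "?A X = ?A Y" if X: "X \<in> G" and Y: "Y \<in> G" and XY: "cov M (X - Y) (X - Y) = 0" for X Y
  proof -
    have "AE \<omega> in M. (X - Y) \<omega> = 0"
      using expectation_sq_eq_0[OF G_sq_integrable[OF G.V_diff[OF X Y]]] XY by (simp add: cov_self)
    then have "AE \<omega> in M. X \<omega> *\<^sub>R \<zeta> \<omega> = Y \<omega> *\<^sub>R \<zeta> \<omega>" by eventually_elim simp
    then show ?thesis
      using i[OF X] i[OF Y] by (intro integral_cong_AE) auto
  qed
  have add: "?A (J (x + y)) = ?A (J x) + ?A (J y)" if x: "x \<in> V" and y: "y \<in> V" for x y
  proof -
    have xy: "x + y \<in> V" by (rule V.V_add[OF x y])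
    have "cov M (J (x + y) - (J x + J y)) (J (x + y) - (J x + J y)) = 0"
      using J x y xy
      by (simp add: G.ip_diff_self G.V_add G.ip_add_right G.ip_add V.ip_add V.ip_add_right V.ip_sym[of y x] algebra_simps)
    then have "?A (J (x + y)) = ?A (J x + J y)" by (intro null G.V_add J x y xy)
    also have "\<dots> = ?A (J x) + ?A (J y)"
      using i[OF J(1)[OF x]] i[OF J(1)[OF y]] by (simp add: scaleR_add_left)
    finally show ?thesis .
  qed
  have scale: "?A (J (c *\<^sub>R x)) = c *\<^sub>R ?A (J x)" if x: "x \<in> V" for c x
  proof -
    have cx: "c *\<^sub>R x \<in> V" by (rule V.V_scaleR[OF x])
    have "cov M (J (c *\<^sub>R x) - c *\<^sub>R J x) (J (c *\<^sub>R x) - c *\<^sub>R J x) = 0"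
      using J x cx by (simp add: G.ip_diff_self G.V_scaleR G.ip_scaleR G.ip_scaleR_right V.ip_scaleR V.ip_scaleR_right)
    then have "?A (J (c *\<^sub>R x)) = ?A (c *\<^sub>R J x)" by (intro null G.V_scaleR J x cx)
    also have "\<dots> = c *\<^sub>R ?A (J x)"
      by (simp add: scaleR_fun_apply scaleR_scaleR[symmetric] del: scaleR_scaleR)
    finally show ?thesis .
  qed
  define C where "C = sqrt (expectation (\<lambda>\<omega>. (norm (\<zeta> \<omega>))\<^sup>2))"
  have "norm (?A (J x)) \<le> C * sqrt (ip x x)" if x: "x \<in> V" for x
  proof -
    note sqJ = G_sq_integrable[OF J(1)[OF x]]
    have a: "sq_integrable M (\<lambda>\<omega>. \<bar>J x \<omega>\<bar>)" "sq_integrable M (\<lambda>\<omega>. norm (\<zeta> \<omega>))"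
      using sqJ \<zeta> by (auto simp: sq_integrable_def)
    have "norm (?A (J x)) \<le> expectation (\<lambda>\<omega>. norm (J x \<omega> *\<^sub>R \<zeta> \<omega>))" by (rule integral_norm_bound)
    also have "\<dots> = cov M (\<lambda>\<omega>. \<bar>J x \<omega>\<bar>) (\<lambda>\<omega>. norm (\<zeta> \<omega>))" by (simp add: cov_def)
    also have "\<dots> \<le> sqrt (cov M (\<lambda>\<omega>. \<bar>J x \<omega>\<bar>) (\<lambda>\<omega>. \<bar>J x \<omega>\<bar>)) * sqrt (cov M (\<lambda>\<omega>. norm (\<zeta> \<omega>)) (\<lambda>\<omega>. norm (\<zeta> \<omega>)))"
      using L2.ip_Cauchy_Schwarz_sqrt[of "\<lambda>\<omega>. \<bar>J x \<omega>\<bar>" "\<lambda>\<omega>. norm (\<zeta> \<omega>)"] a by simp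
    also have "cov M (\<lambda>\<omega>. \<bar>J x \<omega>\<bar>) (\<lambda>\<omega>. \<bar>J x \<omega>\<bar>) = ip x x"
      using J(2)[OF x x] by (simp add: cov_self)
    finally show ?thesis by (simp add: C_def cov_self mult.commute)
  qed
  then show ?thesis using add scale unfolding bounded_operator_on_def by blast
qed

text \<open>The difference \<open>A - B\<close> is itself a covariance operator, that of the
  residual \<open>\<eta> - S\<close>, so the bound on gamma norms turns the approximation of
  \<open>\<eta>\<close> into an approximation of \<open>A\<close>.\<close>

lemma gamma_radonifying_covariance:
  fixes \<eta> :: "'w \<Rightarrow> 'x::{banach, second_countable_topology}"
  assumes \<eta>: "sq_integrable M \<eta>" and G: "\<And>f :: 'x \<Rightarrow> real. bounded_linear f \<Longrightarrow> (\<lambda>\<omega>. f (\<eta> \<omega>)) \<in> G"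
    and V: "semi_inner_on V ip"
    and J: "\<And>h. h \<in> V \<Longrightarrow> J h \<in> G" "\<And>h h'. h \<in> V \<Longrightarrow> h' \<in> V \<Longrightarrow> cov M (J h) (J h') = ip h h'"
    and A: "\<And>h. h \<in> V \<Longrightarrow> A h = expectation (\<lambda>\<omega>. J h \<omega> *\<^sub>R \<eta> \<omega>)"
  shows "gamma_radonifying V ip A"
proof -
  interpret V: semi_inner_on V ip by fact
  have lt_top: "gamma_norm V ip B < \<infinity>"
    if "sq_integrable M \<zeta>" "\<And>f :: 'x \<Rightarrow> real. bounded_linear f \<Longrightarrow> (\<lambda>\<omega>. f (\<zeta> \<omega>)) \<in> G"
      "\<And>h. h \<in> V \<Longrightarrow> B h = expectation (\<lambda>\<omega>. J h \<omega> *\<^sub>R \<zeta> \<omega>)" for \<zeta> :: "'w \<Rightarrow> 'x" and B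
    using gamma_norm_covariance_le[of \<zeta> V J ip B] that J by (auto intro: le_less_trans)
  have "bounded_operator_on V ip A"
    \<comment> \<open>\<open>A\<close> agrees with the covariance operator only on \<open>V\<close>;
      closure of \<open>V\<close> under sums and multiples is what transfers linearity.\<close>
    using covariance_operator_bounded[OF \<eta> V J] A V.V_add V.V_scaleR
    unfolding bounded_operator_on_def by auto
  then have A_inf: "A \<in> gamma_infinity V ip"
    using lt_top[OF \<eta> G A] by (simp add: gamma_infinity_def)
  have "\<exists>B\<in>gamma_infinity V ip. finite_rank_on V B \<and> gamma_norm V ip (\<lambda>h. A h - B h) < ennreal e"
    if e: "0 < e" for e
  proof -
    obtain n Z where Z: "orthonormal_on G (cov M) n Z"
      and less: "expectation (\<lambda>\<omega>. (norm (\<eta> \<omega> - cond_sum n Z \<eta> \<omega>))\<^sup>2) < e\<^sup>2"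
      using cond_sum_approx[OF \<eta> G, of "e\<^sup>2"] e by auto
    define S where "S = cond_sum n Z \<eta>"
    define B where "B h = expectation (\<lambda>\<omega>. J h \<omega> *\<^sub>R S \<omega>)" for h
    have sqS: "sq_integrable M S" unfolding S_def by (rule sq_integrable_cond_sum[OF Z])
    have SG: "(\<lambda>\<omega>. f (S \<omega>)) \<in> G" if "bounded_linear f" for f :: "'x \<Rightarrow> real"
      unfolding S_def by (rule cond_sum_in_G[OF Z \<eta> that])
    have ZG: "Z k \<in> G" if "k < n" for k using Z that by (simp add: orthonormal_on_def)
    have "bounded_operator_on V ip B"
      unfolding B_def[abs_def] by (rule covariance_operator_bounded[OF sqS V J])
    moreover have "gamma_norm V ip B < \<infinity>" by (rule lt_top[OF sqS SG]) (auto simp: B_def)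
    ultimately have "B \<in> gamma_infinity V ip" by (simp add: gamma_infinity_def)
    moreover have "finite_rank_on V B"
      unfolding finite_rank_on_def
    proof (intro exI conjI)
      let ?F = "(\<lambda>k. expectation (\<lambda>\<omega>. Z k \<omega> *\<^sub>R \<eta> \<omega>)) ` {..<n}"
      show "finite ?F" by simp
      show "B ` V \<subseteq> span ?F"
      proof safe
        fix h assume h: "h \<in> V"
        have "B h = expectation (\<lambda>\<omega>. \<Sum>k<n. (J h \<omega> * Z k \<omega>) *\<^sub>R expectation (\<lambda>\<omega>. Z k \<omega> *\<^sub>R \<eta> \<omega>))"
          by (simp add: B_def S_def cond_sum_def scaleR_sum_right)
        also have "\<dots> = (\<Sum>k<n. expectation (\<lambda>\<omega>. (J h \<omega> * Z k \<omega>) *\<^sub>R expectation (\<lambda>\<omega>. Z k \<omega> *\<^sub>R \<eta> \<omega>)))"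
          by (rule Bochner_Integration.integral_sum)
            (use sq_integrable_mult[OF G_sq_integrable[OF J(1)[OF h]] G_sq_integrable[OF ZG]] in auto)
        also have "\<dots> = (\<Sum>k<n. cov M (J h) (Z k) *\<^sub>R expectation (\<lambda>\<omega>. Z k \<omega> *\<^sub>R \<eta> \<omega>))"
          using sq_integrable_mult[OF G_sq_integrable[OF J(1)[OF h]] G_sq_integrable[OF ZG]]
          by (intro sum.cong) (auto simp: cov_def)
        finally have "B h = (\<Sum>k<n. cov M (J h) (Z k) *\<^sub>R expectation (\<lambda>\<omega>. Z k \<omega> *\<^sub>R \<eta> \<omega>))" .
        then show "B h \<in> span ?F" by (simp only:) (intro span_sum span_scale span_base imageI, simp)
      qed
    qed
    moreover have "gamma_norm V ip (\<lambda>h. A h - B h) < ennreal e"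
    proof -
      have sqd: "sq_integrable M (\<lambda>\<omega>. \<eta> \<omega> - S \<omega>)" by (rule sq_integrable_diff[OF \<eta> sqS])
      have "gamma_norm V ip (\<lambda>h. A h - B h) \<le> ennreal (sqrt (expectation (\<lambda>\<omega>. (norm (\<eta> \<omega> - S \<omega>))\<^sup>2)))"
      proof (rule gamma_norm_covariance_le[OF sqd _ J])
        show "(\<lambda>\<omega>. f (\<eta> \<omega> - S \<omega>)) \<in> G" if f: "bounded_linear f" for f :: "'x \<Rightarrow> real"
          using G_diff[OF G[OF f] SG[OF f]] linear_diff[OF bounded_linear.linear[OF f]] by simp
        show "A h - B h = expectation (\<lambda>\<omega>. J h \<omega> *\<^sub>R (\<eta> \<omega> - S \<omega>))" if h: "h \<in> V" for h
          using sq_integrable_times[OF G_sq_integrable[OF J(1)[OF h]] \<eta>]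
            sq_integrable_times[OF G_sq_integrable[OF J(1)[OF h]] sqS]
          by (simp add: A[OF h] B_def scaleR_diff_right)
      qed
      also have "sqrt (expectation (\<lambda>\<omega>. (norm (\<eta> \<omega> - S \<omega>))\<^sup>2)) < sqrt (e\<^sup>2)"
        using less unfolding S_def by (simp only: real_sqrt_less_iff)
      then have "ennreal (sqrt (expectation (\<lambda>\<omega>. (norm (\<eta> \<omega> - S \<omega>))\<^sup>2))) < ennreal e"
        using e by (intro ennreal_lessI) auto
      finally show ?thesis .
    qed
    ultimately show ?thesis by blast
  qed
  then show ?thesis using A_inf by (simp add: gamma_radonifying_def)
qed

end

lemma rkbs_bounded_linear:
  assumes "rkbs emb"
  shows "bounded_linear (\<lambda>x. emb x t)"
proof -
  have lin: "linear (\<lambda>x. emb x t)"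
    using assms by (intro linearI) (auto simp: rkbs_def linear_add linear_cmul scaleR_fun_apply)
  have "continuous_on UNIV (\<lambda>x. emb x t)" using assms by (simp add: rkbs_def)
  then have "isCont (\<lambda>x. emb x t) 0" by (simp add: continuous_on_eq_continuous_at)
  then obtain d where d: "0 < d" "\<And>x. norm x < d \<Longrightarrow> \<bar>emb x t\<bar> < 1"
    using linear_0[OF lin] unfolding continuous_at_eps_delta
    by (metis dist_norm diff_zero real_norm_def zero_less_one)
  have "\<bar>emb x t\<bar> \<le> norm x * (2 / d)" for x
  proof (cases "x = 0")
    case False
    \<comment> \<open>The rescaled vector has norm \<open>d / 2\<close>, strictly inside the radius
      on which the evaluation is below 1.\<close>
    define c where "c = d / (2 * norm x)"
    have c: "0 < c" using d(1) False by (simp add: c_def)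
    have "norm (c *\<^sub>R x) = d / 2" using False c d(1) by (simp add: c_def)
    then have "\<bar>emb (c *\<^sub>R x) t\<bar> < 1" using d by simp
    then have "c * \<bar>emb x t\<bar> < 1" using linear_cmul[OF lin, of c x] c by (simp add: abs_mult)
    then have "\<bar>emb x t\<bar> < 1 / c" using c by (simp add: field_simps)
    then show ?thesis using False d(1) by (simp add: c_def field_simps)
  qed (use linear_0[OF lin] in simp)
  then show ?thesis using lin by (intro bounded_linear_intro[where K = "2 / d"]) (auto simp: linear_add[OF lin] linear_cmul[OF lin])
qed

lemma process_sq_integrable:
  assumes "prob_space M" "centered_gaussian_process M \<xi>"
  shows "sq_integrable M (\<xi> t)"
  using prob_space.centered_gaussian_imp_char(1)[OF assms(1) span_process_gaussian[OF assms(2) span_base[of "\<xi> t"]]] by blast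

lemma gaussian_element_imp_radonifying:
  fixes M :: "'w measure"
    and emb :: "'x::{banach,second_countable_topology} \<Rightarrow> 't \<Rightarrow> real"
    and \<xi> :: "'t \<Rightarrow> 'w \<Rightarrow> real"
  assumes M: "prob_space M" and emb: "rkbs emb" and \<xi>: "centered_gaussian_process M \<xi>"
    and \<eta>: "centered_gaussian_element M \<eta>" and eq: "\<And>t. AE \<omega> in M. \<xi> t \<omega> = emb (\<eta> \<omega>) t"
    and V: "is_rkhs (covariance_function M \<xi>) V ip"
  shows "V \<subseteq> range emb \<and> gamma_radonifying V ip (inv emb)"
proof -
  interpret prob_space M by fact
  note \<xi>sq = process_sq_integrable[OF M \<xi>]
  have "(borel_measurable M :: ('w \<Rightarrow> 'x) set) = measurable M dual_algebra"
    by (rule measurable_cong_sets) (simp_all add: sets_dual_algebra)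
  then have \<eta>m[measurable]: "\<eta> \<in> borel_measurable M" using \<eta> by (simp add: centered_gaussian_element_def)
  have gauss: "centered_gaussian M (\<lambda>\<omega>. f (\<eta> \<omega>))" if "bounded_linear f" for f :: "'x \<Rightarrow> real"
    using \<eta> that by (simp add: centered_gaussian_element_def comp_def)
  have sq: "sq_integrable M \<eta>" by (rule gaussian_sq_integrable[OF M \<eta>m gauss])
  \<comment> \<open>All functionals are taken, not only the evaluations, since the reflection
    argument must recognise every functional of \<open>\<eta>\<close> as a member of
    \<open>G\<close>.\<close>
  define W where "W = {\<lambda>\<omega>. f (\<eta> \<omega>) | f :: 'x \<Rightarrow> real. bounded_linear f}"
  have W: "subspace W"
    unfolding subspace_def
  proof (intro conjI ballI allI)
    show "0 \<in> W" unfolding W_def by (auto intro!: exI[of _ "\<lambda>_. 0"] bounded_linear_zero)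
    show "x + y \<in> W" if xy: "x \<in> W" "y \<in> W" for x y
    proof -
      obtain f g where "bounded_linear f" "bounded_linear g" "x = (\<lambda>\<omega>. f (\<eta> \<omega>))" "y = (\<lambda>\<omega>. g (\<eta> \<omega>))"
        using xy unfolding W_def by blast
      then show ?thesis unfolding W_def by (auto intro!: exI[of _ "\<lambda>a. f a + g a"] bounded_linear_add)
    qed
    show "c *\<^sub>R x \<in> W" if x: "x \<in> W" for c x
    proof -
      obtain f where "bounded_linear f" "x = (\<lambda>\<omega>. f (\<eta> \<omega>))" using x unfolding W_def by blast
      then show ?thesis unfolding W_def
        by (auto intro!: exI[of _ "\<lambda>a. c * f a"] bounded_linear_const_mult simp: scaleR_fun_def)
    qed
  qed
  have Wg: "centered_gaussian M Y" if "Y \<in> W" for Y using that gauss unfolding W_def by blast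
  define G where "G = L2_closure M W"
  interpret G: gaussian_space M G unfolding G_def by (rule gaussian_space_L2_closure[OF M W Wg])
  have WG: "W \<subseteq> G" unfolding G_def
    by (rule L2_closure_superset) (use Wg centered_gaussian_imp_char(1) in blast)
  have fG: "(\<lambda>\<omega>. f (\<eta> \<omega>)) \<in> G" if "bounded_linear f" for f :: "'x \<Rightarrow> real"
    using WG that unfolding W_def by blast
  have \<xi>G: "\<xi> t \<in> G" for t
  proof (rule G.G_AE_cong[OF fG[OF rkbs_bounded_linear[OF emb, of t]] sq_integrableD(1)[OF \<xi>sq[of t]]])
    show "AE \<omega> in M. emb (\<eta> \<omega>) t = \<xi> t \<omega>" using eq[of t] by eventually_elim simp
  qed
  have "span (range \<xi>) \<subseteq> G" using \<xi>G by (intro span_minimal G.G_subspace) auto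
  then have closure: "L2_closure M (span (range \<xi>)) \<subseteq> G" by (rule G.L2_closure_subset)
  obtain J where J0: "\<forall>x\<in>V. J x \<in> L2_closure M (span (range \<xi>)) \<and> (\<forall>t. cov M (J x) (\<xi> t) = x t)"
      "\<forall>x\<in>V. \<forall>y\<in>V. cov M (J x) (J y) = ip x y"
    using rkhs_isometry[OF M \<xi>sq V] by blast
  have J: "J x \<in> G" "cov M (J x) (\<xi> t) = x t" if "x \<in> V" for x t
    using J0(1) closure that by auto
  have iso: "cov M (J x) (J y) = ip x y" if "x \<in> V" "y \<in> V" for x y using J0(2) that by simp
  \<comment> \<open>Evaluation at \<open>t\<close> passes under the Bochner integral and turns
    \<open>\<eta>\<close> into \<open>\<xi> t\<close>, which leaves
    \<open>cov M (J x) (\<xi> t) = x t\<close>. This yields at once the inclusion and the formula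
    for the embedding.\<close>
  have emb_eq: "emb (expectation (\<lambda>\<omega>. J x \<omega> *\<^sub>R \<eta> \<omega>)) = x" if x: "x \<in> V" for x
  proof
    fix t
    note b = rkbs_bounded_linear[OF emb, of t]
    note [measurable] = G.G_borel[OF J(1)[OF x]] G.G_borel[OF \<xi>G] bounded_linear_borel[OF b]
    have "emb (expectation (\<lambda>\<omega>. J x \<omega> *\<^sub>R \<eta> \<omega>)) t = expectation (\<lambda>\<omega>. emb (J x \<omega> *\<^sub>R \<eta> \<omega>) t)"
      by (rule integral_bounded_linear[OF b sq_integrable_times[OF G.G_sq_integrable[OF J(1)[OF x]] sq], symmetric])
    also have "\<dots> = expectation (\<lambda>\<omega>. J x \<omega> * emb (\<eta> \<omega>) t)"
      using linear_cmul[OF bounded_linear.linear[OF b]] by simp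
    also have "\<dots> = cov M (J x) (\<xi> t)"
      unfolding cov_def
    proof (rule integral_cong_AE)
      show "AE \<omega> in M. J x \<omega> * emb (\<eta> \<omega>) t = J x \<omega> * \<xi> t \<omega>" using eq[of t] by eventually_elim simp
    qed measurable
    also have "\<dots> = x t" by (rule J(2)[OF x])
    finally show "emb (expectation (\<lambda>\<omega>. J x \<omega> *\<^sub>R \<eta> \<omega>)) t = x t" .
  qed
  have "V \<subseteq> range emb" using emb_eq by (metis rangeI subsetI)
  moreover have "gamma_radonifying V ip (inv emb)"
  proof (rule G.gamma_radonifying_covariance[OF sq fG _ J(1) iso])
    show "semi_inner_on V ip"
      using V hilbert_on_imp_semi_inner_on by (auto simp: is_rkhs_def)
    show "inv emb h = expectation (\<lambda>\<omega>. J h \<omega> *\<^sub>R \<eta> \<omega>)" if "h \<in> V" for h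
      using inv_f_f[of emb "expectation (\<lambda>\<omega>. J h \<omega> *\<^sub>R \<eta> \<omega>)"] emb emb_eq[OF that] by (simp add: rkbs_def)
  qed
  ultimately show ?thesis by blast
qed

section \<open>From the embedding to the random element\<close>

text \<open>When a generator is added, the common kernel of the chosen functionals in the span grows
  from zero to at most a line. One more functional, nonzero on that line, removes it.\<close>

lemma finite_separating_subset:
  fixes \<Lambda> :: "'t \<Rightarrow> 'x::real_vector \<Rightarrow> real"
  assumes lin: "\<And>t. linear (\<Lambda> t)" and sep: "\<And>x. (\<And>t. \<Lambda> t x = 0) \<Longrightarrow> x = 0" and "finite F"
  shows "\<exists>T. finite T \<and> (\<forall>x\<in>span F. (\<forall>t\<in>T. \<Lambda> t x = 0) \<longrightarrow> x = 0)"
  using \<open>finite F\<close>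
proof (induction F rule: finite_induct)
  case empty
  show ?case by (intro exI[of _ "{}"]) simp
next
  case (insert a F)
  then obtain T where T: "finite T" "\<And>x. x \<in> span F \<Longrightarrow> (\<And>t. t \<in> T \<Longrightarrow> \<Lambda> t x = 0) \<Longrightarrow> x = 0" by blast
  show ?case
  proof (cases "\<forall>x\<in>span (insert a F). (\<forall>t\<in>T. \<Lambda> t x = 0) \<longrightarrow> x = 0")
    case True
    with T(1) show ?thesis by blast
  next
    case False
    then obtain y where y: "y \<in> span (insert a F)" "\<And>t. t \<in> T \<Longrightarrow> \<Lambda> t y = 0" "y \<noteq> 0" by blast
    obtain s where s: "\<Lambda> s y \<noteq> 0" using sep y(3) by blast
    obtain l where l: "y - l *\<^sub>R a \<in> span F" using y(1) by (auto simp: span_breakdown_eq)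
    \<comment> \<open>Otherwise \<open>y\<close> would lie in \<open>span F\<close>, where
      \<open>T\<close> already separates. Since \<open>l\<close> is nonzero, a multiple of
      \<open>y\<close> can cancel the component of any \<open>x\<close> along
      \<open>a\<close>.\<close>
    have "l \<noteq> 0" using l T(2)[of y] y(2,3) by auto
    have "x = 0" if x: "x \<in> span (insert a F)" "\<forall>t\<in>insert s T. \<Lambda> t x = 0" for x
    proof -
      obtain k where k: "x - k *\<^sub>R a \<in> span F" using x(1) by (auto simp: span_breakdown_eq)
      have "x - (k / l) *\<^sub>R y = (x - k *\<^sub>R a) - (k / l) *\<^sub>R (y - l *\<^sub>R a)"
        using \<open>l \<noteq> 0\<close> by (simp add: scaleR_diff_right)
      then have "x - (k / l) *\<^sub>R y \<in> span F" by (simp only:) (intro span_diff span_scale k l)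
      moreover have "\<Lambda> t (x - (k / l) *\<^sub>R y) = \<Lambda> t x - (k / l) * \<Lambda> t y" for t
        by (simp add: linear_diff[OF lin] linear_cmul[OF lin])
      ultimately have "x - (k / l) *\<^sub>R y = 0" by (intro T(2)) (use x(2) y(2) in simp_all)
      then have "x = (k / l) *\<^sub>R y" by simp
      then have "(k / l) * \<Lambda> s y = 0" using x(2) linear_cmul[OF lin, of s "k / l" y] by simp
      with s \<open>x = (k / l) *\<^sub>R y\<close> show ?thesis by simp
    qed
    with T(1) show ?thesis by (intro exI[of _ "insert s T"]) blast
  qed
qed

lemma bounded_operator_on_sum:
  assumes B: "bounded_operator_on V ip B" and V: "subspace V" and h: "\<And>k. k \<in> I \<Longrightarrow> h k \<in> V"
  shows "B (\<Sum>k\<in>I. c k *\<^sub>R h k) = (\<Sum>k\<in>I. c k *\<^sub>R B (h k))"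
proof -
  have add: "\<And>x y. x \<in> V \<Longrightarrow> y \<in> V \<Longrightarrow> B (x + y) = B x + B y"
    and scale: "\<And>c x. x \<in> V \<Longrightarrow> B (c *\<^sub>R x) = c *\<^sub>R B x"
    using B by (auto simp: bounded_operator_on_def)
  have "B 0 = 0" using scale[OF subspace_0[OF V], of 0] by simp
  then show ?thesis using h
  proof (induction I rule: infinite_finite_induct)
    case (insert i I)
    have "(\<Sum>k\<in>I. c k *\<^sub>R h k) \<in> V" using insert V by (intro subspace_sum subspace_scale) auto
    then show ?case using insert V by (simp add: add scale subspace_scale)
  qed auto
qed

lemma orthonormal_basis_of_finite:
  assumes H: "hilbert_on V ip" and P: "finite P" "P \<subseteq> V"
  shows "\<exists>n h. orthonormal_on V ip n h \<and> (\<forall>p\<in>P. p = (\<Sum>k<n. ip p (h k) *\<^sub>R h k))"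
proof -
  interpret V: semi_inner_on V ip by (rule hilbert_on_imp_semi_inner_on[OF H])
  have definite: "x = 0" if "x \<in> V" "ip x x = 0" for x using H that by (simp add: hilbert_on_def)
  obtain n h where h: "orthonormal_on V ip n h"
    and res: "\<And>p. p \<in> P \<Longrightarrow> ip (p - (\<Sum>k<n. ip p (h k) *\<^sub>R h k)) (p - (\<Sum>k<n. ip p (h k) *\<^sub>R h k)) = 0"
    using V.gram_schmidt[OF P] by blast
  have "p - (\<Sum>k<n. ip p (h k) *\<^sub>R h k) = 0" if "p \<in> P" for p
    using definite[OF V.orthonormal_residual(1)[OF h] res[OF that]] that P(2) by blast
  then show ?thesis using h by (intro exI[of _ n] exI[of _ h]) simp
qed

text \<open>Says that \<open>B\<close> factors through the orthogonal projection onto the span of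
  the \<open>h k\<close>; for linear \<open>B\<close> this means that it vanishes on the orthogonal
  complement.\<close>

definition expands :: "'h::real_vector set \<Rightarrow> ('h \<Rightarrow> 'h \<Rightarrow> real) \<Rightarrow> ('h \<Rightarrow> 'x::real_vector) \<Rightarrow> nat \<Rightarrow> (nat \<Rightarrow> 'h) \<Rightarrow> bool"
  where "expands V ip B n h \<longleftrightarrow>
    orthonormal_on V ip n h \<and> (\<forall>x\<in>V. B x = (\<Sum>k<n. ip x (h k) *\<^sub>R B (h k)))"

text \<open>Finitely many of the \<open>\<Lambda> t\<close> separate the points of a
  finite-dimensional space containing the range of \<open>B\<close>. Each composition of such a
  \<open>\<Lambda> t\<close> with \<open>B\<close> is represented by a vector \<open>p t\<close>;
  \<open>B\<close> vanishes on vectors orthogonal to all of these, so an orthonormal basis of their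
  span serves as \<open>h\<close>.\<close>

lemma finite_rank_expands:
  fixes B :: "'h::real_vector \<Rightarrow> 'x::real_normed_vector" and \<Lambda> :: "'t \<Rightarrow> 'x \<Rightarrow> real"
  assumes H: "hilbert_on V ip" and B: "bounded_operator_on V ip B" "finite_rank_on V B"
    and \<Lambda>: "\<And>t. bounded_linear (\<Lambda> t)" "\<And>x. (\<And>t. \<Lambda> t x = 0) \<Longrightarrow> x = 0"
  shows "\<exists>n h. expands V ip B n h"
proof -
  interpret V: semi_inner_on V ip by (rule hilbert_on_imp_semi_inner_on[OF H])
  have add: "\<And>x y. x \<in> V \<Longrightarrow> y \<in> V \<Longrightarrow> B (x + y) = B x + B y"
    and scale: "\<And>c x. x \<in> V \<Longrightarrow> B (c *\<^sub>R x) = c *\<^sub>R B x"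
    using B(1) by (auto simp: bounded_operator_on_def)
  obtain C where C: "\<And>x. x \<in> V \<Longrightarrow> norm (B x) \<le> C * sqrt (ip x x)"
    using B(1) unfolding bounded_operator_on_def by blast
  obtain F where F: "finite F" "B ` V \<subseteq> span F" using B(2) by (auto simp: finite_rank_on_def)
  obtain T where T: "finite T" "\<And>x. x \<in> span F \<Longrightarrow> (\<And>t. t \<in> T \<Longrightarrow> \<Lambda> t x = 0) \<Longrightarrow> x = 0"
    using finite_separating_subset[of \<Lambda>, OF bounded_linear.linear[OF \<Lambda>(1)] \<Lambda>(2) F(1)] by blast
  have "\<exists>p\<in>V. \<forall>x\<in>V. ip p x = \<Lambda> t (B x)" for t
  proof -
    obtain D where D: "\<And>x. \<bar>\<Lambda> t x\<bar> \<le> norm x * D" "0 \<le> D"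
      using bounded_linear.nonneg_bounded[OF \<Lambda>(1)[of t]] by auto
    have bound: "\<bar>\<Lambda> t (B x)\<bar> \<le> (C * D) * sqrt (ip x x)" if "x \<in> V" for x
    proof -
      have "\<bar>\<Lambda> t (B x)\<bar> \<le> norm (B x) * D" by (rule D(1))
      also have "\<dots> \<le> (C * sqrt (ip x x)) * D" by (rule mult_right_mono[OF C[OF that] D(2)])
      finally show ?thesis by (simp add: ac_simps)
    qed
    have lin: "linear (\<Lambda> t)" by (rule bounded_linear.linear[OF \<Lambda>(1)])
    have "\<exists>p\<in>V. (\<forall>u\<in>V. ip p u = \<Lambda> t (B u)) \<and> (\<exists>u. (\<forall>n. u n \<in> V) \<and> (\<lambda>n. ip (u n - p) (u n - p)) \<longlonglongrightarrow> 0)"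
      by (rule hilbert_representation[OF H V.subspace order_refl _ _ bound])
        (auto simp: add scale linear_add[OF lin] linear_cmul[OF lin])
    then show ?thesis by blast
  qed
  then obtain p where p: "\<And>t. p t \<in> V" "\<And>t x. x \<in> V \<Longrightarrow> ip (p t) x = \<Lambda> t (B x)" by metis
  have pV: "p ` T \<subseteq> V" using p(1) by blast
  obtain n h where h: "orthonormal_on V ip n h" and ph: "\<And>t. t \<in> T \<Longrightarrow> p t = (\<Sum>k<n. ip (p t) (h k) *\<^sub>R h k)"
    using orthonormal_basis_of_finite[OF H finite_imageI[OF T(1)] pV] by blast
  have hV: "h k \<in> V" if "k < n" for k using h that by (simp add: orthonormal_on_def)
  have "B x = (\<Sum>k<n. ip x (h k) *\<^sub>R B (h k))" if x: "x \<in> V" for x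
  proof -
    define s where "s = (\<Sum>k<n. ip x (h k) *\<^sub>R h k)"
    have sV: "s \<in> V" unfolding s_def by (intro V.V_sum V.V_scaleR) (use hV in auto)
    have yV: "x - s \<in> V" by (rule V.V_diff[OF x sV])
    have "\<Lambda> t (B (x - s)) = 0" if t: "t \<in> T" for t
    proof -
      have "\<Lambda> t (B (x - s)) = ip (\<Sum>k<n. ip (p t) (h k) *\<^sub>R h k) (x - s)"
        using p(2)[OF yV, of t] ph[OF t] by simp
      also have "\<dots> = (\<Sum>k<n. 0)"
      proof (subst V.ip_sum[OF _ yV])
        show "(\<Sum>k<n. ip (ip (p t) (h k) *\<^sub>R h k) (x - s)) = (\<Sum>k<n. 0)"
        proof (rule sum.cong[OF refl])
          fix k assume "k \<in> {..<n}"
          then have k: "k < n" by simp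
          have "ip (h k) (x - s) = ip (x - s) (h k)" by (rule V.ip_sym[OF hV[OF k] yV])
          also have "\<dots> = 0" unfolding s_def by (rule V.orthonormal_residual(2)[OF h x k])
          finally show "ip (ip (p t) (h k) *\<^sub>R h k) (x - s) = 0" by (simp add: V.ip_scaleR[OF hV[OF k] yV])
        qed
      qed (use hV V.V_scaleR in auto)
      finally show ?thesis by simp
    qed
    moreover have "B (x - s) \<in> span F" using F(2) yV by blast
    ultimately have "B (x - s) = 0" using T(2) by blast
    moreover have "B x = B (x - s) + B s" using add[OF yV sV] by simp
    ultimately have "B x = B s" by simp
    also have "B s = (\<Sum>k<n. ip x (h k) *\<^sub>R B (h k))"
      unfolding s_def by (rule bounded_operator_on_sum[OF B(1) V.subspace]) (use hV in auto)
    finally show ?thesis .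
  qed
  then show ?thesis using h unfolding expands_def by blast
qed

section \<open>Random sums attached to operators of finite rank\<close>

context gaussian_space
begin

text \<open>\<open>J\<close> respects finite expansions only almost surely. The variance of
  \<open>J h\<close>, that of the sum, and their covariance all equal the sum of the squared
  coefficients, so the difference is null.\<close>

lemma isometry_expansion:
  assumes V: "semi_inner_on V ip"
    and J: "\<And>h. h \<in> V \<Longrightarrow> J h \<in> G" "\<And>h h'. h \<in> V \<Longrightarrow> h' \<in> V \<Longrightarrow> cov M (J h) (J h') = ip h h'"
    and g: "orthonormal_on V ip m g" and h: "h \<in> V" "h = (\<Sum>k<m. ip h (g k) *\<^sub>R g k)"
  shows "AE \<omega> in M. J h \<omega> = (\<Sum>k<m. ip h (g k) * J (g k) \<omega>)"
proof -
  interpret V: semi_inner_on V ip by fact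
  interpret G: semi_inner_on G "cov M" by (rule semi_inner_on_G)
  have gV: "g k \<in> V" if "k < m" for k using g that by (simp add: orthonormal_on_def)
  have Jg: "orthonormal_on G (cov M) m (\<lambda>k. J (g k))"
    using g J gV by (simp add: orthonormal_on_def)
  define S where "S = (\<lambda>\<omega>. \<Sum>k<m. ip h (g k) * J (g k) \<omega>)"
  have S: "S \<in> G" unfolding S_def by (rule orthonormal_sum_cov(1)[OF Jg])
  note Jh = J(1)[OF h(1)]
  have "cov M S S = (\<Sum>k<m. (ip h (g k))\<^sup>2)" unfolding S_def by (rule orthonormal_sum_cov(2)[OF Jg])
  moreover have "cov M S (J h) = (\<Sum>k<m. (ip h (g k))\<^sup>2)"
    unfolding S_def orthonormal_sum_cov(3)[OF Jg Jh]
    using J(2)[OF gV h(1)] V.ip_sym[OF gV h(1)] by (intro sum.cong) (auto simp: power2_eq_square)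
  moreover have "cov M (J h) (J h) = (\<Sum>k<m. (ip h (g k))\<^sup>2)"
  proof -
    have "ip h h = ip (\<Sum>k<m. ip h (g k) *\<^sub>R g k) h" by (rule arg_cong[where f = "\<lambda>x. ip x h", OF h(2)])
    also have "\<dots> = (\<Sum>k<m. ip (ip h (g k) *\<^sub>R g k) h)"
      by (rule V.ip_sum) (use gV V.V_scaleR h(1) in auto)
    also have "\<dots> = (\<Sum>k<m. (ip h (g k))\<^sup>2)"
      using V.ip_scaleR[OF gV h(1)] V.ip_sym[OF gV h(1)] by (intro sum.cong) (auto simp: power2_eq_square)
    finally show ?thesis using J(2)[OF h(1) h(1)] by simp
  qed
  ultimately have "cov M (J h - S) (J h - S) = 0"
    using G.ip_diff_self[OF Jh S] G.ip_sym[OF S Jh] by simp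
  then have "AE \<omega> in M. (J h - S) \<omega> = 0"
    using expectation_sq_eq_0[OF G_sq_integrable[OF G.V_diff[OF Jh S]]] by (simp add: cov_self)
  then show ?thesis by eventually_elim (simp add: S_def)
qed

text \<open>Expand each \<open>J (h j)\<close> in the system \<open>g\<close> and each
  \<open>B (g k)\<close> in the system \<open>h\<close>: both sides become the same double sum.
  Hence the random sum attached to \<open>B\<close> can be moved into a system shared with other
  operators.\<close>

lemma expands_change_basis:
  fixes B :: "'h::real_vector \<Rightarrow> 'x::{banach, second_countable_topology}"
  assumes V: "semi_inner_on V ip"
    and J: "\<And>h. h \<in> V \<Longrightarrow> J h \<in> G" "\<And>h h'. h \<in> V \<Longrightarrow> h' \<in> V \<Longrightarrow> cov M (J h) (J h') = ip h h'"
    and g: "orthonormal_on V ip m g" and B: "expands V ip B n h"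
    and hg: "\<And>j. j < n \<Longrightarrow> h j = (\<Sum>k<m. ip (h j) (g k) *\<^sub>R g k)"
  shows "AE \<omega> in M. (\<Sum>j<n. J (h j) \<omega> *\<^sub>R B (h j)) = (\<Sum>k<m. J (g k) \<omega> *\<^sub>R B (g k))"
proof -
  interpret V: semi_inner_on V ip by fact
  have gV: "g k \<in> V" if "k < m" for k using g that by (simp add: orthonormal_on_def)
  have hV: "h k \<in> V" if "k < n" for k using B that by (simp add: expands_def orthonormal_on_def)
  have Bg: "B (g k) = (\<Sum>j<n. ip (g k) (h j) *\<^sub>R B (h j))" if "k < m" for k
    using B gV[OF that] by (simp add: expands_def)
  have "AE \<omega> in M. \<forall>j\<in>{..<n}. J (h j) \<omega> = (\<Sum>k<m. ip (h j) (g k) * J (g k) \<omega>)"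
    by (rule AE_finite_allI) (use isometry_expansion[OF V J g hV hg] in auto)
  then show ?thesis
  proof eventually_elim
    fix \<omega> assume \<omega>: "\<forall>j\<in>{..<n}. J (h j) \<omega> = (\<Sum>k<m. ip (h j) (g k) * J (g k) \<omega>)"
    have "(\<Sum>k<m. J (g k) \<omega> *\<^sub>R B (g k)) = (\<Sum>k<m. \<Sum>j<n. (ip (h j) (g k) * J (g k) \<omega>) *\<^sub>R B (h j))"
      using V.ip_sym[OF hV gV] by (intro sum.cong) (auto simp: Bg scaleR_sum_right mult.commute intro!: sum.cong)
    also have "\<dots> = (\<Sum>j<n. \<Sum>k<m. (ip (h j) (g k) * J (g k) \<omega>) *\<^sub>R B (h j))" by (rule sum.swap)
    also have "\<dots> = (\<Sum>j<n. J (h j) \<omega> *\<^sub>R B (h j))"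
      using \<omega> by (intro sum.cong) (auto simp: scaleR_sum_left)
    finally show "(\<Sum>j<n. J (h j) \<omega> *\<^sub>R B (h j)) = (\<Sum>k<m. J (g k) \<omega> *\<^sub>R B (g k))" by simp
  qed
qed

text \<open>Each orthonormal system is one of those in the supremum defining the gamma norm, and its
  Gaussian average is the second moment of the corresponding sum over \<open>M\<close>.\<close>

lemma gamma_norm_sum_le:
  fixes C :: "'h \<Rightarrow> 'x::{banach, second_countable_topology}"
  assumes J: "\<And>h. h \<in> V \<Longrightarrow> J h \<in> G" "\<And>h h'. h \<in> V \<Longrightarrow> h' \<in> V \<Longrightarrow> cov M (J h) (J h') = ip h h'"
    and g: "orthonormal_on V ip m g" and C: "gamma_norm V ip C < ennreal e" "0 \<le> e"
  shows "sq_integrable M (\<lambda>\<omega>. \<Sum>k<m. J (g k) \<omega> *\<^sub>R C (g k))"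
    and "expectation (\<lambda>\<omega>. (norm (\<Sum>k<m. J (g k) \<omega> *\<^sub>R C (g k)))\<^sup>2) \<le> e\<^sup>2"
proof -
  have gV: "g k \<in> V" if "k < m" for k using g that by (simp add: orthonormal_on_def)
  show "sq_integrable M (\<lambda>\<omega>. \<Sum>k<m. J (g k) \<omega> *\<^sub>R C (g k))"
    by (intro sq_integrable_sum sq_integrable_scaleR_left G_sq_integrable J gV) simp
  have Jg: "orthonormal_on G (cov M) m (\<lambda>k. J (g k))"
    using g J gV by (simp add: orthonormal_on_def)
  let ?I = "\<integral>x. (norm (\<Sum>k<m. x k *\<^sub>R C (g k)))\<^sup>2 \<partial>gaussian_seq"
  have "(case (m, g) of (n, h) \<Rightarrow> ennreal (sqrt (\<integral>x. (norm (\<Sum>k<n. x k *\<^sub>R C (h k)))\<^sup>2 \<partial>gaussian_seq))) \<le> gamma_norm V ip C"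
    unfolding gamma_norm_def by (rule SUP_upper) (use g in simp)
  then have "ennreal (sqrt ?I) \<le> ennreal e" using C(1) by (simp add: order.strict_implies_order[OF le_less_trans])
  then have "sqrt ?I \<le> e" using C(2) by (simp add: ennreal_le_iff)
  then have "?I \<le> e\<^sup>2" by (simp add: sqrt_le_D)
  then show "expectation (\<lambda>\<omega>. (norm (\<Sum>k<m. J (g k) \<omega> *\<^sub>R C (g k)))\<^sup>2) \<le> e\<^sup>2"
    unfolding orthonormal_sum_norm[OF Jg] .
qed

end

lemma radonifying_imp_gaussian_element:
  fixes M :: "'w measure"
    and emb :: "'x::{banach,second_countable_topology} \<Rightarrow> 't \<Rightarrow> real"
    and \<xi> :: "'t \<Rightarrow> 'w \<Rightarrow> real"
  assumes M: "prob_space M" and emb: "rkbs emb" and \<xi>: "centered_gaussian_process M \<xi>"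
    and V: "is_rkhs (covariance_function M \<xi>) V ip"
    and range: "V \<subseteq> range emb" and rad: "gamma_radonifying V ip (inv emb)"
  shows "\<exists>\<eta>. centered_gaussian_element M \<eta> \<and> (\<forall>t. AE \<omega> in M. \<xi> t \<omega> = emb (\<eta> \<omega>) t)"
proof -
  interpret prob_space M by fact
  note \<xi>sq = process_sq_integrable[OF M \<xi>]
  define G where "G = L2_closure M (span (range \<xi>))"
  interpret gaussian_space M G
    unfolding G_def by (rule gaussian_space_L2_closure[OF M subspace_span span_process_gaussian[OF \<xi>]])
  interpret Gs: semi_inner_on G "cov M" by (rule semi_inner_on_G)
  have \<xi>G: "\<xi> t \<in> G" for t
  proof -
    have "span (range \<xi>) \<subseteq> G" unfolding G_def
      by (rule L2_closure_superset) (use centered_gaussian_imp_char(1) span_process_gaussian[OF \<xi>] in blast)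
    then show ?thesis using span_base[of "\<xi> t" "range \<xi>"] by blast
  qed
  have H: "hilbert_on V ip" using V by (simp add: is_rkhs_def)
  have semi: "semi_inner_on V ip" by (rule hilbert_on_imp_semi_inner_on[OF H])
  interpret V: semi_inner_on V ip by (rule semi)
  define \<kappa> where "\<kappa> t = (\<lambda>s. covariance_function M \<xi> s t)" for t
  have \<kappa>: "\<kappa> t \<in> V" "x \<in> V \<Longrightarrow> ip x (\<kappa> t) = x t" for t x
    using V by (auto simp: is_rkhs_def \<kappa>_def)
  obtain J where J0: "\<forall>x\<in>V. J x \<in> L2_closure M (span (range \<xi>)) \<and> (\<forall>t. cov M (J x) (\<xi> t) = x t)"
      "\<forall>x\<in>V. \<forall>y\<in>V. cov M (J x) (J y) = ip x y"
    using rkhs_isometry[OF M \<xi>sq V] by blast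
  have J: "J x \<in> G" "cov M (J x) (\<xi> t) = x t" if "x \<in> V" for x t
    using J0(1) that by (auto simp: G_def)
  have iso: "cov M (J x) (J y) = ip x y" if "x \<in> V" "y \<in> V" for x y using J0(2) that by simp
  \<comment> \<open>Both variables lie in the closed span of the process and have the same
    covariance with each of its members.\<close>
  have J\<kappa>: "AE \<omega> in M. J (\<kappa> t) \<omega> = \<xi> t \<omega>" for t
  proof -
    have D: "J (\<kappa> t) - \<xi> t \<in> G" by (rule Gs.V_diff[OF J(1)[OF \<kappa>(1)] \<xi>G])
    have "cov M (J (\<kappa> t) - \<xi> t) s = 0" if s: "s \<in> range \<xi>" for s
    proof -
      obtain u where u: "s = \<xi> u" using s by (rule rangeE)
      have "cov M (J (\<kappa> t) - \<xi> t) (\<xi> u) = \<kappa> t u - cov M (\<xi> t) (\<xi> u)"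
        using Gs.ip_diff[OF J(1)[OF \<kappa>(1)] \<xi>G \<xi>G] J(2)[OF \<kappa>(1)] by simp
      then show ?thesis unfolding u \<kappa>_def covariance_function_def cov_def by (simp add: mult.commute)
    qed
    then have "cov M (J (\<kappa> t) - \<xi> t) (J (\<kappa> t) - \<xi> t) = 0"
      using D \<xi>sq by (intro L2_closure_span_orthogonal[of "range \<xi>" M "J (\<kappa> t) - \<xi> t"]) (auto simp: G_def)
    then have "AE \<omega> in M. (J (\<kappa> t) - \<xi> t) \<omega> = 0"
      using expectation_sq_eq_0[OF G_sq_integrable[OF D]] by (simp add: cov_self)
    then show ?thesis by eventually_elim simp
  qed
  define A where "A = inv emb"
  have embA: "emb (A x) = x" if "x \<in> V" for x
    unfolding A_def using range that by (auto intro: f_inv_into_f)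
  note bl = rkbs_bounded_linear[OF emb]
  note lin = bounded_linear.linear[OF bl]
  have sep: "x = 0" if "\<And>t. emb x t = 0" for x
  proof -
    have "emb x = emb 0" using that linear_0[OF lin] by (simp add: fun_eq_iff)
    then show ?thesis using emb by (simp add: rkbs_def inj_eq)
  qed
  define \<epsilon> where "\<epsilon> n = (1 / 2 :: real) ^ n" for n
  have \<epsilon>_pos: "0 < \<epsilon> n" for n by (simp add: \<epsilon>_def)
  have \<epsilon>_lim: "\<epsilon> \<longlonglongrightarrow> 0" unfolding \<epsilon>_def[abs_def] by (rule LIMSEQ_power_zero) simp
  have "\<forall>n. \<exists>B. B \<in> gamma_infinity V ip \<and> finite_rank_on V B \<and> gamma_norm V ip (\<lambda>h. A h - B h) < ennreal (\<epsilon> n)"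
    using rad \<epsilon>_pos unfolding gamma_radonifying_def A_def by blast
  then obtain B where B: "\<And>n. B n \<in> gamma_infinity V ip" "\<And>n. finite_rank_on V (B n)"
      "\<And>n. gamma_norm V ip (\<lambda>h. A h - B n h) < ennreal (\<epsilon> n)" by metis
  have bop: "bounded_operator_on V ip (B n)" for n using B(1) by (simp add: gamma_infinity_def)
  have "\<exists>d h. expands V ip (B n) d h" for n
    by (rule finite_rank_expands[OF H bop B(2), where \<Lambda> = "\<lambda>t x. emb x t"]) (use bl sep in auto)
  then obtain d h where dh: "\<And>n. expands V ip (B n) (d n) (h n)" by metis
  have hV: "h n j \<in> V" if "j < d n" for n j using dh[of n] that by (simp add: expands_def orthonormal_on_def)
  define s where "s n \<omega> = (\<Sum>j<d n. J (h n j) \<omega> *\<^sub>R B n (h n j))" for n \<omega>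
  have sq_s: "sq_integrable M (s n)" for n
    unfolding s_def[abs_def] by (intro sq_integrable_sum sq_integrable_scaleR_left G_sq_integrable J hV) simp
  \<comment> \<open>A common orthonormal system for finitely many stages \<open>I\<close>, whose
    span also contains the prescribed vectors \<open>P\<close>. Comparing two stages uses an empty
    \<open>P\<close>; comparing a stage with \<open>\<xi> t\<close> puts the kernel section into
    \<open>P\<close>.\<close>
  have basis: "\<exists>m g. orthonormal_on V ip m g \<and> (\<forall>p\<in>P. p = (\<Sum>k<m. ip p (g k) *\<^sub>R g k)) \<and>
      (\<forall>i\<in>I. AE \<omega> in M. s i \<omega> = (\<Sum>k<m. J (g k) \<omega> *\<^sub>R B i (g k)))"
    if "finite P" "P \<subseteq> V" "finite I" for P I
  proof -
    define Q where "Q = P \<union> (\<Union>i\<in>I. h i ` {..<d i})"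
    have "finite Q" "Q \<subseteq> V" unfolding Q_def using that hV by auto
    then obtain m g where g: "orthonormal_on V ip m g" and Q: "\<forall>p\<in>Q. p = (\<Sum>k<m. ip p (g k) *\<^sub>R g k)"
      using orthonormal_basis_of_finite[OF H] by blast
    have "AE \<omega> in M. s i \<omega> = (\<Sum>k<m. J (g k) \<omega> *\<^sub>R B i (g k))" if "i \<in> I" for i
      unfolding s_def
    proof (rule expands_change_basis[OF semi J(1) iso g dh])
      show "h i j = (\<Sum>k<m. ip (h i j) (g k) *\<^sub>R g k)" if j: "j < d i" for j
      proof -
        have "h i j \<in> Q" unfolding Q_def using j \<open>i \<in> I\<close> by blast
        with Q show ?thesis by (rule bspec)
      qed
    qed
    moreover have "\<forall>p\<in>P. p = (\<Sum>k<m. ip p (g k) *\<^sub>R g k)" using Q by (simp add: Q_def)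
    ultimately show ?thesis using g by blast
  qed
  \<comment> \<open>In a common system, \<open>s i - s j\<close> is the difference of the two error
    sums formed with \<open>A - B j\<close> and \<open>A - B i\<close>. The sum for \<open>A\<close>
    itself is thus needed only along finite systems.\<close>
  have s_diff: "expectation (\<lambda>\<omega>. (norm (s i \<omega> - s j \<omega>))\<^sup>2) \<le> 2 * (\<epsilon> i)\<^sup>2 + 2 * (\<epsilon> j)\<^sup>2" for i j
  proof -
    obtain m g where g: "orthonormal_on V ip m g"
      and i: "AE \<omega> in M. s i \<omega> = (\<Sum>k<m. J (g k) \<omega> *\<^sub>R B i (g k))"
      and j: "AE \<omega> in M. s j \<omega> = (\<Sum>k<m. J (g k) \<omega> *\<^sub>R B j (g k))"
      using basis[of "{}" "{i, j}"] by auto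
    define D where "D i \<omega> = (\<Sum>k<m. J (g k) \<omega> *\<^sub>R (A (g k) - B i (g k)))" for i \<omega>
    have D: "sq_integrable M (D i)" "expectation (\<lambda>\<omega>. (norm (D i \<omega>))\<^sup>2) \<le> (\<epsilon> i)\<^sup>2" for i
      unfolding D_def using gamma_norm_sum_le[OF J(1) iso g B(3) less_imp_le[OF \<epsilon>_pos]] by auto
    have D': "sq_integrable M (\<lambda>\<omega>. - D i \<omega>)" for i using sq_integrable_scaleR[OF D(1), of "-1" i] by simp
    note [measurable] = sq_integrableD(1)[OF sq_s] sq_integrableD(1)[OF D(1)]
    have "AE \<omega> in M. s i \<omega> - s j \<omega> = D j \<omega> + - D i \<omega>"
      using i j by eventually_elim (simp add: D_def scaleR_diff_right sum_subtractf)
    then have "expectation (\<lambda>\<omega>. (norm (s i \<omega> - s j \<omega>))\<^sup>2) = expectation (\<lambda>\<omega>. (norm (D j \<omega> + - D i \<omega>))\<^sup>2)"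
      by (intro integral_cong_AE) (auto elim: eventually_mono)
    also have "\<dots> \<le> 2 * expectation (\<lambda>\<omega>. (norm (D j \<omega>))\<^sup>2) + 2 * expectation (\<lambda>\<omega>. (norm (- D i \<omega>))\<^sup>2)"
      by (rule expectation_add_sq_le[OF D(1) D'])
    also have "\<dots> \<le> 2 * (\<epsilon> i)\<^sup>2 + 2 * (\<epsilon> j)\<^sup>2" using D(2)[of i] D(2)[of j] by simp
    finally show ?thesis .
  qed
  \<comment> \<open>With \<open>\<kappa> t\<close> in the span of the system, \<open>\<xi> t\<close>
    has the coefficients \<open>ip (\<kappa> t) (g k)\<close>, which are the values of
    \<open>g k = emb (A (g k))\<close> at \<open>t\<close>. So
    \<open>\<xi> t - emb (s n \<omega>) t\<close> is the evaluation at \<open>t\<close> of the error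
    sum formed with \<open>A - B n\<close>.\<close>
  have eval: "expectation (\<lambda>\<omega>. (\<xi> t \<omega> - emb (s n \<omega>) t)\<^sup>2) \<le> C * (\<epsilon> n)\<^sup>2"
    if C: "0 \<le> C" "\<And>x. (emb x t)\<^sup>2 \<le> C * (norm x)\<^sup>2" for t n C
  proof -
    obtain m g where g: "orthonormal_on V ip m g" and \<kappa>g: "\<kappa> t = (\<Sum>k<m. ip (\<kappa> t) (g k) *\<^sub>R g k)"
      and n: "AE \<omega> in M. s n \<omega> = (\<Sum>k<m. J (g k) \<omega> *\<^sub>R B n (g k))"
      using basis[of "{\<kappa> t}" "{n}"] \<kappa>(1) by auto
    have gV: "g k \<in> V" if "k < m" for k using g that by (simp add: orthonormal_on_def)
    define D where "D \<omega> = (\<Sum>k<m. J (g k) \<omega> *\<^sub>R (A (g k) - B n (g k)))" for \<omega>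
    have D: "sq_integrable M D" "expectation (\<lambda>\<omega>. (norm (D \<omega>))\<^sup>2) \<le> (\<epsilon> n)\<^sup>2"
      unfolding D_def[abs_def] using gamma_norm_sum_le[OF J(1) iso g B(3) less_imp_le[OF \<epsilon>_pos]] by auto
    note [measurable] = sq_integrableD(1)[OF sq_s] sq_integrableD(1)[OF D(1)] sq_integrableD(1)[OF \<xi>sq]
      bounded_linear_borel[OF bl]
    have "AE \<omega> in M. J (\<kappa> t) \<omega> = (\<Sum>k<m. ip (\<kappa> t) (g k) * J (g k) \<omega>)"
      by (rule isometry_expansion[OF semi J(1) iso g \<kappa>(1) \<kappa>g])
    with J\<kappa>[of t] n have "AE \<omega> in M. \<xi> t \<omega> - emb (s n \<omega>) t = emb (D \<omega>) t"
    proof eventually_elim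
      fix \<omega> assume *: "J (\<kappa> t) \<omega> = \<xi> t \<omega>" "s n \<omega> = (\<Sum>k<m. J (g k) \<omega> *\<^sub>R B n (g k))"
        "J (\<kappa> t) \<omega> = (\<Sum>k<m. ip (\<kappa> t) (g k) * J (g k) \<omega>)"
      have "ip (\<kappa> t) (g k) = emb (A (g k)) t" if "k < m" for k
        using V.ip_sym[OF \<kappa>(1) gV[OF that]] \<kappa>(2)[OF gV[OF that]] embA[OF gV[OF that]] by simp
      then have "\<xi> t \<omega> = (\<Sum>k<m. J (g k) \<omega> *\<^sub>R emb (A (g k)) t)"
        unfolding *(1)[symmetric] *(3) by (intro sum.cong) auto
      moreover have "emb (s n \<omega>) t = (\<Sum>k<m. J (g k) \<omega> *\<^sub>R emb (B n (g k)) t)"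
        unfolding *(2) by (rule bounded_linear_sum_scaleR[OF bl])
      moreover have "emb (D \<omega>) t = (\<Sum>k<m. J (g k) \<omega> *\<^sub>R emb (A (g k) - B n (g k)) t)"
        unfolding D_def by (rule bounded_linear_sum_scaleR[OF bl])
      ultimately show "\<xi> t \<omega> - emb (s n \<omega>) t = emb (D \<omega>) t"
        by (simp add: linear_diff[OF lin] right_diff_distrib sum_subtractf)
    qed
    then have "expectation (\<lambda>\<omega>. (\<xi> t \<omega> - emb (s n \<omega>) t)\<^sup>2) = expectation (\<lambda>\<omega>. (emb (D \<omega>) t)\<^sup>2)"
      by (intro integral_cong_AE) (auto elim: eventually_mono)
    also have "\<dots> \<le> expectation (\<lambda>\<omega>. C * (norm (D \<omega>))\<^sup>2)"
      by (rule integral_mono)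
        (use sq_integrableD(2)[OF sq_integrable_bounded_linear[OF D(1) bl[of t]]] sq_integrableD(2)[OF D(1)] C(2) in auto)
    also have "\<dots> \<le> C * (\<epsilon> n)\<^sup>2" using D(2) C(1) by (simp add: mult_left_mono)
    finally show ?thesis .
  qed
  have \<epsilon>2: "(\<lambda>n. (\<epsilon> n)\<^sup>2) \<longlonglongrightarrow> 0" using tendsto_power[OF \<epsilon>_lim, of 2] by simp
  obtain \<eta> where \<eta>: "sq_integrable M \<eta>" and lim: "(\<lambda>n. expectation (\<lambda>\<omega>. (norm (s n \<omega> - \<eta> \<omega>))\<^sup>2)) \<longlonglongrightarrow> 0"
  proof -
    have "\<exists>N. \<forall>m\<ge>N. \<forall>n\<ge>N. expectation (\<lambda>\<omega>. (norm (s m \<omega> - s n \<omega>))\<^sup>2) < e" if e: "0 < e" for e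
    proof -
      have "\<forall>\<^sub>F n in sequentially. (\<epsilon> n)\<^sup>2 < e / 4" by (rule order_tendstoD(2)[OF \<epsilon>2]) (use e in simp)
      then obtain N where N: "\<And>n. n \<ge> N \<Longrightarrow> (\<epsilon> n)\<^sup>2 < e / 4" by (auto simp: eventually_sequentially)
      have "expectation (\<lambda>\<omega>. (norm (s m \<omega> - s n \<omega>))\<^sup>2) < e" if "m \<ge> N" "n \<ge> N" for m n
        using s_diff[of m n] N[OF that(1)] N[OF that(2)] by linarith
      then show ?thesis by blast
    qed
    from sq_integrable_complete[OF sq_s this] show ?thesis using that by blast
  qed
  have bounded_lim: "(\<lambda>n. expectation (\<lambda>\<omega>. (f (s n \<omega>) - f (\<eta> \<omega>))\<^sup>2)) \<longlonglongrightarrow> 0" if f: "bounded_linear f" for f :: "'x \<Rightarrow> real"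
  proof -
    obtain C where C: "0 \<le> C" "\<And>x. (norm (f x))\<^sup>2 \<le> C * (norm x)\<^sup>2" using bounded_linear_sq[OF f] by blast
    have z: "(\<lambda>n. C * expectation (\<lambda>\<omega>. (norm (s n \<omega> - \<eta> \<omega>))\<^sup>2)) \<longlonglongrightarrow> 0"
      using tendsto_mult_right_zero[OF lim] by simp
    have "expectation (\<lambda>\<omega>. (f (s n \<omega>) - f (\<eta> \<omega>))\<^sup>2) \<le> C * expectation (\<lambda>\<omega>. (norm (s n \<omega> - \<eta> \<omega>))\<^sup>2)" for n
    proof -
      note sqd = sq_integrable_diff[OF sq_s[of n] \<eta>]
      have "expectation (\<lambda>\<omega>. (f (s n \<omega>) - f (\<eta> \<omega>))\<^sup>2) = expectation (\<lambda>\<omega>. (f (s n \<omega> - \<eta> \<omega>))\<^sup>2)"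
        by (simp add: linear_diff[OF bounded_linear.linear[OF f]])
      also have "\<dots> \<le> expectation (\<lambda>\<omega>. C * (norm (s n \<omega> - \<eta> \<omega>))\<^sup>2)"
        by (rule integral_mono)
          (use sq_integrableD(2)[OF sq_integrable_bounded_linear[OF sqd f]] sq_integrableD(2)[OF sqd] C(2) in auto)
      finally show ?thesis by simp
    qed
    then show ?thesis by (intro tendsto_sandwich[OF _ _ tendsto_const z]) (auto intro!: always_eventually)
  qed
  have "centered_gaussian M (\<lambda>\<omega>. f (\<eta> \<omega>))" if f: "bounded_linear f" for f :: "'x \<Rightarrow> real"
  proof (rule G_gaussian, rule G_closed)
    show "sq_integrable M (\<lambda>\<omega>. f (\<eta> \<omega>))" by (rule sq_integrable_bounded_linear[OF \<eta> f])
    show "(\<lambda>\<omega>. f (s n \<omega>)) \<in> G" for n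
    proof -
      have "(\<lambda>\<omega>. f (s n \<omega>)) = (\<lambda>\<omega>. \<Sum>j<d n. f (B n (h n j)) * J (h n j) \<omega>)"
        unfolding s_def bounded_linear_sum_scaleR[OF f] by (simp add: mult.commute)
      also have "\<dots> \<in> G" by (intro G_sum G_cmult J hV) simp
      finally show ?thesis .
    qed
    show "(\<lambda>n. cov M ((\<lambda>\<omega>. f (s n \<omega>)) - (\<lambda>\<omega>. f (\<eta> \<omega>))) ((\<lambda>\<omega>. f (s n \<omega>)) - (\<lambda>\<omega>. f (\<eta> \<omega>)))) \<longlonglongrightarrow> 0"
      unfolding cov_diff_self by (rule bounded_lim[OF f])
  qed
  moreover have "\<eta> \<in> measurable M dual_algebra"
  proof -
    have "(borel_measurable M :: ('w \<Rightarrow> 'x) set) = measurable M dual_algebra"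
      by (rule measurable_cong_sets) (simp_all add: sets_dual_algebra)
    then show ?thesis using sq_integrableD(1)[OF \<eta>] by simp
  qed
  ultimately have "centered_gaussian_element M \<eta>"
    by (simp add: centered_gaussian_element_def comp_def)
  moreover have "AE \<omega> in M. \<xi> t \<omega> = emb (\<eta> \<omega>) t" for t
  proof -
    obtain C where C: "0 \<le> C" "\<And>x. (norm (emb x t))\<^sup>2 \<le> C * (norm x)\<^sup>2" using bounded_linear_sq[OF bl[of t]] by blast
    have sqd: "sq_integrable M (\<lambda>\<omega>. \<xi> t \<omega> - emb (\<eta> \<omega>) t)"
      by (rule sq_integrable_diff[OF \<xi>sq sq_integrable_bounded_linear[OF \<eta> bl]])
    have le: "expectation (\<lambda>\<omega>. (norm (\<xi> t \<omega> - emb (\<eta> \<omega>) t))\<^sup>2)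
        \<le> 2 * (C * (\<epsilon> n)\<^sup>2) + 2 * expectation (\<lambda>\<omega>. (emb (s n \<omega>) t - emb (\<eta> \<omega>) t)\<^sup>2)" for n
    proof -
      have 1: "sq_integrable M (\<lambda>\<omega>. \<xi> t \<omega> - emb (s n \<omega>) t)" "sq_integrable M (\<lambda>\<omega>. emb (s n \<omega>) t - emb (\<eta> \<omega>) t)"
        by (intro sq_integrable_diff \<xi>sq sq_integrable_bounded_linear[OF \<eta> bl] sq_integrable_bounded_linear[OF sq_s bl])+
      have "expectation (\<lambda>\<omega>. (norm (\<xi> t \<omega> - emb (\<eta> \<omega>) t))\<^sup>2)
          = expectation (\<lambda>\<omega>. (norm ((\<xi> t \<omega> - emb (s n \<omega>) t) + (emb (s n \<omega>) t - emb (\<eta> \<omega>) t)))\<^sup>2)" by simp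
      also have "\<dots> \<le> 2 * expectation (\<lambda>\<omega>. (norm (\<xi> t \<omega> - emb (s n \<omega>) t))\<^sup>2)
          + 2 * expectation (\<lambda>\<omega>. (norm (emb (s n \<omega>) t - emb (\<eta> \<omega>) t))\<^sup>2)"
        by (rule expectation_add_sq_le[OF 1])
      also have "expectation (\<lambda>\<omega>. (norm (\<xi> t \<omega> - emb (s n \<omega>) t))\<^sup>2) \<le> C * (\<epsilon> n)\<^sup>2"
        using eval[OF C(1), of t n] C(2) by simp
      finally show ?thesis by simp
    qed
    have "(\<lambda>n. 2 * (C * (\<epsilon> n)\<^sup>2) + 2 * expectation (\<lambda>\<omega>. (emb (s n \<omega>) t - emb (\<eta> \<omega>) t)\<^sup>2)) \<longlonglongrightarrow> 2 * (C * 0) + 2 * 0"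
      by (intro tendsto_intros \<epsilon>2 bounded_lim bl)
    then have "expectation (\<lambda>\<omega>. (norm (\<xi> t \<omega> - emb (\<eta> \<omega>) t))\<^sup>2) \<le> 2 * (C * 0) + 2 * 0"
      by (rule LIMSEQ_le_const) (use le in auto)
    moreover have "0 \<le> expectation (\<lambda>\<omega>. (norm (\<xi> t \<omega> - emb (\<eta> \<omega>) t))\<^sup>2)" by simp
    ultimately have "expectation (\<lambda>\<omega>. (norm (\<xi> t \<omega> - emb (\<eta> \<omega>) t))\<^sup>2) = 0" by linarith
    then have "AE \<omega> in M. \<xi> t \<omega> - emb (\<eta> \<omega>) t = 0" by (rule expectation_sq_eq_0[OF sqd])
    then show ?thesis by eventually_elim simp
  qed
  ultimately show ?thesis by blast
qed

theorem theorem5p6: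
  fixes M :: "'w measure"
    and emb :: "'x::{banach,second_countable_topology} \<Rightarrow> 't \<Rightarrow> real"
    and \<xi> :: "'t \<Rightarrow> 'w \<Rightarrow> real"
    and K :: "'t \<Rightarrow> 't \<Rightarrow> real"
  assumes "prob_space M"
    and "rkbs emb"
    and "centered_gaussian_process M \<xi>"
    and "K = covariance_function M \<xi>"
  shows "(\<exists>\<eta> :: 'w \<Rightarrow> 'x. centered_gaussian_element M \<eta> \<and>
            (\<forall>t. AE \<omega> in M. \<xi> t \<omega> = emb (\<eta> \<omega>) t))
         \<longleftrightarrow>
         (rkhs K \<subseteq> range emb \<and> gamma_radonifying (rkhs K) (rkhs_inner K) (inv emb))"
proof -
  have V: "is_rkhs (covariance_function M \<xi>) (rkhs K) (rkhs_inner K)"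
    unfolding assms(4) by (rule is_rkhs_rkhs[OF assms(1) process_sq_integrable[OF assms(1,3)]])
  show ?thesis
    using gaussian_element_imp_radonifying[OF assms(1-3) _ _ V]
      radonifying_imp_gaussian_element[OF assms(1-3) V] by blast
qed

end
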